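(* Let $A$ be a split local commutative algebra over an infinite field $k$ with Jacobson radical $J$ and $\dim_k(J/J^2)=n$. Let $r\in\mathbb{N}$ with $1\le r\le n$. Then the following statements are equivalent: (1) $G_A$ contains the diagonal changes of variables of the form $D(r,k)=\operatorname{diag}(a_1,a_2,\dots,a_{r-1},\beta,\dots,\beta)$ ($n\times n$ diagonal matrices, $\beta$ repeated $n-r+1$ times), where $a_i,\beta\in k^\times$, $1\le i\le r-1$; that is, for some presentation $A\cong k[X_1,\dots,X_n]/I$ with $I$ admissible, for all $a_1,\dots,a_{r-1},\beta\in k^\times$ the substitution $X_i\mapsto a_iX_i$ ($1\le i\le r-1$), $X_i\mapsto\beta X_i$ ($r\le i\le n$) induces an automorphism of $A$ lying in $G_A$; (2) there exists an admissible ideal $I$ which satisfies Property $*$ for $r$, or a monomial ideal $I$, such that $A\cong k[X_1,\dots,X_n]/I$. If (2) is satisfied, there is a $k$-embedding $\phi:\mathbb{G}_m^r\to G_A$.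
   Context: Algebras are finite-dimensional, unital, associative. $A$ is split local if $A/J\cong k$. $\mathrm{Aut}_k(A)$ is regarded as the affine algebraic $k$-group $B\mapsto\mathrm{Aut}_B(A\otimes_kB)$, and $G_A$ is its identity component. An ideal $I$ of $k[X_1,\dots,X_n]$ with $A\cong k[X_1,\dots,X_n]/I$ is admissible for $A$ if $\langle X_1,\dots,X_n\rangle^l\subseteq I\subseteq\langle X_1,\dots,X_n\rangle^2$ for some $l\ge2$; the minimal such $l$ is the Loewy length of $A$. Every admissible ideal can be written $I=\langle X_1,\dots,X_n\rangle^l+\langle P_1,\dots,P_m\rangle$, with $l$ the Loewy length and each non-zero $P_i$ a polynomial with $2\le\deg P_i\le l-1$ and no linear component. A non-constant homogeneous polynomial that is not a monomial is called $s$-homogeneous ($s\ge1$) if it involves only the indeterminates $X_s,\dots,X_n$. A non-constant homogeneous polynomial $f$ is called an $s$-monomial homogeneous polynomial if $f=Mg$, where $M$ is a monomial or a scalar and $g$ is an $s$-homogeneous polynomial. $I$ is called a monomial ideal if (for such a choice of generators) all $P_i$ are monomials or $0$. The admissible ideal $I$ satisfies Property $*$ for $r$ if (for such a choice of generators) there exists a $P_i$ which is an $s_i$-monomial homogeneous polynomial for some $s_i\ge r$, and for every $j\ne i$, $P_j$ is either a monomial or a $u_j$-monomial homogeneous polynomial for some $u_j\ge r$. *)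

theory Defs
  imports
    "HOL-Analysis.Abstract_Topology_2"
    "HOL-Library.Product_Plus"
    "HOL-Algebra.Algebraic_Closure_Type"
    "HOL-Algebra.Embedded_Algebras"
    "HOL-Algebra.Ideal_Product"
    "HOL-Library.Poly_Mapping"
begin

section \<open>Algebras over a field\<close>

text \<open>The parameter \<open>Basis\<close> serves as the index set for coordinates on \<open>A\<close>; it
  is inherited from the library locale for finite-dimensional vector spaces.\<close>

locale fd_comm_algebra = finite_dimensional_vector_space smul Basis
  for smul :: "'k::field \<Rightarrow> 'a::comm_ring_1 \<Rightarrow> 'a" and Basis :: "'a set" +
  assumes smul_mult_left: "smul c (x * y) = smul c x * y"

abbreviation type_ring :: "'a::ring_1 ring" where
  "type_ring \<equiv> ring_of_type_algebra"

text \<open>A \<open>k\<close>-algebra with underlying ring \<open>R\<close> is given by its structure map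
  \<open>k \<Rightarrow> R\<close>; \<open>\<rho>\<close> and \<open>\<sigma>\<close> below are the structure maps of \<open>R\<close> and \<open>S\<close>.\<close>

definition alg_hom ::
  "('k \<Rightarrow> 'r) \<Rightarrow> ('r, 'm) ring_scheme \<Rightarrow> ('k \<Rightarrow> 's) \<Rightarrow> ('s, 'n) ring_scheme \<Rightarrow> ('r \<Rightarrow> 's) set" where
  "alg_hom \<rho> R \<sigma> S = {h \<in> ring_hom R S. \<forall>c. h (\<rho> c) = \<sigma> c}"

definition alg_iso ::
  "('k \<Rightarrow> 'r) \<Rightarrow> ('r, 'm) ring_scheme \<Rightarrow> ('k \<Rightarrow> 's) \<Rightarrow> ('s, 'n) ring_scheme \<Rightarrow> ('r \<Rightarrow> 's) set" where
  "alg_iso \<rho> R \<sigma> S = {h \<in> ring_iso R S. \<forall>c. h (\<rho> c) = \<sigma> c}"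

definition jacobson_radical :: "('r, 'm) ring_scheme \<Rightarrow> 'r set" where
  "jacobson_radical R = \<Inter> {M. maximalideal M R}"

abbreviation scalar :: "('k \<Rightarrow> 'a \<Rightarrow> 'a) \<Rightarrow> 'k \<Rightarrow> 'a::one" where
  "scalar smul c \<equiv> smul c 1"

definition split_local :: "('k::field \<Rightarrow> 'a::comm_ring_1 \<Rightarrow> 'a) \<Rightarrow> bool" where
  "split_local smul \<longleftrightarrow>
     (let A = (type_ring :: 'a ring); J = jacobson_radical A in
       alg_iso (\<lambda>c. J +>\<^bsub>A\<^esub> scalar smul c) (A Quot J) (\<lambda>c. c) (type_ring :: 'k ring) \<noteq> {})"

text \<open>\<open>dim\<^sub>k (J/J\<^sup>2) = n\<close>, where \<open>J/J\<^sup>2\<close> and \<open>k\<close> are regarded as subsets of \<open>A/J\<^sup>2\<close>.\<close>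

definition cotangent_dim :: "('k::field \<Rightarrow> 'a::comm_ring_1 \<Rightarrow> 'a) \<Rightarrow> nat \<Rightarrow> bool" where
  "cotangent_dim smul n \<longleftrightarrow>
     (let A = (type_ring :: 'a ring); J = jacobson_radical A; J2 = J \<cdot>\<^bsub>A\<^esub> J in
       ring.dimension (A Quot J2) n
         (range (\<lambda>c. J2 +>\<^bsub>A\<^esub> scalar smul c)) ((\<lambda>x. J2 +>\<^bsub>A\<^esub> x) ` J))"


section \<open>Polynomials and Laurent polynomials\<close>

text \<open>Polynomials are finitely supported functions from exponents to coefficients. With
  natural exponents, \<open>mpoly_ring V\<close> is the polynomial ring in the indeterminates \<open>V\<close>;
  with integer exponents it is the Laurent polynomial ring.\<close>

definition mpoly_ring :: "'v set \<Rightarrow> (('v \<Rightarrow>\<^sub>0 'e::comm_monoid_add) \<Rightarrow>\<^sub>0 'k::comm_ring_1) ring" where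
  "mpoly_ring V = type_ring
     \<lparr>carrier := {p. \<forall>m \<in> Poly_Mapping.keys p. Poly_Mapping.keys m \<subseteq> V}\<rparr>"

definition Const :: "'k \<Rightarrow> ('e::zero \<Rightarrow>\<^sub>0 'k::zero)" where
  "Const c = Poly_Mapping.single 0 c"

definition Var :: "'v \<Rightarrow> (('v \<Rightarrow>\<^sub>0 nat) \<Rightarrow>\<^sub>0 'k::comm_ring_1)" where
  "Var i = Poly_Mapping.single (Poly_Mapping.single i 1) 1"

text \<open>Evaluation at \<open>f\<close>, the coefficients being mapped by \<open>\<rho>\<close>.\<close>

definition mpoly_eval ::
  "('k::comm_ring_1 \<Rightarrow> 'b::comm_ring_1) \<Rightarrow> ('v \<Rightarrow> 'b) \<Rightarrow> (('v \<Rightarrow>\<^sub>0 nat) \<Rightarrow>\<^sub>0 'k) \<Rightarrow> 'b" where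
  "mpoly_eval \<rho> f p = (\<Sum>m\<in>Poly_Mapping.keys p. \<rho> (Poly_Mapping.lookup p m) *
     (\<Prod>i\<in>Poly_Mapping.keys m. f i ^ Poly_Mapping.lookup m i))"

definition mon_degree :: "('v \<Rightarrow>\<^sub>0 nat) \<Rightarrow> nat" where
  "mon_degree m = (\<Sum>i\<in>Poly_Mapping.keys m. Poly_Mapping.lookup m i)"

definition total_degree :: "(('v \<Rightarrow>\<^sub>0 nat) \<Rightarrow>\<^sub>0 'k::zero) \<Rightarrow> nat" where
  "total_degree p = Max (insert 0 (mon_degree ` Poly_Mapping.keys p))"

text \<open>Monomials are taken up to a non-zero scalar factor.\<close>

definition is_monomial :: "(('v \<Rightarrow>\<^sub>0 nat) \<Rightarrow>\<^sub>0 'k::zero) \<Rightarrow> bool" where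
  "is_monomial p \<longleftrightarrow> (\<exists>m c. c \<noteq> 0 \<and> p = Poly_Mapping.single m c)"

definition nonconst_homogeneous :: "(('v \<Rightarrow>\<^sub>0 nat) \<Rightarrow>\<^sub>0 'k::zero) \<Rightarrow> bool" where
  "nonconst_homogeneous p \<longleftrightarrow>
     p \<noteq> 0 \<and> (\<exists>d\<ge>1. \<forall>m\<in>Poly_Mapping.keys p. mon_degree m = d)"


section \<open>Admissible ideals and Property \<open>*\<close>\<close>

type_synonym 'k mpoly = "(nat \<Rightarrow>\<^sub>0 nat) \<Rightarrow>\<^sub>0 'k"

abbreviation poly_ring_n :: "nat \<Rightarrow> ('k::field mpoly) ring" where
  "poly_ring_n n \<equiv> mpoly_ring {1..n}"

definition var_ideal :: "nat \<Rightarrow> ('k::field mpoly) set" where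
  "var_ideal n = Idl\<^bsub>poly_ring_n n\<^esub> (Var ` {1..n})"

definition var_ideal_power :: "nat \<Rightarrow> nat \<Rightarrow> ('k::field mpoly) set" where
  "var_ideal_power n l = var_ideal n [^]\<^bsub>ideals_set (poly_ring_n n)\<^esub> l"

definition admissible :: "nat \<Rightarrow> ('k::field mpoly) set \<Rightarrow> bool" where
  "admissible n I \<longleftrightarrow> ideal I (poly_ring_n n) \<and>
     (\<exists>l\<ge>2. var_ideal_power n l \<subseteq> I \<and> I \<subseteq> var_ideal_power n 2)"

definition loewy_length :: "nat \<Rightarrow> ('k::field mpoly) set \<Rightarrow> nat" where
  "loewy_length n I = (LEAST l. l \<ge> 2 \<and> var_ideal_power n l \<subseteq> I \<and> I \<subseteq> var_ideal_power n 2)"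

definition admissible_generators :: "nat \<Rightarrow> ('k::field mpoly) set \<Rightarrow> 'k mpoly list \<Rightarrow> bool" where
  "admissible_generators n I Ps \<longleftrightarrow>
     set Ps \<subseteq> carrier (poly_ring_n n) \<and>
     I = var_ideal_power n (loewy_length n I) <+>\<^bsub>poly_ring_n n\<^esub> (Idl\<^bsub>poly_ring_n n\<^esub> (set Ps)) \<and>
     (\<forall>P\<in>set Ps. P \<noteq> 0 \<longrightarrow>
        2 \<le> total_degree P \<and> total_degree P \<le> loewy_length n I - 1 \<and>
        (\<forall>m\<in>Poly_Mapping.keys P. mon_degree m \<noteq> 1))"

definition s_homogeneous :: "nat \<Rightarrow> nat \<Rightarrow> 'k::field mpoly \<Rightarrow> bool" where
  "s_homogeneous n s f \<longleftrightarrow> s \<ge> 1 \<and> nonconst_homogeneous f \<and> \<not> is_monomial f \<and>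
     (\<forall>m\<in>Poly_Mapping.keys f. Poly_Mapping.keys m \<subseteq> {s..n})"

definition s_monomial_homogeneous :: "nat \<Rightarrow> nat \<Rightarrow> 'k::field mpoly \<Rightarrow> bool" where
  "s_monomial_homogeneous n s f \<longleftrightarrow> nonconst_homogeneous f \<and>
     (\<exists>M\<in>carrier (poly_ring_n n). \<exists>g.
        (is_monomial M \<or> (\<exists>c. M = Const c)) \<and> s_homogeneous n s g \<and> f = M * g)"

definition monomial_ideal :: "nat \<Rightarrow> ('k::field mpoly) set \<Rightarrow> bool" where
  "monomial_ideal n I \<longleftrightarrow>
     (\<exists>Ps. admissible_generators n I Ps \<and> (\<forall>P\<in>set Ps. is_monomial P \<or> P = 0))"

definition property_star :: "nat \<Rightarrow> nat \<Rightarrow> ('k::field mpoly) set \<Rightarrow> bool" where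
  "property_star n r I \<longleftrightarrow>
     (\<exists>Ps. admissible_generators n I Ps \<and>
       (\<exists>i<length Ps. (\<exists>s\<ge>r. s_monomial_homogeneous n s (Ps ! i)) \<and>
         (\<forall>j<length Ps. j \<noteq> i \<longrightarrow>
            is_monomial (Ps ! j) \<or> (\<exists>u\<ge>r. s_monomial_homogeneous n u (Ps ! j)))))"

text \<open>The isomorphisms \<open>k[X\<^sub>1,\<dots>,X\<^sub>n]/I \<cong> A\<close> of \<open>k\<close>-algebras.\<close>

definition presentations ::
  "('k::field \<Rightarrow> 'a::comm_ring_1 \<Rightarrow> 'a) \<Rightarrow> nat \<Rightarrow> 'k mpoly set \<Rightarrow> ('k mpoly set \<Rightarrow> 'a) set" where
  "presentations smul n I =
     alg_iso (\<lambda>c. I +>\<^bsub>poly_ring_n n\<^esub> Const c) (poly_ring_n n Quot I) (scalar smul) type_ring"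


section \<open>The automorphism group scheme\<close>

subsection \<open>Base change\<close>

text \<open>For a commutative \<open>k\<close>-algebra \<open>B\<close> with structure map \<open>\<rho>\<close>, an element
  \<open>\<Sum>b\<in>Basis. b \<otimes> f b\<close> of \<open>A \<otimes>\<^sub>k B\<close> is represented by its coordinate function \<open>f\<close>,
  which vanishes outside \<open>Basis\<close>. The numbers \<open>coord smul Basis (b * c) d\<close> are the structure
  constants of \<open>A\<close>.\<close>

abbreviation coord :: "('k::field \<Rightarrow> 'a::comm_ring_1 \<Rightarrow> 'a) \<Rightarrow> 'a set \<Rightarrow> 'a \<Rightarrow> 'a \<Rightarrow> 'k" where
  "coord smul Basis \<equiv> module.representation smul Basis"

definition tensor_embed ::
  "('k::field \<Rightarrow> 'a::comm_ring_1 \<Rightarrow> 'a) \<Rightarrow> 'a set \<Rightarrow> ('k \<Rightarrow> 'b::comm_ring_1) \<Rightarrow> 'a \<Rightarrow> ('a \<Rightarrow> 'b)" where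
  "tensor_embed smul Basis \<rho> a = (\<lambda>d. \<rho> (coord smul Basis a d))"

definition tensor_mult ::
  "('k::field \<Rightarrow> 'a::comm_ring_1 \<Rightarrow> 'a) \<Rightarrow> 'a set \<Rightarrow> ('k \<Rightarrow> 'b::comm_ring_1) \<Rightarrow>
     ('a \<Rightarrow> 'b) \<Rightarrow> ('a \<Rightarrow> 'b) \<Rightarrow> ('a \<Rightarrow> 'b)" where
  "tensor_mult smul Basis \<rho> f g =
     (\<lambda>d. \<Sum>b\<in>Basis. \<Sum>c\<in>Basis. \<rho> (coord smul Basis (b * c) d) * (f b * g c))"

definition tensor_ring ::
  "('k::field \<Rightarrow> 'a::comm_ring_1 \<Rightarrow> 'a) \<Rightarrow> 'a set \<Rightarrow> ('k \<Rightarrow> 'b::comm_ring_1) \<Rightarrow> ('a \<Rightarrow> 'b) ring" where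
  "tensor_ring smul Basis \<rho> =
     \<lparr>carrier = {f. \<forall>d. d \<notin> Basis \<longrightarrow> f d = 0}, monoid.mult = tensor_mult smul Basis \<rho>,
      one = tensor_embed smul Basis \<rho> 1, zero = (\<lambda>_. 0), add = (\<lambda>f g d. f d + g d)\<rparr>"

text \<open>The functor \<open>B \<mapsto> Aut\<^sub>B(A \<otimes>\<^sub>k B)\<close>.\<close>

definition aut_functor ::
  "('k::field \<Rightarrow> 'a::comm_ring_1 \<Rightarrow> 'a) \<Rightarrow> 'a set \<Rightarrow> ('k \<Rightarrow> 'b::comm_ring_1) \<Rightarrow>
     (('a \<Rightarrow> 'b) \<Rightarrow> ('a \<Rightarrow> 'b)) set" where
  "aut_functor smul Basis \<rho> =
     {g \<in> ring_iso (tensor_ring smul Basis \<rho>) (tensor_ring smul Basis \<rho>).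
        \<forall>c. \<forall>f \<in> carrier (tensor_ring smul Basis \<rho>). g (\<lambda>d. c * f d) = (\<lambda>d. c * g f d)}"

text \<open>The \<open>B\<close>-linear endomorphism of \<open>A \<otimes>\<^sub>k B\<close> with matrix \<open>M\<close>.\<close>

definition mat_apply :: "'a set \<Rightarrow> ('a \<Rightarrow> 'a \<Rightarrow> 'b::comm_ring_1) \<Rightarrow> ('a \<Rightarrow> 'b) \<Rightarrow> ('a \<Rightarrow> 'b)" where
  "mat_apply Basis M f = (\<lambda>d. if d \<in> Basis then \<Sum>b\<in>Basis. M d b * f b else 0)"


subsection \<open>The coordinate ring\<close>

text \<open>Indeterminates for the entries of an invertible matrix and those of its inverse.\<close>

datatype 'a gl_var = Entry 'a 'a | Inv_Entry 'a 'a

type_synonym ('a, 'k) gl_poly = "('a gl_var \<Rightarrow>\<^sub>0 nat) \<Rightarrow>\<^sub>0 'k"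

definition gl_vars :: "'a set \<Rightarrow> 'a gl_var set" where
  "gl_vars Basis = {Entry d b | d b. d \<in> Basis \<and> b \<in> Basis} \<union>
     {Inv_Entry d b | d b. d \<in> Basis \<and> b \<in> Basis}"

abbreviation gl_poly_ring :: "'a set \<Rightarrow> (('a, 'k::field) gl_poly) ring" where
  "gl_poly_ring Basis \<equiv> mpoly_ring (gl_vars Basis)"

text \<open>The equations expressing that the generic matrix defines an algebra automorphism: it is
  multiplicative, unital, and inverse to the matrix of the indeterminates \<open>Inv_Entry\<close>.\<close>

definition aut_relations ::
  "('k::field \<Rightarrow> 'a::comm_ring_1 \<Rightarrow> 'a) \<Rightarrow> 'a set \<Rightarrow> ('a, 'k) gl_poly set" where
  "aut_relations smul Basis =
     (let x = mat_apply Basis (\<lambda>d b. Var (Entry d b) :: ('a, 'k) gl_poly);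
          y = mat_apply Basis (\<lambda>d b. Var (Inv_Entry d b) :: ('a, 'k) gl_poly);
          \<iota> = tensor_embed smul Basis Const;
          mul = tensor_mult smul Basis Const
      in {x (\<iota> (b * c)) d - mul (x (\<iota> b)) (x (\<iota> c)) d | b c d. b \<in> Basis \<and> c \<in> Basis \<and> d \<in> Basis} \<union>
         {x (\<iota> 1) d - \<iota> 1 d | d. d \<in> Basis} \<union>
         {x (y (\<iota> b)) d - \<iota> b d | b d. b \<in> Basis \<and> d \<in> Basis} \<union>
         {y (x (\<iota> b)) d - \<iota> b d | b d. b \<in> Basis \<and> d \<in> Basis})"

definition aut_ideal ::
  "('k::field \<Rightarrow> 'a::comm_ring_1 \<Rightarrow> 'a) \<Rightarrow> 'a set \<Rightarrow> ('a, 'k) gl_poly set" where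
  "aut_ideal smul Basis = Idl\<^bsub>gl_poly_ring Basis\<^esub> (aut_relations smul Basis)"

definition aut_class ::
  "('k::field \<Rightarrow> 'a::comm_ring_1 \<Rightarrow> 'a) \<Rightarrow> 'a set \<Rightarrow> ('a, 'k) gl_poly \<Rightarrow> ('a, 'k) gl_poly set" where
  "aut_class smul Basis p = aut_ideal smul Basis +>\<^bsub>gl_poly_ring Basis\<^esub> p"

definition aut_coord_ring ::
  "('k::field \<Rightarrow> 'a::comm_ring_1 \<Rightarrow> 'a) \<Rightarrow> 'a set \<Rightarrow> ('a, 'k) gl_poly set ring" where
  "aut_coord_ring smul Basis = gl_poly_ring Basis Quot aut_ideal smul Basis"


subsection \<open>Representability\<close>

lemma type_ring_simps:
  "x \<otimes>\<^bsub>type_ring\<^esub> y = x * y" "x \<oplus>\<^bsub>type_ring\<^esub> y = x + y"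
  "\<one>\<^bsub>type_ring\<^esub> = 1" "\<zero>\<^bsub>type_ring\<^esub> = 0" "carrier type_ring = UNIV"
  by (simp_all add: ring_of_type_algebra_def)

lemma mpoly_ring_simps:
  "x \<otimes>\<^bsub>mpoly_ring V\<^esub> y = x * y" "x \<oplus>\<^bsub>mpoly_ring V\<^esub> y = x + y"
  "\<one>\<^bsub>mpoly_ring V\<^esub> = 1" "\<zero>\<^bsub>mpoly_ring V\<^esub> = 0"
  "p \<in> carrier (mpoly_ring V) \<longleftrightarrow> (\<forall>m \<in> Poly_Mapping.keys p. Poly_Mapping.keys m \<subseteq> V)"
  by (simp_all add: ring_of_type_algebra_def mpoly_ring_def)

lemma keys_add_subset: "Poly_Mapping.keys (m + n) \<subseteq> Poly_Mapping.keys m \<union> Poly_Mapping.keys n"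
  for m n :: "'v \<Rightarrow>\<^sub>0 'e::comm_monoid_add"
  by (metis Poly_Mapping.keys_add)

lemma mpoly_ring_closed:
  fixes p q :: "('v \<Rightarrow>\<^sub>0 'e::comm_monoid_add) \<Rightarrow>\<^sub>0 'k::comm_ring_1"
  assumes "p \<in> carrier (mpoly_ring V)" "q \<in> carrier (mpoly_ring V)"
  shows "p + q \<in> carrier (mpoly_ring V)" "p * q \<in> carrier (mpoly_ring V)"
    "p - q \<in> carrier (mpoly_ring V)" "- p \<in> carrier (mpoly_ring V)"
proof -
  have *: "Poly_Mapping.keys m \<subseteq> V" if "m \<in> Poly_Mapping.keys p \<union> Poly_Mapping.keys q" for m
    using that assms by (auto simp: mpoly_ring_simps)
  show "p + q \<in> carrier (mpoly_ring V)"
    using * Poly_Mapping.keys_add[of p q] unfolding mpoly_ring_simps by blast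
  have m: "- p \<in> carrier (mpoly_ring V)" if "p \<in> carrier (mpoly_ring V)"
    for p :: "('v \<Rightarrow>\<^sub>0 'e) \<Rightarrow>\<^sub>0 'k"
    using that by (auto simp: mpoly_ring_simps in_keys_iff)
  show "- p \<in> carrier (mpoly_ring V)" using m assms by blast
  show "p - q \<in> carrier (mpoly_ring V)"
    using * unfolding mpoly_ring_simps
    by (auto simp: in_keys_iff lookup_minus subset_iff)
      (metis (no_types, lifting) diff_zero)
  show "p * q \<in> carrier (mpoly_ring V)"
    unfolding mpoly_ring_simps
  proof
    fix m assume "m \<in> Poly_Mapping.keys (p * q)"
    then obtain a b where "m = a + b" "a \<in> Poly_Mapping.keys p" "b \<in> Poly_Mapping.keys q"
      using Poly_Mapping.keys_mult[of p q] by blast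
    then show "Poly_Mapping.keys m \<subseteq> V"
      using * keys_add_subset[of a b] by blast
  qed
qed

lemma cring_mpoly_ring:
  "cring (mpoly_ring V :: (('v \<Rightarrow>\<^sub>0 'e::comm_monoid_add) \<Rightarrow>\<^sub>0 'k::comm_ring_1) ring)"
proof (rule cringI)
  show "abelian_group (mpoly_ring V :: (('v \<Rightarrow>\<^sub>0 'e) \<Rightarrow>\<^sub>0 'k) ring)"
  proof (rule abelian_groupI)
    fix p :: "('v \<Rightarrow>\<^sub>0 'e) \<Rightarrow>\<^sub>0 'k" assume "p \<in> carrier (mpoly_ring V)"
    then show "\<exists>q\<in>carrier (mpoly_ring V). q \<oplus>\<^bsub>mpoly_ring V\<^esub> p = \<zero>\<^bsub>mpoly_ring V\<^esub>"
      by (intro bexI[of _ "- p"] mpoly_ring_closed) (auto simp: mpoly_ring_simps(1-4))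
  qed (auto simp: mpoly_ring_simps(1-4) ac_simps intro: mpoly_ring_closed, simp add: mpoly_ring_simps)
  show "comm_monoid (mpoly_ring V :: (('v \<Rightarrow>\<^sub>0 'e) \<Rightarrow>\<^sub>0 'k) ring)"
    by (rule comm_monoidI)
      (auto simp: mpoly_ring_simps(1-4) ac_simps intro: mpoly_ring_closed, simp add: mpoly_ring_simps)
qed (simp add: mpoly_ring_simps algebra_simps)

lemma poly_mapping_sum_single:
  "p = (\<Sum>m\<in>Poly_Mapping.keys p. Poly_Mapping.single m (Poly_Mapping.lookup p m))"
  by (rule poly_mapping_eqI)
    (simp add: lookup_sum lookup_single when_def in_keys_iff sum.delta)

lemma poly_mapping_add_induct:
  fixes p :: "'e \<Rightarrow>\<^sub>0 'k::comm_monoid_add"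
  assumes "P 0" and "\<And>p q. P p \<Longrightarrow> P q \<Longrightarrow> P (p + q)"
    and "\<And>m c. m \<in> Poly_Mapping.keys p \<Longrightarrow> P (Poly_Mapping.single m c)"
  shows "P p"
proof -
  have "P (\<Sum>m\<in>S. Poly_Mapping.single m (Poly_Mapping.lookup p m))"
    if "finite S" "S \<subseteq> Poly_Mapping.keys p" for S
    using that by (induction S) (auto intro: assms)
  from this[of "Poly_Mapping.keys p"] show ?thesis
    using poly_mapping_sum_single[of p] by simp
qed

locale coeff_hom =
  fixes \<rho> :: "'k::comm_ring_1 \<Rightarrow> 'b::comm_ring_1"
  assumes hom: "\<rho> \<in> ring_hom type_ring type_ring"
begin

lemma hom_simps: "\<rho> (x + y) = \<rho> x + \<rho> y" "\<rho> (x * y) = \<rho> x * \<rho> y" "\<rho> 1 = 1"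
  using hom by (auto simp: ring_hom_def type_ring_simps)

lemma hom_0: "\<rho> 0 = 0" using hom_simps(1)[of 0 0] by simp

definition mon where "mon f m = (\<Prod>i\<in>Poly_Mapping.keys m. f i ^ Poly_Mapping.lookup m i)"
  for f :: "'v \<Rightarrow> 'b"

lemma mon_superset: "finite S \<Longrightarrow> Poly_Mapping.keys m \<subseteq> S \<Longrightarrow> mon f m = (\<Prod>i\<in>S. f i ^ Poly_Mapping.lookup m i)"
  unfolding mon_def by (rule prod.mono_neutral_left) (auto simp: in_keys_iff)

lemma mon_add: "mon f (m + m') = mon f m * mon f m'"
proof -
  let ?S = "Poly_Mapping.keys m \<union> Poly_Mapping.keys m'"
  have "finite ?S" by simp
  then show ?thesis
    using mon_superset[of ?S] keys_add_subset[of m m']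
    by (simp add: lookup_add power_add prod.distrib)
qed

lemma eval_superset:
  "finite S \<Longrightarrow> Poly_Mapping.keys p \<subseteq> S \<Longrightarrow>
   mpoly_eval \<rho> f p = (\<Sum>m\<in>S. \<rho> (Poly_Mapping.lookup p m) * mon f m)"
  unfolding mpoly_eval_def mon_def[symmetric]
  by (rule sum.mono_neutral_left) (auto simp: in_keys_iff hom_0)

lemma eval_add: "mpoly_eval \<rho> f (p + q) = mpoly_eval \<rho> f p + mpoly_eval \<rho> f q"
proof -
  let ?S = "Poly_Mapping.keys p \<union> Poly_Mapping.keys q"
  have "finite ?S" by simp
  then show ?thesis
    using eval_superset[of ?S] Poly_Mapping.keys_add[of p q]
    by (simp add: lookup_add hom_simps algebra_simps sum.distrib)
qed

lemma eval_single: "mpoly_eval \<rho> f (Poly_Mapping.single m c) = \<rho> c * mon f m"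
  using eval_superset[of "{m}"] by simp

lemma eval_0: "mpoly_eval \<rho> f 0 = 0" by (simp add: mpoly_eval_def)

lemma eval_mult: "mpoly_eval \<rho> f (p * q) = mpoly_eval \<rho> f p * mpoly_eval \<rho> f q"
proof (induction p rule: poly_mapping_add_induct)
  case (3 m c)
  show ?case
    by (induction q rule: poly_mapping_add_induct)
      (simp_all add: eval_0 eval_add eval_single algebra_simps mult_single hom_simps mon_add)
qed (simp_all add: eval_0 eval_add algebra_simps)

lemma eval_Const: "mpoly_eval \<rho> f (Const c) = \<rho> c"
  by (simp add: Const_def eval_single mon_def)

lemma eval_Var: "mpoly_eval \<rho> f (Var i) = f i"
  by (simp add: Var_def eval_single mon_def hom_simps)

lemma eval_1: "mpoly_eval \<rho> f 1 = 1"
  using eval_Const[of f 1] by (simp add: Const_def hom_simps)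

lemma eval_diff: "mpoly_eval \<rho> f (p - q) = mpoly_eval \<rho> f p - mpoly_eval \<rho> f q"
  using eval_add[of f "p - q" q] by simp

lemma eval_sum: "mpoly_eval \<rho> f (sum g S) = (\<Sum>i\<in>S. mpoly_eval \<rho> f (g i))"
  by (induction S rule: infinite_finite_induct) (simp_all add: eval_0 eval_add)

lemma eval_hom: "mpoly_eval \<rho> f \<in> alg_hom Const (mpoly_ring V) \<rho> type_ring"
  by (simp add: alg_hom_def ring_hom_def type_ring_simps mpoly_ring_simps(1-4)
      eval_add eval_mult eval_1 eval_Const)

lemma hom_eq_eval:
  fixes V :: "'v set"
  assumes "\<chi> \<in> alg_hom Const (mpoly_ring V) \<rho> type_ring" "p \<in> carrier (mpoly_ring V)"
  shows "\<chi> p = mpoly_eval \<rho> (\<lambda>i. \<chi> (Var i)) p"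
proof -
  let ?P = "mpoly_ring V :: (('v \<Rightarrow>\<^sub>0 nat) \<Rightarrow>\<^sub>0 'k) ring"
  let ?e = "mpoly_eval \<rho> (\<lambda>i. \<chi> (Var i))"
  have h: "\<chi> (p + q) = \<chi> p + \<chi> q" "\<chi> (p * q) = \<chi> p * \<chi> q"
    if "p \<in> carrier ?P" "q \<in> carrier ?P" for p q
    using assms(1) that by (auto simp: alg_hom_def ring_hom_def type_ring_simps mpoly_ring_simps(1-4))
  have c: "\<chi> (Const c) = \<rho> c" for c
    using assms(1) by (simp add: alg_hom_def)
  have z: "0 \<in> carrier ?P" by (simp add: mpoly_ring_simps)
  have C: "Const c \<in> carrier ?P" for c :: 'k by (auto simp: mpoly_ring_simps Const_def)
  have X: "Var i \<in> carrier ?P" if "i \<in> V" for i using that by (auto simp: mpoly_ring_simps Var_def)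
  have mono: "Poly_Mapping.single m 1 \<in> carrier ?P \<and>
      \<chi> (Poly_Mapping.single m 1) = ?e (Poly_Mapping.single m 1)"
    if "Poly_Mapping.keys m \<subseteq> V" for m
    using that
  proof (induction m rule: poly_mapping_add_induct)
    case 1
    show ?case using C[of 1] c[of 1] by (simp add: Const_def eval_1 hom_simps)
  next
    case (2 m m')
    have k: "Poly_Mapping.keys (m + m') = Poly_Mapping.keys m \<union> Poly_Mapping.keys m'"
      by (auto simp: in_keys_iff lookup_add)
    have s: "Poly_Mapping.single (m + m') (1::'k) = Poly_Mapping.single m 1 * Poly_Mapping.single m' 1"
      by (simp add: mult_single)
    from 2 k show ?case unfolding s by (auto simp: h eval_mult mpoly_ring_closed)
  next
    case (3 i n)
    show ?case
    proof (cases "n = 0")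
      case True then show ?thesis using C[of 1] c[of 1] by (simp add: Const_def eval_1 hom_simps)
    next
      case False
      then have "i \<in> V" using 3 by auto
      have "Poly_Mapping.single (Poly_Mapping.single i n) (1::'k) = Var i ^ n" for n
      proof (induction n)
        case (Suc n)
        have e: "Poly_Mapping.single i (Suc n) = Poly_Mapping.single i 1 + Poly_Mapping.single i n"
          by (simp flip: single_add)
        have "Var i ^ Suc n = Var i * Poly_Mapping.single (Poly_Mapping.single i n) (1::'k)"
          using Suc by simp
        also have "\<dots> = Poly_Mapping.single (Poly_Mapping.single i (Suc n)) 1"
          unfolding e by (simp add: Var_def mult_single)
        finally show ?case by simp
      qed simp
      moreover have "Var i ^ n \<in> carrier ?P \<and> \<chi> (Var i ^ n) = ?e (Var i ^ n)" for n
      proof (induction n)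
        case 0 show ?case using C[of 1] c[of 1] by (simp add: Const_def eval_1 hom_simps)
      next
        case (Suc n) then show ?case using X[OF \<open>i \<in> V\<close>]
          by (simp add: h eval_mult eval_Var mpoly_ring_closed)
      qed
      ultimately show ?thesis by simp
    qed
  qed
  have "p \<in> carrier ?P \<and> \<chi> p = ?e p"
  proof (induction p rule: poly_mapping_add_induct)
    case 1
    show ?case using z c[of 0] by (simp add: eval_0 hom_0 Const_def)
  next
    case (2 p q)
    then show ?case by (simp add: h eval_add mpoly_ring_closed)
  next
    case (3 m a)
    then have "Poly_Mapping.keys m \<subseteq> V" using assms(2) by (simp add: mpoly_ring_simps)
    moreover have "Poly_Mapping.single m a = Const a * Poly_Mapping.single m 1"
      by (simp add: Const_def mult_single)
    ultimately show ?case using mono[of m] by (simp add: h eval_mult C mpoly_ring_closed c eval_Const)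
  qed
  then show ?thesis by simp
qed

end

lemma (in coeff_hom) eval_cong:
  assumes "p \<in> carrier (mpoly_ring V)" "\<And>i. i \<in> V \<Longrightarrow> f i = g i"
  shows "mpoly_eval \<rho> f p = mpoly_eval \<rho> g p"
proof -
  have "f i = g i" if "m \<in> Poly_Mapping.keys p" "i \<in> Poly_Mapping.keys m" for m i
    using assms that unfolding mpoly_ring_simps by blast
  then show ?thesis
    unfolding mpoly_eval_def by (intro sum.cong arg_cong2[of _ _ _ _ "(*)"] prod.cong refl) auto
qed

lemma mpoly_ring_sum:
  "(\<And>i. i \<in> S \<Longrightarrow> g i \<in> carrier (mpoly_ring V)) \<Longrightarrow> sum g S \<in> carrier (mpoly_ring V)"
proof (induction S rule: infinite_finite_induct)
  case (insert x F)
  then show ?case by (simp add: mpoly_ring_closed)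
qed (simp_all add: mpoly_ring_simps)

lemma mpoly_ring_Var: "i \<in> V \<Longrightarrow> Var i \<in> carrier (mpoly_ring V)"
  and mpoly_ring_Const: "Const c \<in> carrier (mpoly_ring V)"
  by (auto simp: mpoly_ring_simps Var_def Const_def)

lemma mpoly_ring_0: "0 \<in> carrier (mpoly_ring V)"
  by (simp add: mpoly_ring_simps)

context
  fixes smul :: "'k::field \<Rightarrow> 'a::comm_ring_1 \<Rightarrow> 'a" and Basis :: "'a set"
  assumes alg: "fd_comm_algebra smul Basis"
begin

interpretation fd_comm_algebra smul Basis by (rule alg)
interpretation P: cring "gl_poly_ring Basis :: (('a, 'k) gl_poly) ring" by (rule cring_mpoly_ring)

lemma aut_relations_closed: "aut_relations smul Basis \<subseteq> carrier (gl_poly_ring Basis)"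
proof -
  let ?C = "carrier (gl_poly_ring Basis) :: ('a, 'k) gl_poly set"
  have V: "Entry d b \<in> gl_vars Basis" "Inv_Entry d b \<in> gl_vars Basis"
    if "d \<in> Basis" "b \<in> Basis" for d b
    using that by (auto simp: gl_vars_def)
  have "tensor_embed smul Basis Const a d \<in> ?C" for a d
    by (simp add: tensor_embed_def mpoly_ring_Const)
  moreover have "mat_apply Basis M g d \<in> ?C"
    if "\<And>d. g d \<in> ?C" "\<And>d b. d \<in> Basis \<Longrightarrow> b \<in> Basis \<Longrightarrow> M d b \<in> ?C" for M g d
    using that by (auto simp: mat_apply_def mpoly_ring_0 intro!: mpoly_ring_sum mpoly_ring_closed)
  moreover have "tensor_mult smul Basis Const g h d \<in> ?C"
    if "\<And>d. g d \<in> ?C" "\<And>d. h d \<in> ?C" for g h d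
    using that by (auto simp: tensor_mult_def mpoly_ring_Const intro!: mpoly_ring_sum mpoly_ring_closed)
  ultimately show ?thesis
    by (auto simp: aut_relations_def Let_def V mpoly_ring_Var intro!: mpoly_ring_closed)
qed

lemma aut_ideal_ideal: "ideal (aut_ideal smul Basis) (gl_poly_ring Basis)"
  unfolding aut_ideal_def by (rule P.genideal_ideal[OF aut_relations_closed])

lemma aut_class_hom: "aut_class smul Basis \<in> ring_hom (gl_poly_ring Basis) (aut_coord_ring smul Basis)"
  using ideal.rcos_ring_hom[OF aut_ideal_ideal]
  by (simp add: aut_coord_ring_def aut_class_def[abs_def])

lemma carrier_aut_coord_ring:
  "carrier (aut_coord_ring smul Basis) = aut_class smul Basis ` carrier (gl_poly_ring Basis)"
  by (auto simp: aut_coord_ring_def FactRing_def A_RCOSETS_def' aut_class_def)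

lemma aut_class_eq_zero:
  assumes "q \<in> aut_relations smul Basis"
  shows "aut_class smul Basis q = aut_class smul Basis 0"
proof -
  interpret I: ideal "aut_ideal smul Basis" "gl_poly_ring Basis" by (rule aut_ideal_ideal)
  have "q \<in> aut_ideal smul Basis"
    using P.genideal_self[OF aut_relations_closed] assms by (auto simp: aut_ideal_def)
  moreover have "0 \<in> aut_ideal smul Basis"
    using I.zero_closed by (simp add: mpoly_ring_simps)
  ultimately show ?thesis
    unfolding aut_class_def using P.a_coset_join2 I.a_subgroup I.Icarr
    by (metis I.a_Hcarr I.a_rcos_const)
qed

context
  fixes \<rho> :: "'k \<Rightarrow> 'b::comm_ring_1"
  assumes hom\<rho>: "\<rho> \<in> ring_hom type_ring type_ring"
begin

interpretation coeff_hom \<rho> by unfold_locales (rule hom\<rho>)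

private abbreviation "emb \<equiv> tensor_embed smul Basis \<rho>"
private abbreviation "mul \<equiv> tensor_mult smul Basis \<rho>"
private abbreviation "T \<equiv> tensor_ring smul Basis \<rho>"

lemma emb_basis: "b \<in> Basis \<Longrightarrow> emb b d = (if d = b then 1 else 0)"
  using independent_Basis
  by (simp add: tensor_embed_def representation_basis hom_simps hom_0)

lemma emb_outside: "d \<notin> Basis \<Longrightarrow> emb a d = 0"
  unfolding tensor_embed_def by (metis representation_ne_zero hom_0)

lemma mul_outside: "d \<notin> Basis \<Longrightarrow> mul f g d = 0"
proof -
  assume "d \<notin> Basis"
  then have "\<rho> (coord smul Basis a d) = 0" for a
    by (metis representation_ne_zero hom_0)
  then show ?thesis by (simp add: tensor_mult_def)
qed

lemma T_simps:
  "f \<in> carrier T \<longleftrightarrow> (\<forall>d. d \<notin> Basis \<longrightarrow> f d = 0)"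
  "f \<otimes>\<^bsub>T\<^esub> g = mul f g" "f \<oplus>\<^bsub>T\<^esub> g = (\<lambda>d. f d + g d)" "\<one>\<^bsub>T\<^esub> = emb 1"
  by (simp_all add: tensor_ring_def)

lemma emb_T: "emb a \<in> carrier T" and mul_T: "mul f g \<in> carrier T" and mat_T: "mat_apply Basis M f \<in> carrier T"
  by (simp_all add: T_simps emb_outside mul_outside mat_apply_def)

lemma mat_emb: "b \<in> Basis \<Longrightarrow> d \<in> Basis \<Longrightarrow> mat_apply Basis M (emb b) d = M d b"
  using finite_Basis by (simp add: mat_apply_def emb_basis if_distrib[of "\<lambda>x. _ * x"] cong: if_cong)

lemma mul_expand: "mul f g e = (\<Sum>b\<in>Basis. \<Sum>c\<in>Basis. (f b * g c) * emb (b * c) e)"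
  by (simp add: tensor_mult_def tensor_embed_def mult.commute)

lemma mul_emb: "b \<in> Basis \<Longrightarrow> c \<in> Basis \<Longrightarrow> emb (b * c) = mul (emb b) (emb c)"
proof
  fix e assume b: "b \<in> Basis" and c: "c \<in> Basis"
  have "mul (emb b) (emb c) e = (\<Sum>b'\<in>Basis. \<Sum>c'\<in>Basis.
      if c' = c then if b' = b then emb (b * c) e else 0 else 0)"
    unfolding mul_expand using b c by (intro sum.cong refl) (simp add: emb_basis)
  also have "\<dots> = emb (b * c) e"
    using finite_Basis b c by simp
  finally show "emb (b * c) e = mul (emb b) (emb c) e" by simp
qed

lemma mat_sum:
  "mat_apply Basis M (\<lambda>e. \<Sum>i\<in>S. h i e) d = (\<Sum>i\<in>S. mat_apply Basis M (h i) d)"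
  by (simp add: mat_apply_def sum_distrib_left) (rule impI, rule sum.swap)

lemma mat_scale: "mat_apply Basis M (\<lambda>e. x * h e) d = x * mat_apply Basis M h d"
  by (simp add: mat_apply_def sum_distrib_left algebra_simps)

lemma mat_add: "mat_apply Basis M (\<lambda>e. g e + h e) d = mat_apply Basis M g d + mat_apply Basis M h d"
  by (simp add: mat_apply_def algebra_simps sum.distrib)

lemma T_expand: "f \<in> carrier T \<Longrightarrow> f = (\<lambda>d. \<Sum>b\<in>Basis. f b * emb b d)"
proof
  fix d assume f: "f \<in> carrier T"
  show "f d = (\<Sum>b\<in>Basis. f b * emb b d)"
  proof (cases "d \<in> Basis")
    case True
    have "(\<Sum>b\<in>Basis. f b * emb b d) = (\<Sum>b\<in>Basis. if d = b then f b else 0)"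
      by (rule sum.cong) (simp_all add: emb_basis)
    then show ?thesis using True finite_Basis by simp
  next
    case False then show ?thesis using f by (simp add: T_simps emb_outside)
  qed
qed

lemma mul_sum_left: "mul (\<lambda>d. \<Sum>i\<in>S. h i d) g e = (\<Sum>i\<in>S. mul (h i) g e)"
proof (induction S rule: infinite_finite_induct)
  case (insert x F)
  then show ?case by (simp add: tensor_mult_def algebra_simps sum.distrib)
qed (simp_all add: tensor_mult_def)

lemma mul_sum_right: "mul g (\<lambda>d. \<Sum>i\<in>S. h i d) e = (\<Sum>i\<in>S. mul g (h i) e)"
proof (induction S rule: infinite_finite_induct)
  case (insert x F)
  then show ?case by (simp add: tensor_mult_def algebra_simps sum.distrib)
qed (simp_all add: tensor_mult_def)

lemma mul_scale: "mul (\<lambda>d. x * f d) (\<lambda>d. y * g d) e = x * y * mul f g e"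
  by (simp add: tensor_mult_def sum_distrib_left algebra_simps)

lemma mat_mul:
  assumes "\<And>b c d. b \<in> Basis \<Longrightarrow> c \<in> Basis \<Longrightarrow> d \<in> Basis \<Longrightarrow>
      mat_apply Basis M (emb (b * c)) d = mul (mat_apply Basis M (emb b)) (mat_apply Basis M (emb c)) d"
    and f: "f \<in> carrier T" and g: "g \<in> carrier T"
  shows "mat_apply Basis M (mul f g) = mul (mat_apply Basis M f) (mat_apply Basis M g)"
proof
  fix d
  let ?m = "mat_apply Basis M"
  have e: "?m h = (\<lambda>d. \<Sum>b\<in>Basis. h b * ?m (emb b) d)" if "h \<in> carrier T" for h
    by (subst (1) T_expand[OF that]) (simp add: fun_eq_iff mat_sum mat_scale)
  have "?m (mul f g) d = (\<Sum>b\<in>Basis. \<Sum>c\<in>Basis. f b * g c * ?m (emb (b * c)) d)"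
    unfolding mul_expand[abs_def] by (simp add: mat_sum mat_scale)
  also have "\<dots> = (\<Sum>b\<in>Basis. \<Sum>c\<in>Basis. f b * g c * mul (?m (emb b)) (?m (emb c)) d)"
    using assms(1) mul_outside mat_T[of M] by (cases "d \<in> Basis") (auto simp: T_simps)
  also have "\<dots> = mul (?m f) (?m g) d"
    by (subst e[OF f], subst e[OF g]) (simp add: mul_sum_left mul_sum_right mul_scale)
  finally show "?m (mul f g) d = mul (?m f) (?m g) d" .
qed

lemma eval_emb: "mpoly_eval \<rho> f (tensor_embed smul Basis Const a d) = emb a d"
  by (simp add: tensor_embed_def eval_Const)

lemma eval_mat: "mpoly_eval \<rho> f (mat_apply Basis M g d) =
    mat_apply Basis (\<lambda>d b. mpoly_eval \<rho> f (M d b)) (\<lambda>b. mpoly_eval \<rho> f (g b)) d"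
  by (simp add: mat_apply_def eval_sum eval_mult eval_0)

lemma eval_mul: "mpoly_eval \<rho> f (tensor_mult smul Basis Const g h d) =
    mul (\<lambda>b. mpoly_eval \<rho> f (g b)) (\<lambda>b. mpoly_eval \<rho> f (h b)) d"
  by (simp add: tensor_mult_def eval_sum eval_mult eval_Const)

definition aut_eqs where "aut_eqs M N \<longleftrightarrow>
   (\<forall>b\<in>Basis. \<forall>c\<in>Basis. \<forall>d\<in>Basis. mat_apply Basis M (emb (b * c)) d =
       mul (mat_apply Basis M (emb b)) (mat_apply Basis M (emb c)) d) \<and>
   (\<forall>d\<in>Basis. mat_apply Basis M (emb 1) d = emb 1 d) \<and>
   (\<forall>b\<in>Basis. \<forall>d\<in>Basis. mat_apply Basis M (mat_apply Basis N (emb b)) d = emb b d) \<and>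
   (\<forall>b\<in>Basis. \<forall>d\<in>Basis. mat_apply Basis N (mat_apply Basis M (emb b)) d = emb b d)"

lemma relations_iff:
  "(\<forall>q\<in>aut_relations smul Basis. mpoly_eval \<rho> f q = 0) \<longleftrightarrow>
   aut_eqs (\<lambda>d b. f (Entry d b)) (\<lambda>d b. f (Inv_Entry d b))"
proof -
  let ?ev = "mpoly_eval \<rho> f"
  let ?x = "mat_apply Basis (\<lambda>d b. Var (Entry d b) :: ('a, 'k) gl_poly)"
  let ?y = "mat_apply Basis (\<lambda>d b. Var (Inv_Entry d b) :: ('a, 'k) gl_poly)"
  let ?e = "tensor_embed smul Basis Const :: 'a \<Rightarrow> 'a \<Rightarrow> ('a, 'k) gl_poly"
  let ?m = "tensor_mult smul Basis Const :: _ \<Rightarrow> _ \<Rightarrow> 'a \<Rightarrow> ('a, 'k) gl_poly"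
  have "(\<forall>q\<in>aut_relations smul Basis. ?ev q = 0) \<longleftrightarrow>
     (\<forall>b\<in>Basis. \<forall>c\<in>Basis. \<forall>d\<in>Basis. ?ev (?x (?e (b * c)) d - ?m (?x (?e b)) (?x (?e c)) d) = 0) \<and>
     (\<forall>d\<in>Basis. ?ev (?x (?e 1) d - ?e 1 d) = 0) \<and>
     (\<forall>b\<in>Basis. \<forall>d\<in>Basis. ?ev (?x (?y (?e b)) d - ?e b d) = 0) \<and>
     (\<forall>b\<in>Basis. \<forall>d\<in>Basis. ?ev (?y (?x (?e b)) d - ?e b d) = 0)"
    unfolding aut_relations_def Let_def by blast
  then show ?thesis
    by (simp add: aut_eqs_def eval_diff eval_emb eval_mat eval_mul eval_Var)
qed

lemma mat_inverse:
  assumes "\<forall>b\<in>Basis. \<forall>d\<in>Basis. mat_apply Basis M (mat_apply Basis N (emb b)) d = emb b d"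
    and f: "f \<in> carrier T"
  shows "mat_apply Basis M (mat_apply Basis N f) = f"
proof
  fix d
  show "mat_apply Basis M (mat_apply Basis N f) d = f d"
  proof (cases "d \<in> Basis")
    case True
    have "mat_apply Basis M (mat_apply Basis N f) d =
        (\<Sum>b\<in>Basis. f b * mat_apply Basis M (mat_apply Basis N (emb b)) d)"
      by (subst T_expand[OF f]) (simp add: mat_sum[abs_def] mat_scale[abs_def])
    also have "\<dots> = (\<Sum>b\<in>Basis. f b * emb b d)"
      using assms True by simp
    also have "\<dots> = f d" using T_expand[OF f] by metis
    finally show ?thesis .
  qed (use f in \<open>simp add: mat_apply_def T_simps\<close>)
qed

lemma mat_aut:
  assumes "aut_eqs M N"
  shows "restrict (mat_apply Basis M) (carrier T) \<in> aut_functor smul Basis \<rho>"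
proof -
  let ?g = "restrict (mat_apply Basis M) (carrier T)"
  have one: "mat_apply Basis M (emb 1) = emb 1"
    using assms by (auto simp: aut_eqs_def fun_eq_iff mat_apply_def emb_outside)
  have "bij_betw ?g (carrier T) (carrier T)"
    by (rule bij_betw_byWitness[of _ "mat_apply Basis N"])
      (use assms mat_inverse in \<open>auto simp: aut_eqs_def mat_T\<close>)
  moreover have "(\<lambda>d. f d + g d) \<in> carrier T" "(\<lambda>d. x * f d) \<in> carrier T"
    if "f \<in> carrier T" "g \<in> carrier T" for f g x
    using that by (auto simp: T_simps)
  ultimately show ?thesis
    using mat_mul[of M] assms
    by (auto simp: aut_functor_def ring_iso_def ring_hom_def T_simps(2-) mul_T emb_T mat_T one
        aut_eqs_def mat_add mat_scale)
qed

lemma aut_functor_matrix: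
  assumes lin: "\<And>f h. f \<in> carrier T \<Longrightarrow> h \<in> carrier T \<Longrightarrow> g (\<lambda>d. f d + h d) = (\<lambda>d. g f d + g h d)"
    "\<And>x f. f \<in> carrier T \<Longrightarrow> g (\<lambda>d. x * f d) = (\<lambda>d. x * g f d)"
    and clo: "\<And>f. f \<in> carrier T \<Longrightarrow> g f \<in> carrier T" and f: "f \<in> carrier T"
  shows "g f = mat_apply Basis (\<lambda>d b. g (emb b) d) f"
proof -
  have z: "g (\<lambda>d. 0) = (\<lambda>d. 0)"
    using lin(2)[of f 0] f by simp
  have "g (\<lambda>d. \<Sum>b\<in>S. f b * emb b d) = (\<lambda>d. \<Sum>b\<in>S. f b * g (emb b) d)"
    if "finite S" for S
    using that
  proof (induction S)
    case empty show ?case using z by simp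
  next
    case (insert b S)
    have 1: "(\<lambda>d. f b * emb b d) \<in> carrier T" "(\<lambda>d. \<Sum>b\<in>S. f b * emb b d) \<in> carrier T"
      by (simp_all add: T_simps emb_outside)
    show ?case
      using insert by (simp add: lin(1)[OF 1] lin(2)[OF emb_T])
  qed
  from this[OF finite_Basis] have "g f = (\<lambda>d. \<Sum>b\<in>Basis. f b * g (emb b) d)"
    using T_expand[OF f] by simp
  then show ?thesis
    using clo[OF emb_T] by (auto simp: mat_apply_def fun_eq_iff mult.commute T_simps)
qed

lemma homs_aut_class:
  assumes "\<psi> \<in> alg_hom (\<lambda>c. aut_class smul Basis (Const c)) (aut_coord_ring smul Basis) \<rho> type_ring"
  shows "p \<in> carrier (gl_poly_ring Basis) \<Longrightarrow> \<psi> (aut_class smul Basis p) =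
      mpoly_eval \<rho> (\<lambda>i. \<psi> (aut_class smul Basis (Var i))) p"
    and "aut_eqs (\<lambda>d b. \<psi> (aut_class smul Basis (Var (Entry d b))))
      (\<lambda>d b. \<psi> (aut_class smul Basis (Var (Inv_Entry d b))))"
proof -
  have "\<psi> \<circ> aut_class smul Basis \<in> alg_hom Const (gl_poly_ring Basis) \<rho> type_ring"
    using assms ring_hom_trans[OF aut_class_hom, of \<psi> type_ring] by (auto simp: alg_hom_def)
  from hom_eq_eval[OF this] show *: "\<psi> (aut_class smul Basis p) =
      mpoly_eval \<rho> (\<lambda>i. \<psi> (aut_class smul Basis (Var i))) p"
    if "p \<in> carrier (gl_poly_ring Basis)" for p using that by simp
  have "mpoly_eval \<rho> (\<lambda>i. \<psi> (aut_class smul Basis (Var i))) q = 0"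
    if "q \<in> aut_relations smul Basis" for q
    using aut_class_eq_zero[OF that] *[of q] *[of 0] that aut_relations_closed
    by (auto simp: mpoly_ring_0 eval_0)
  then show "aut_eqs (\<lambda>d b. \<psi> (aut_class smul Basis (Var (Entry d b))))
      (\<lambda>d b. \<psi> (aut_class smul Basis (Var (Inv_Entry d b))))"
    using relations_iff[of "\<lambda>i. \<psi> (aut_class smul Basis (Var i))"] by simp
qed

lemma hom_of_relations:
  assumes "\<forall>q\<in>aut_relations smul Basis. mpoly_eval \<rho> f q = 0"
  obtains \<psi> where
    "\<psi> \<in> alg_hom (\<lambda>c. aut_class smul Basis (Const c)) (aut_coord_ring smul Basis) \<rho> type_ring"
    "\<psi> \<in> extensional (carrier (aut_coord_ring smul Basis))"
    "\<And>p. p \<in> carrier (gl_poly_ring Basis) \<Longrightarrow> \<psi> (aut_class smul Basis p) = mpoly_eval \<rho> f p"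
proof -
  let ?P = "gl_poly_ring Basis :: ('a, 'k) gl_poly ring"
  let ?ev = "mpoly_eval \<rho> f"
  let ?cl = "aut_class smul Basis"
  let ?O = "aut_coord_ring smul Basis"
  have B: "cring (type_ring :: 'b ring)" by (rule cring_from_type_algebra)
  have ev: "?ev \<in> ring_hom ?P type_ring"
    using eval_hom[of f] by (simp add: alg_hom_def)
  have E: "ring_hom_ring ?P (type_ring :: 'b ring) ?ev"
    by (rule ring_hom_ringI2[OF P.ring_axioms cring.axioms(1)[OF B] ev])
  have "aut_ideal smul Basis \<subseteq> a_kernel ?P type_ring ?ev"
    unfolding aut_ideal_def
  proof (rule P.genideal_minimal[OF ring_hom_ring.kernel_is_ideal[OF E]])
    show "aut_relations smul Basis \<subseteq> a_kernel ?P type_ring ?ev"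
      using aut_relations_closed assms by (auto simp: a_kernel_def' type_ring_simps)
  qed
  then have I: "?ev i = 0" if "i \<in> aut_ideal smul Basis" for i
    using that by (auto simp: a_kernel_def' type_ring_simps)
  define \<psi> where "\<psi> = restrict (\<lambda>c. the_elem (?ev ` c)) (carrier ?O)"
  interpret I: ideal "aut_ideal smul Basis" ?P by (rule aut_ideal_ideal)
  have "?ev ` ?cl p = {?ev p}" if "p \<in> carrier ?P" for p
  proof -
    have "?cl p = (\<lambda>i. i + p) ` aut_ideal smul Basis"
      by (auto simp: aut_class_def a_r_coset_def' mpoly_ring_simps)
    moreover have "aut_ideal smul Basis \<noteq> {}" using I.zero_closed by blast
    ultimately show ?thesis using I by (auto simp: eval_add image_iff)
  qed
  then have cl: "\<psi> (?cl p) = ?ev p" if "p \<in> carrier ?P" for p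
    using that by (simp add: \<psi>_def carrier_aut_coord_ring)
  have h: "?cl p \<otimes>\<^bsub>?O\<^esub> ?cl q = ?cl (p * q)" "?cl p \<oplus>\<^bsub>?O\<^esub> ?cl q = ?cl (p + q)" "\<one>\<^bsub>?O\<^esub> = ?cl 1"
    if "p \<in> carrier ?P" "q \<in> carrier ?P" for p q
    using aut_class_hom that by (auto simp: ring_hom_def mpoly_ring_simps(1-4))
  have one: "\<one>\<^bsub>?O\<^esub> = ?cl 1" "1 \<in> carrier ?P"
    using h(3)[of 0 0] by (simp_all add: mpoly_ring_0) (simp add: mpoly_ring_simps)
  have "\<psi> \<in> alg_hom (\<lambda>c. ?cl (Const c)) ?O \<rho> type_ring"
    by (auto simp: alg_hom_def ring_hom_def carrier_aut_coord_ring type_ring_simps h one cl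
        mpoly_ring_closed mpoly_ring_Const eval_mult eval_add eval_1 eval_Const)
  moreover have "\<psi> \<in> extensional (carrier ?O)" by (simp add: \<psi>_def)
  ultimately show thesis using cl that by blast
qed

lemma aut_eqs_unique:
  assumes 1: "aut_eqs M N" and 2: "aut_eqs M' N'"
    and eq: "\<And>d b. d \<in> Basis \<Longrightarrow> b \<in> Basis \<Longrightarrow> M d b = M' d b"
    and "d \<in> Basis" "b \<in> Basis"
  shows "N d b = N' d b"
proof -
  have "mat_apply Basis M = mat_apply Basis M'"
    using eq by (auto simp: mat_apply_def fun_eq_iff)
  then have "mat_apply Basis N (emb b) = mat_apply Basis N (mat_apply Basis M (mat_apply Basis N' (emb b)))"
    using mat_inverse[of M' N' "emb b"] 2 by (simp add: aut_eqs_def emb_T)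
  also have "\<dots> = mat_apply Basis N' (emb b)"
    using mat_inverse[of N M] 1 by (simp add: aut_eqs_def mat_T)
  finally show ?thesis using assms(4,5) mat_emb by metis
qed

lemma aut_eqs_of_aut:
  assumes "g \<in> aut_functor smul Basis \<rho>"
  shows "aut_eqs (\<lambda>d b. g (emb b) d) (\<lambda>d b. inv_into (carrier T) g (emb b) d)"
    and "f \<in> carrier T \<Longrightarrow> g f = mat_apply Basis (\<lambda>d b. g (emb b) d) f"
proof -
  let ?h = "inv_into (carrier T) g"
  have bij: "bij_betw g (carrier T) (carrier T)"
    and mult: "\<And>f h. f \<in> carrier T \<Longrightarrow> h \<in> carrier T \<Longrightarrow> g (mul f h) = mul (g f) (g h)"
    and add: "\<And>f h. f \<in> carrier T \<Longrightarrow> h \<in> carrier T \<Longrightarrow> g (\<lambda>d. f d + h d) = (\<lambda>d. g f d + g h d)"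
    and one: "g (emb 1) = emb 1"
    and sc: "\<And>x f. f \<in> carrier T \<Longrightarrow> g (\<lambda>d. x * f d) = (\<lambda>d. x * g f d)"
    using assms by (auto simp: aut_functor_def ring_iso_def ring_hom_def T_simps(2-))
  have clo: "g f \<in> carrier T" "?h f \<in> carrier T" "g (?h f) = f" "?h (g f) = f"
    if "f \<in> carrier T" for f
    using that bij bij_betw_inv_into[OF bij]
    by (auto simp: bij_betw_def f_inv_into_f inv_into_f_f)
  have T: "(\<lambda>d. f d + h d) \<in> carrier T" "(\<lambda>d. x * f d) \<in> carrier T"
    if "f \<in> carrier T" "h \<in> carrier T" for f h x
    using that by (auto simp: T_simps)
  have hadd: "?h (\<lambda>d. f d + k d) = (\<lambda>d. ?h f d + ?h k d)" if "f \<in> carrier T" "k \<in> carrier T" for f k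
  proof -
    have "g (\<lambda>d. ?h f d + ?h k d) = (\<lambda>d. f d + k d)"
      using add[of "?h f" "?h k"] clo that by simp
    then show ?thesis using clo(4)[OF T(1)[OF clo(2)[OF that(1)] clo(2)[OF that(2)]]] by simp
  qed
  have hsc: "?h (\<lambda>d. x * f d) = (\<lambda>d. x * ?h f d)" if "f \<in> carrier T" for x f
  proof -
    have "g (\<lambda>d. x * ?h f d) = (\<lambda>d. x * f d)"
      using sc[of "?h f" x] clo that by simp
    then show ?thesis using clo(4)[OF T(2)[OF clo(2)[OF that] clo(2)[OF that]], of x] by simp
  qed
  show gm: "g f = mat_apply Basis (\<lambda>d b. g (emb b) d) f" if "f \<in> carrier T" for f
    using aut_functor_matrix[of g f] add sc clo that by blast
  have hm: "?h f = mat_apply Basis (\<lambda>d b. ?h (emb b) d) f" if "f \<in> carrier T" for f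
    using aut_functor_matrix[of ?h f] hadd hsc clo that by blast
  show "aut_eqs (\<lambda>d b. g (emb b) d) (\<lambda>d b. ?h (emb b) d)"
    unfolding aut_eqs_def gm[OF emb_T, symmetric] hm[OF emb_T, symmetric]
      gm[OF clo(2)[OF emb_T], symmetric] hm[OF clo(1)[OF emb_T], symmetric]
    by (simp add: one clo emb_T mul_emb mult)
qed

end
end

text \<open>
  The \<open>k\<close>-algebra \<open>aut_coord_ring\<close> represents the functor \<open>B \<mapsto> Aut\<^sub>B(A \<otimes>\<^sub>k B)\<close>.
\<close>

theorem aut_coord_ring_represents:
  fixes smul :: "'k::field \<Rightarrow> 'a::comm_ring_1 \<Rightarrow> 'a" and \<rho> :: "'k \<Rightarrow> 'b::comm_ring_1"
  assumes alg: "fd_comm_algebra smul Basis" and hom: "\<rho> \<in> ring_hom type_ring type_ring"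
  defines "R \<equiv> aut_coord_ring smul Basis" and "T \<equiv> tensor_ring smul Basis \<rho>"
  shows "bij_betw
    (\<lambda>\<psi>. restrict (mat_apply Basis (\<lambda>d b. \<psi> (aut_class smul Basis (Var (Entry d b))))) (carrier T))
    (alg_hom (\<lambda>c. aut_class smul Basis (Const c)) R \<rho> type_ring \<inter> extensional (carrier R))
    (aut_functor smul Basis \<rho> \<inter> extensional (carrier T))"
    (is "bij_betw ?F ?H ?G")
proof -
  interpret coeff_hom \<rho> by unfold_locales (rule hom)
  note defs = R_def T_def
  let ?cl = "aut_class smul Basis"
  have "\<psi> = \<psi>'" if "\<psi> \<in> ?H" "\<psi>' \<in> ?H" "?F \<psi> = ?F \<psi>'" for \<psi> \<psi>'
  proof (rule extensionalityI)
    show "\<psi> \<in> extensional (carrier R)" "\<psi>' \<in> extensional (carrier R)" using that by auto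
    fix x assume "x \<in> carrier R"
    then obtain p where p: "x = ?cl p" "p \<in> carrier (gl_poly_ring Basis)"
      by (auto simp: R_def carrier_aut_coord_ring[OF alg])
    have h: "\<psi> \<in> alg_hom (\<lambda>c. ?cl (Const c)) (aut_coord_ring smul Basis) \<rho> type_ring"
      "\<psi>' \<in> alg_hom (\<lambda>c. ?cl (Const c)) (aut_coord_ring smul Basis) \<rho> type_ring"
      using that by (auto simp: R_def)
    have M: "\<psi> (?cl (Var (Entry d b))) = \<psi>' (?cl (Var (Entry d b)))"
      if "d \<in> Basis" "b \<in> Basis" for d b
      using \<open>?F \<psi> = ?F \<psi>'\<close> emb_T[OF alg hom, of b] mat_emb[OF alg hom that(2,1)]
      unfolding T_def by (metis (mono_tags, lifting) restrict_apply')
    have N: "\<psi> (?cl (Var (Inv_Entry d b))) = \<psi>' (?cl (Var (Inv_Entry d b)))"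
      if "d \<in> Basis" "b \<in> Basis" for d b
      using aut_eqs_unique[OF alg hom homs_aut_class(2)[OF alg hom h(1)] homs_aut_class(2)[OF alg hom h(2)]]
        M that by blast
    have "\<psi> (?cl (Var i)) = \<psi>' (?cl (Var i))" if "i \<in> gl_vars Basis" for i
      using that M N by (auto simp: gl_vars_def)
    then show "\<psi> x = \<psi>' x"
      unfolding p(1) homs_aut_class(1)[OF alg hom h(1) p(2)] homs_aut_class(1)[OF alg hom h(2) p(2)]
      by (rule eval_cong[OF p(2)])
  qed
  then have inj: "inj_on ?F ?H" by (rule inj_onI)
  have "?F \<psi> \<in> ?G" if "\<psi> \<in> ?H" for \<psi>
    using that mat_aut[OF alg hom homs_aut_class(2)[OF alg hom]] by (auto simp: defs)
  moreover have "g \<in> ?F ` ?H" if g: "g \<in> ?G" for g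
  proof -
    let ?e = "tensor_embed smul Basis \<rho>"
    let ?M = "\<lambda>d b. g (?e b) d" and ?N = "\<lambda>d b. inv_into (carrier T) g (?e b) d"
    have eqs: "aut_eqs smul Basis \<rho> ?M ?N"
      and gm: "f \<in> carrier T \<Longrightarrow> g f = mat_apply Basis ?M f" for f
      using aut_eqs_of_aut[OF alg hom] g by (auto simp: T_def)
    have "\<forall>q\<in>aut_relations smul Basis. mpoly_eval \<rho> (case_gl_var ?M ?N) q = 0"
      using relations_iff[OF alg hom, of "case_gl_var ?M ?N"] eqs by simp
    from hom_of_relations[OF alg hom this] obtain \<psi> where \<psi>: "\<psi> \<in> ?H"
      "\<And>p. p \<in> carrier (gl_poly_ring Basis) \<Longrightarrow> \<psi> (?cl p) = mpoly_eval \<rho> (case_gl_var ?M ?N) p"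
      by (auto simp: R_def)
    have "\<psi> (?cl (Var (Entry d b))) = ?M d b" if "d \<in> Basis" "b \<in> Basis" for d b
      using \<psi>(2)[OF mpoly_ring_Var] that by (auto simp: gl_vars_def eval_Var)
    then have "?F \<psi> = restrict (mat_apply Basis ?M) (carrier T)"
      by (intro restrict_ext) (auto simp: mat_apply_def fun_eq_iff)
    also have "\<dots> = g"
      using g gm by (intro extensionalityI[of _ "carrier T"]) auto
    finally show ?thesis using \<psi>(1) by blast
  qed
  ultimately show ?thesis using inj by (intro bij_betw_imageI) auto
qed


subsection \<open>The identity component\<close>

definition zariski :: "('r, 'm) ring_scheme \<Rightarrow> 'r set topology" where
  "zariski R = topology_generated_by ((\<lambda>f. {Q. primeideal Q R \<and> f \<notin> Q}) ` carrier R)"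

text \<open>The \<open>k\<close>-rational point of the spectrum of \<open>aut_coord_ring\<close> given by an automorphism \<open>g\<close>
  of \<open>A\<close>: the kernel of evaluation at the matrices of \<open>g\<close> and of its inverse.\<close>

definition aut_point ::
  "('k::field \<Rightarrow> 'a::comm_ring_1 \<Rightarrow> 'a) \<Rightarrow> 'a set \<Rightarrow> ('a \<Rightarrow> 'a) \<Rightarrow> ('a, 'k) gl_poly set set" where
  "aut_point smul Basis g = aut_class smul Basis `
     {p \<in> carrier (gl_poly_ring Basis).
        mpoly_eval (\<lambda>c. c)
          (case_gl_var (\<lambda>d b. coord smul Basis (g b) d) (\<lambda>d b. coord smul Basis (inv_into UNIV g b) d)) p = 0}"

definition identity_component ::
  "('k::field \<Rightarrow> 'a::comm_ring_1 \<Rightarrow> 'a) \<Rightarrow> 'a set \<Rightarrow> ('a, 'k) gl_poly set set set" where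
  "identity_component smul Basis =
     Collect (connected_component_of (zariski (aut_coord_ring smul Basis)) (aut_point smul Basis id))"

text \<open>\<open>G\<^sub>A(k)\<close>: since \<open>G\<^sub>A\<close> is an open subscheme, a \<open>k\<close>-rational point belongs to it iff the
  corresponding point of the spectrum does.\<close>

definition identity_component_rational_points ::
  "('k::field \<Rightarrow> 'a::comm_ring_1 \<Rightarrow> 'a) \<Rightarrow> 'a set \<Rightarrow> ('a \<Rightarrow> 'a) set" where
  "identity_component_rational_points smul Basis =
     {g \<in> alg_iso (scalar smul) type_ring (scalar smul) type_ring.
        aut_point smul Basis g \<in> identity_component smul Basis}"


subsection \<open>Embeddings of tori\<close>

type_synonym 'k laurent = "(nat \<Rightarrow>\<^sub>0 int) \<Rightarrow>\<^sub>0 'k"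

text \<open>The coordinate ring \<open>k[T\<^sub>1\<^sup>\<plusminus>,\<dots>,T\<^sub>r\<^sup>\<plusminus>]\<close> of \<open>\<bbbG>\<^sub>m\<^sup>r\<close>; that of
  \<open>\<bbbG>\<^sub>m\<^sup>r \<times> \<bbbG>\<^sub>m\<^sup>r\<close> has pairs of exponents, and a substitution of monomials for the
  \<open>T\<^sub>i\<close> is given by the map \<open>e\<close> it induces on exponents.\<close>

abbreviation laurent_ring :: "nat \<Rightarrow> ('k::field laurent) ring" where
  "laurent_ring r \<equiv> mpoly_ring {1..r}"

definition map_exponents :: "('e \<Rightarrow> 'f) \<Rightarrow> ('e \<Rightarrow>\<^sub>0 'k::comm_ring_1) \<Rightarrow> ('f \<Rightarrow>\<^sub>0 'k)" where
  "map_exponents e p = (\<Sum>m\<in>Poly_Mapping.keys p. Poly_Mapping.single (e m) (Poly_Mapping.lookup p m))"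

text \<open>A morphism \<open>\<phi> : \<bbbG>\<^sub>m\<^sup>r \<rightarrow> G\<^sub>A\<close> is given by the comorphism
  \<open>\<psi>\<close> of its composition with the inclusion of the open and closed subscheme \<open>G\<^sub>A\<close>:
  it factors through \<open>G\<^sub>A\<close> iff it maps every point of the torus into \<open>G\<^sub>A\<close>, and it is a
  closed immersion iff \<open>\<psi>\<close> is surjective. It is a homomorphism of groups iff
  \<open>\<phi>(t) \<circ> \<phi>(u) = \<phi>(t u)\<close> holds for the generic pair \<open>(t, u)\<close>, which is a point of the
  torus with values in the coordinate ring of \<open>\<bbbG>\<^sub>m\<^sup>r \<times> \<bbbG>\<^sub>m\<^sup>r\<close>.\<close>

definition torus_embedding ::
  "('k::field \<Rightarrow> 'a::comm_ring_1 \<Rightarrow> 'a) \<Rightarrow> 'a set \<Rightarrow> nat \<Rightarrow> (('a, 'k) gl_poly set \<Rightarrow> 'k laurent) \<Rightarrow> bool" where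
  "torus_embedding smul Basis r \<psi> \<longleftrightarrow>
     (let R = aut_coord_ring smul Basis;
          \<phi> = (\<lambda>e d b. map_exponents e (\<psi> (aut_class smul Basis (Var (Entry d b))))
                :: (nat \<Rightarrow>\<^sub>0 int) \<times> (nat \<Rightarrow>\<^sub>0 int) \<Rightarrow>\<^sub>0 'k)
      in \<psi> \<in> alg_hom (\<lambda>c. aut_class smul Basis (Const c)) R Const (laurent_ring r) \<and>
         (\<forall>Q. primeideal Q (laurent_ring r) \<longrightarrow>
            {x \<in> carrier R. \<psi> x \<in> Q} \<in> identity_component smul Basis) \<and>
         \<psi> ` carrier R = carrier (laurent_ring r) \<and>
         (\<forall>d\<in>Basis. \<forall>b\<in>Basis.
            (\<Sum>c\<in>Basis. \<phi> (\<lambda>m. (m, 0)) d c * \<phi> (\<lambda>m. (0, m)) c b) = \<phi> (\<lambda>m. (m, m)) d b))"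


section \<open>The conditions of the theorem\<close>

definition diag_subst :: "nat \<Rightarrow> (nat \<Rightarrow> 'k::field) \<Rightarrow> 'k \<Rightarrow> 'k mpoly \<Rightarrow> 'k mpoly" where
  "diag_subst r a \<beta> = mpoly_eval Const (\<lambda>i. Const (if i < r then a i else \<beta>) * Var i)"

definition contains_diagonal ::
  "('k::field \<Rightarrow> 'a::comm_ring_1 \<Rightarrow> 'a) \<Rightarrow> 'a set \<Rightarrow> nat \<Rightarrow> nat \<Rightarrow> bool" where
  "contains_diagonal smul Basis n r \<longleftrightarrow>
     (\<exists>I. admissible n I \<and> (\<exists>h \<in> presentations smul n I.
        \<forall>a \<beta>. (\<forall>i\<in>{1..<r}. a i \<noteq> 0) \<longrightarrow> \<beta> \<noteq> 0 \<longrightarrow>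
          (\<exists>g \<in> identity_component_rational_points smul Basis.
             \<forall>p \<in> carrier (poly_ring_n n).
               g (h (I +>\<^bsub>poly_ring_n n\<^esub> p)) = h (I +>\<^bsub>poly_ring_n n\<^esub> diag_subst r a \<beta> p))))"

definition star_or_monomial_presentation ::
  "('k::field \<Rightarrow> 'a::comm_ring_1 \<Rightarrow> 'a) \<Rightarrow> nat \<Rightarrow> nat \<Rightarrow> bool" where
  "star_or_monomial_presentation smul n r \<longleftrightarrow>
     (\<exists>I. admissible n I \<and> (property_star n r I \<or> monomial_ideal n I) \<and> presentations smul n I \<noteq> {})"

end

theory Submission
  imports Defs
begin

text \<open>
  Give \<open>X\<^sub>i\<close> with \<open>i < r\<close> its own weight and \<open>X\<^sub>r, \<dots>, X\<^sub>n\<close> a common one. The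
  substitutions in \<open>D(r,k)\<close> act on the monomials through characters, one for each weight, and over an
  infinite field distinct weights give distinct characters; by Artin's independence argument an
  admissible ideal is invariant under \<open>D(r,k)\<close> iff it contains the weight components of its
  elements. A polynomial of a single weight is a monomial or a monomial in \<open>X\<^sub>1, \<dots>, X\<^sub>r\<^sub>-\<^sub>1\<close>
  times a homogeneous polynomial in \<open>X\<^sub>r, \<dots>, X\<^sub>n\<close>, so such ideals are those satisfying
  Property \<open>*\<close> and the monomial ones. Conversely, a grading of \<open>A\<close> is a torus action: the
  matrix of the generic torus element has Laurent polynomial entries and defines a homomorphism from
  the coordinate ring of the automorphism group. The image of the irreducible torus is connected and
  contains the identity, hence lies in \<open>G\<^sub>A\<close>. Because \<open>I\<close> lies in the square of the
  maximal ideal, every \<open>X\<^sub>i\<close> survives in \<open>A\<close>, which makes all coordinates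
  of the torus and their inverses linear combinations of matrix entries.
\<close>

section \<open>Irreducible subsets of a spectrum\<close>

text \<open>Membership in \<open>G_A\<close> is a statement about prime ideals of the coordinate
  ring. The torus is handled on that level: its coordinate ring is a domain, so the zero ideal pulls
  back to a prime contained in the pullback of every other prime, and this one common generization
  already forces connectedness.

  Property \<open>*\<close> speaks of a finite list of generators cut off at the Loewy length,
  whereas gradedness speaks of all elements of \<open>I\<close>. Truncation reconciles the two:
  everything of degree at least the Loewy length lies in \<open>I\<close> anyway, and the rest is a
  finite-dimensional space, so the weight components of a basis form such a list.

  Weights have integer entries although monomials have natural exponents, since the generic torus
  element must have an inverse. The exponent map \<open>s\<close> in \<open>coaction\<close> is left
  free so that the generic element, its inverse, the identity and the generic pair on the product
  torus are instances of one formula.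

  Infinitude of \<open>k\<close> serves to separate weights by characters: \<open>X^d - 1\<close>
  has only finitely many roots.\<close>

lemma openin_zariski_generization:
  assumes "openin (zariski R) U" "Q \<in> U" "primeideal P R" "P \<subseteq> Q"
  shows "P \<in> U"
proof -
  have "generate_topology_on ((\<lambda>f. {Q. primeideal Q R \<and> f \<notin> Q}) ` carrier R) U"
    using assms(1) unfolding zariski_def by (rule openin_topology_generated_by)
  then show ?thesis
    using assms(2) by induction (use assms(3,4) in auto)
qed

lemma topspace_zariski: "topspace (zariski R) = {Q. primeideal Q R}"
proof -
  have "\<exists>f\<in>carrier R. f \<notin> Q" if "primeideal Q R" for Q
    using primeideal.I_notcarr[OF that] ideal.Icarr[OF primeideal.axioms(1)[OF that]] by blast
  then show ?thesis by (auto simp: zariski_def)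
qed

text \<open>\<open>P\<close> acts as a generic point: every open set meeting \<open>S\<close>
  contains it, because basic open sets are non-membership conditions and pass to smaller primes. So
  no two open sets can separate \<open>S\<close>.\<close>

lemma connectedin_zariski:
  assumes "P \<in> S" and "\<And>Q. Q \<in> S \<Longrightarrow> primeideal Q R \<and> P \<subseteq> Q"
  shows "connectedin (zariski R) S"
  unfolding connectedin topspace_zariski
proof (intro conjI notI)
  show "S \<subseteq> {Q. primeideal Q R}" using assms by auto
  assume "\<exists>E1 E2. openin (zariski R) E1 \<and> openin (zariski R) E2 \<and> S \<subseteq> E1 \<union> E2 \<and>
    E1 \<inter> E2 \<inter> S = {} \<and> E1 \<inter> S \<noteq> {} \<and> E2 \<inter> S \<noteq> {}"
  then obtain E1 E2 Q1 Q2 where "openin (zariski R) E1" "openin (zariski R) E2"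
    "E1 \<inter> E2 \<inter> S = {}" "Q1 \<in> E1 \<inter> S" "Q2 \<in> E2 \<inter> S" by blast
  moreover have "P \<in> E" if "openin (zariski R) E" "Q \<in> E \<inter> S" for E Q
    using openin_zariski_generization[OF that(1), of Q P] that(2) assms by simp
  ultimately show False using assms(1) by (metis IntI empty_iff)
qed


section \<open>Group algebras\<close>

lemma Const_hom:
  "(Const :: 'k::comm_ring_1 \<Rightarrow> ('e::comm_monoid_add \<Rightarrow>\<^sub>0 'k)) \<in> ring_hom type_ring type_ring"
  by (simp add: ring_hom_def type_ring_simps Const_def single_add mult_single)

lemma coeff_hom_Const:
  "coeff_hom (Const :: 'k::comm_ring_1 \<Rightarrow> ('e::comm_monoid_add \<Rightarrow>\<^sub>0 'k))"
  by unfold_locales (rule Const_hom)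

lemma single_sum: "Poly_Mapping.single m (sum f S) = (\<Sum>i\<in>S. Poly_Mapping.single m (f i))"
  by (induction S rule: infinite_finite_induct) (simp_all add: single_add)

lemma map_exponents_superset:
  assumes "finite S" "Poly_Mapping.keys p \<subseteq> S"
  shows "map_exponents e p = (\<Sum>m\<in>S. Poly_Mapping.single (e m) (Poly_Mapping.lookup p m))"
  unfolding map_exponents_def
  by (rule sum.mono_neutral_left) (use assms in \<open>auto simp: in_keys_iff\<close>)

lemma map_exponents_add: "map_exponents e (p + q) = map_exponents e p + map_exponents e q"
proof -
  let ?S = "Poly_Mapping.keys p \<union> Poly_Mapping.keys q"
  have "finite ?S" "Poly_Mapping.keys (p + q) \<subseteq> ?S"
    using Poly_Mapping.keys_add[of p q] by simp_all
  then show ?thesis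
    by (simp add: map_exponents_superset[of ?S] lookup_add single_add sum.distrib)
qed

lemma map_exponents_single:
  "map_exponents e (Poly_Mapping.single m c) = Poly_Mapping.single (e m) c"
  by (simp add: map_exponents_superset[of "{m}"])

lemma map_exponents_sum: "map_exponents e (sum f S) = (\<Sum>i\<in>S. map_exponents e (f i))"
proof (induction S rule: infinite_finite_induct)
  case (insert x F)
  then show ?case by (simp add: map_exponents_add)
qed (simp_all add: map_exponents_def)

section \<open>Characters as rational points of monoid algebras\<close>

text \<open>Such maps are the \<open>k\<close>-points of the monoid algebra, and
  \<open>char_eval\<close> is evaluation at the point. For integer exponent vectors they give the
  rational points of a torus.\<close>

locale character =
  fixes \<chi> :: "'e::comm_monoid_add \<Rightarrow> 'k::comm_ring_1"
  assumes char_0: "\<chi> 0 = 1" and char_add: "\<chi> (u + v) = \<chi> u * \<chi> v"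
begin

definition char_eval :: "('e \<Rightarrow>\<^sub>0 'k) \<Rightarrow> 'k" where
  "char_eval p = (\<Sum>m\<in>Poly_Mapping.keys p. Poly_Mapping.lookup p m * \<chi> m)"

lemma char_eval_superset:
  assumes "finite S" "Poly_Mapping.keys p \<subseteq> S"
  shows "char_eval p = (\<Sum>m\<in>S. Poly_Mapping.lookup p m * \<chi> m)"
  unfolding char_eval_def
  by (rule sum.mono_neutral_left) (use assms in \<open>auto simp: in_keys_iff\<close>)

lemma char_eval_add: "char_eval (p + q) = char_eval p + char_eval q"
proof -
  let ?S = "Poly_Mapping.keys p \<union> Poly_Mapping.keys q"
  have "finite ?S" by simp
  then show ?thesis
    using char_eval_superset[of ?S] Poly_Mapping.keys_add[of p q]
    by (simp add: lookup_add algebra_simps sum.distrib)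
qed

lemma char_eval_single: "char_eval (Poly_Mapping.single m c) = c * \<chi> m"
  using char_eval_superset[of "{m}"] by simp

lemma char_eval_0: "char_eval 0 = 0"
  by (simp add: char_eval_def)

lemma char_eval_sum: "char_eval (sum f S) = (\<Sum>i\<in>S. char_eval (f i))"
  by (induction S rule: infinite_finite_induct) (simp_all add: char_eval_0 char_eval_add)

lemma char_eval_mult: "char_eval (p * q) = char_eval p * char_eval q"
proof (induction p rule: poly_mapping_add_induct)
  case (3 m c)
  show ?case
    by (induction q rule: poly_mapping_add_induct)
      (simp_all add: char_eval_0 char_eval_add char_eval_single algebra_simps mult_single char_add)
qed (simp_all add: char_eval_0 char_eval_add algebra_simps)

lemma char_eval_Const: "char_eval (Const c) = c"
  by (simp add: Const_def char_eval_single char_0)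

lemma char_eval_1: "char_eval 1 = 1"
  using char_eval_single[of 0 1] by (simp add: char_0)

lemma char_eval_prod: "char_eval (prod f S) = (\<Prod>i\<in>S. char_eval (f i))"
  by (induction S rule: infinite_finite_induct) (simp_all add: char_eval_1 char_eval_mult)

lemma char_eval_power: "char_eval (p ^ j) = char_eval p ^ j"
  by (induction j) (simp_all add: char_eval_1 char_eval_mult)

lemma char_eval_mpoly_eval:
  "char_eval (mpoly_eval Const f p) = mpoly_eval (\<lambda>c. c) (\<lambda>i. char_eval (f i)) p"
  by (simp add: mpoly_eval_def char_eval_sum char_eval_mult char_eval_prod char_eval_power
      char_eval_Const)

end

text \<open>The zero ideal of the field \<open>k\<close> is pulled back along evaluation. This turns
  a rational point of the torus into a point of its spectrum.\<close>

lemma kernel_char_eval_prime: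
  fixes \<chi> :: "('v \<Rightarrow>\<^sub>0 'e::comm_monoid_add) \<Rightarrow> 'k::field"
  assumes "character \<chi>"
  shows "primeideal {p \<in> carrier (mpoly_ring V). character.char_eval \<chi> p = 0} (mpoly_ring V)"
proof -
  interpret character \<chi> by fact
  let ?L = "mpoly_ring V :: (('v \<Rightarrow>\<^sub>0 'e) \<Rightarrow>\<^sub>0 'k) ring"
  interpret L: cring ?L by (rule cring_mpoly_ring)
  interpret K: cring "type_ring :: 'k ring" by (rule cring_from_type_algebra)
  have hom: "ring_hom_ring ?L (type_ring :: 'k ring) char_eval"
    by (rule ring_hom_ringI2[OF L.ring_axioms K.ring_axioms])
      (auto simp: ring_hom_def type_ring_simps mpoly_ring_simps(1-4) char_eval_add char_eval_mult
        char_eval_1)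
  have "primeideal {0} (type_ring :: 'k ring)"
  proof (rule primeidealI[OF _ K.is_cring])
    have "1 \<noteq> (0::'k)" by simp
    then show "carrier type_ring \<noteq> {0::'k}" unfolding type_ring_simps by blast
  qed (use K.zeroideal in \<open>auto simp: type_ring_simps\<close>)
  from ring_hom_ring.primeideal_vimage[OF hom L.is_cring this] show ?thesis unfolding singleton_iff .
qed

text \<open>Exponent vectors carry a linear order compatible with addition, so products of nonzero
  elements are nonzero by the type class instance. The zero ideal is the generic point of the
  torus.\<close>

lemma zero_prime_laurent: "primeideal {0} (laurent_ring r :: 'k::field laurent ring)"
proof -
  interpret L: cring "laurent_ring r :: 'k laurent ring" by (rule cring_mpoly_ring)
  have "1 \<in> carrier (laurent_ring r :: 'k laurent ring)"
    using L.one_closed by (simp add: mpoly_ring_simps(1-4))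
  then show ?thesis
    using L.zeroideal
    by (intro primeidealI L.is_cring) (auto simp: mpoly_ring_simps(1-4))
qed

lemma mpoly_eval_Const_closed:
  fixes f :: "'w \<Rightarrow> (('v \<Rightarrow>\<^sub>0 'e::comm_monoid_add) \<Rightarrow>\<^sub>0 'k::comm_ring_1)"
  assumes "\<And>i. f i \<in> carrier (mpoly_ring V)"
  shows "mpoly_eval Const f p \<in> carrier (mpoly_ring V)"
proof -
  let ?C = "carrier (mpoly_ring V) :: (('v \<Rightarrow>\<^sub>0 'e) \<Rightarrow>\<^sub>0 'k) set"
  have one: "1 \<in> ?C"
    using mpoly_ring_Const[of "1::'k" V] by (simp add: Const_def)
  have pow: "q ^ j \<in> ?C" if "q \<in> ?C" for q j
    by (induction j) (use that one in \<open>simp_all add: mpoly_ring_closed\<close>)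
  have "(\<Prod>i\<in>S. f i ^ g i) \<in> ?C" for S g
    by (induction S rule: infinite_finite_induct)
      (use assms pow one in \<open>simp_all add: mpoly_ring_closed\<close>)
  then show ?thesis
    unfolding mpoly_eval_def by (intro mpoly_ring_sum mpoly_ring_closed mpoly_ring_Const)
qed

text \<open>\<open>S\<close> is closed only under the operations of a \<open>k\<close>-algebra, so
  the inverses of the indeterminates are listed among the generators; they supply the negative
  exponents.\<close>

lemma laurent_subring_eq_carrier:
  fixes S :: "'k::field laurent set"
  assumes mult: "\<And>p q. p \<in> S \<Longrightarrow> q \<in> S \<Longrightarrow> p * q \<in> S"
    and add: "\<And>p q. p \<in> S \<Longrightarrow> q \<in> S \<Longrightarrow> p + q \<in> S"
    and Const: "\<And>c. Const c \<in> S"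
    and gen: "\<And>i. i \<in> {1..r} \<Longrightarrow> Poly_Mapping.single (Poly_Mapping.single i 1) 1 \<in> S"
      "\<And>i. i \<in> {1..r} \<Longrightarrow> Poly_Mapping.single (Poly_Mapping.single i (- 1)) 1 \<in> S"
  shows "carrier (laurent_ring r) \<subseteq> S"
proof
  fix p :: "'k laurent" assume p: "p \<in> carrier (laurent_ring r)"
  have one: "Poly_Mapping.single 0 1 \<in> S" using Const[of 1] by (simp add: Const_def)
  have pow: "Poly_Mapping.single (Poly_Mapping.single i (int j * c)) 1 \<in> S"
    if "Poly_Mapping.single (Poly_Mapping.single i c) 1 \<in> S" for i j c
  proof (induction j)
    case (Suc j)
    have "int (Suc j) * c = c + int j * c" by (simp add: algebra_simps)
    then show ?case
      using mult[OF that Suc] by (simp only: mult_single single_add mult_1)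
  qed (use one in simp)
  have sing: "Poly_Mapping.single (Poly_Mapping.single i c) 1 \<in> S" if "i \<in> {1..r}" for i c
  proof (cases "c \<ge> 0")
    case True
    then show ?thesis using pow[OF gen(1)[OF that], of "nat c"] by simp
  next
    case False
    then show ?thesis using pow[OF gen(2)[OF that], of "nat (- c)"] by simp
  qed
  have "Poly_Mapping.single (\<Sum>i\<in>T. Poly_Mapping.single i (m i)) 1 \<in> S"
    if "T \<subseteq> {1..r}" for T m
    using finite_subset[OF that finite_atLeastAtMost] that
  proof (induction T)
    case (insert i T)
    then show ?case
      using mult[OF sing[of i "m i"] insert.IH] by (simp add: mult_single)
  qed (use one in simp)
  then have mon: "Poly_Mapping.single m 1 \<in> S" if "Poly_Mapping.keys m \<subseteq> {1..r}" for m
    using that poly_mapping_sum_single[of m] by metis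
  have "Poly_Mapping.single m c \<in> S" if "m \<in> Poly_Mapping.keys p" for m c
  proof -
    have "Poly_Mapping.keys m \<subseteq> {1..r}" using that p by (simp add: mpoly_ring_simps)
    from mult[OF Const[of c] mon[OF this]] show ?thesis
      by (simp add: Const_def mult_single)
  qed
  moreover have "0 \<in> S" using Const[of 0] by (simp add: Const_def)
  ultimately show "p \<in> S"
    by (intro poly_mapping_add_induct[of "\<lambda>p. p \<in> S" p] add) auto
qed


section \<open>Gradings and torus actions\<close>

context fd_comm_algebra
begin

lemma coord_add: "coord smul Basis (a + b) d = coord smul Basis a d + coord smul Basis b d"
  by (simp add: representation_add independent_Basis span_Basis)

lemma coord_scale: "coord smul Basis (smul c a) d = c * coord smul Basis a d"
  by (simp add: representation_scale independent_Basis span_Basis)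

lemma coord_sum: "coord smul Basis (sum f S) d = (\<Sum>i\<in>S. coord smul Basis (f i) d)"
  by (simp add: representation_sum independent_Basis span_Basis)

lemma sum_coord: "(\<Sum>b\<in>Basis. smul (coord smul Basis a b) b) = a"
  by (rule sum_representation_eq) (simp_all add: independent_Basis span_Basis finite_Basis)

lemma smul_mult_right: "smul c (x * y) = x * smul c y"
  using smul_mult_left[of c y x] by (simp add: mult.commute)

end

section \<open>Gradings and their coactions\<close>

text \<open>A grading is encoded by its projections instead of subspaces, so that components and
  their coordinates are terms. \<open>W\<close> may be larger than the set of weights that occur;
  that no weight lies outside it follows from \<open>sum_pr\<close> and
  \<open>pr_pr\<close>.\<close>

locale graded_fd_algebra = fd_comm_algebra smul Basis
  for smul :: "'k::field \<Rightarrow> 'a::comm_ring_1 \<Rightarrow> 'a" and Basis :: "'a set" +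
  fixes W :: "'e::ab_group_add set" and pr :: "'e \<Rightarrow> 'a \<Rightarrow> 'a"
  assumes finite_W: "finite W"
    and pr_add: "pr w (a + b) = pr w a + pr w b"
    and pr_smul: "pr w (smul c a) = smul c (pr w a)"
    and pr_pr: "pr u (pr v a) = (if u = v then pr v a else 0)"
    and sum_pr: "(\<Sum>w\<in>W. pr w a) = a"
    and pr_mult: "pr w (pr u a * pr v b) = (if w = u + v then pr u a * pr v b else 0)"
    and pr_1: "pr w 1 = (if w = 0 then 1 else 0)"
begin

lemma pr_0: "pr w 0 = 0"
  using pr_add[of w 0 0] by simp

lemma pr_sum: "pr w (sum f S) = (\<Sum>i\<in>S. pr w (f i))"
  by (induction S rule: infinite_finite_induct) (simp_all add: pr_0 pr_add)

lemma pr_outside: "w \<notin> W \<Longrightarrow> pr w a = 0"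
proof -
  assume w: "w \<notin> W"
  have "pr w a = (\<Sum>v\<in>W. pr w (pr v a))" by (simp add: sum_pr flip: pr_sum)
  also have "\<dots> = 0" using w by (intro sum.neutral) (auto simp: pr_pr)
  finally show ?thesis .
qed

lemma coord_pr: "(\<Sum>c\<in>Basis. coord smul Basis (pr w c) d * coord smul Basis a c) = coord smul Basis (pr w a) d"
proof -
  have "coord smul Basis (pr w a) d = coord smul Basis (pr w (\<Sum>c\<in>Basis. smul (coord smul Basis a c) c)) d"
    by (simp add: sum_coord)
  then show ?thesis by (simp add: pr_sum pr_smul coord_sum coord_scale mult.commute)
qed

lemma pr_mult_eq: "pr w (a * b) = (\<Sum>u\<in>W. \<Sum>v\<in>W. if w = u + v then pr u a * pr v b else 0)"
proof -
  have "pr w (a * b) = pr w ((\<Sum>u\<in>W. pr u a) * (\<Sum>v\<in>W. pr v b))"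
    by (simp add: sum_pr)
  then show ?thesis by (simp add: sum_product pr_sum pr_mult)
qed

text \<open>Common source of multiplicativity for \<open>coaction\<close> and \<open>act\<close>:
  \<open>F w\<close> attaches data depending on \<open>w\<close> to a component of weight
  \<open>w\<close>, and the sum is regrouped by the weights of the two factors.\<close>

lemma sum_weights_mult:
  fixes F :: "'e \<Rightarrow> 'a \<Rightarrow> 'm::comm_monoid_add"
  assumes F0: "\<And>w. F w 0 = 0" and F_add: "\<And>w a b. F w (a + b) = F w a + F w b"
  shows "(\<Sum>w\<in>W. F w (pr w (a * b))) = (\<Sum>u\<in>W. \<Sum>v\<in>W. F (u + v) (pr u a * pr v b))"
proof -
  have F_sum: "F w (sum f S) = (\<Sum>i\<in>S. F w (f i))" for w f and S :: "'e set"
    by (induction S rule: infinite_finite_induct) (simp_all add: F0 F_add)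
  have "(\<Sum>w\<in>W. F w (pr w (a * b))) =
      (\<Sum>w\<in>W. \<Sum>u\<in>W. \<Sum>v\<in>W. if w = u + v then F w (pr u a * pr v b) else 0)"
    by (simp add: pr_mult_eq F_sum if_distrib[of "F _"] F0 cong: if_cong)
  also have "\<dots> = (\<Sum>u\<in>W. \<Sum>v\<in>W. \<Sum>w\<in>W. if w = u + v then F w (pr u a * pr v b) else 0)"
    by (rule trans[OF sum.swap]) (rule sum.cong[OF refl], rule sum.swap)
  also have "\<dots> = (\<Sum>u\<in>W. \<Sum>v\<in>W. F (u + v) (pr u a * pr v b))"
  proof (intro sum.cong refl)
    fix u v
    \<comment> \<open>Outside \<open>W\<close> the projection \<open>pr (u + v)\<close> both fixes
      and annihilates this product, so the missing index costs nothing.\<close>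
    have "pr u a * pr v b = 0" if "u + v \<notin> W"
      using pr_outside[OF that, of "pr u a * pr v b"] unfolding pr_mult by simp
    then show "(\<Sum>w\<in>W. if w = u + v then F w (pr u a * pr v b) else 0) = F (u + v) (pr u a * pr v b)"
      using finite_W F0 by (cases "u + v \<in> W") (auto simp: sum.delta)
  qed
  finally show ?thesis .
qed

text \<open>A component of weight \<open>w\<close> is multiplied by the monomial with exponent
  \<open>s w\<close>. The identity as \<open>s\<close> gives the generic torus element,
  \<open>uminus\<close> its inverse, the zero map the plain embedding of \<open>A\<close>, and maps
  into pairs the two factors of the product torus.\<close>

definition coaction :: "('e \<Rightarrow> 'f) \<Rightarrow> 'a \<Rightarrow> 'a \<Rightarrow> ('f::comm_monoid_add \<Rightarrow>\<^sub>0 'k)" where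
  "coaction s a d = (\<Sum>w\<in>W. Poly_Mapping.single (s w) (coord smul Basis (pr w a) d))"

lemma coaction_outside: "d \<notin> Basis \<Longrightarrow> coaction s a d = 0"
  unfolding coaction_def by (intro sum.neutral ballI) (metis representation_ne_zero single_zero)

lemma coaction_zero: "coaction (\<lambda>_. 0) a = tensor_embed smul Basis Const a"
proof
  fix d
  have "coaction (\<lambda>_. 0) a d = Poly_Mapping.single 0 (coord smul Basis (\<Sum>w\<in>W. pr w a) d)"
    by (simp add: coaction_def coord_sum single_sum)
  then show "coaction (\<lambda>_. 0) a d = tensor_embed smul Basis Const a d"
    by (simp add: sum_pr tensor_embed_def Const_def)
qed

text \<open>Orthogonality of the projections kills the mixed terms, so composing matrices adds
  exponents. Identity, inverse and group law of the torus are all instances.\<close>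

lemma coaction_matrix_mult:
  "(\<Sum>c\<in>Basis. coaction s c d * coaction s' a c) = coaction (\<lambda>w. s w + s' w) a d"
proof -
  let ?c = "coord smul Basis"
  have "(\<Sum>c\<in>Basis. coaction s c d * coaction s' a c) =
      (\<Sum>c\<in>Basis. \<Sum>u\<in>W. \<Sum>v\<in>W. Poly_Mapping.single (s u + s' v) (?c (pr u c) d * ?c (pr v a) c))"
    by (simp add: coaction_def sum_product mult_single)
  also have "\<dots> = (\<Sum>u\<in>W. \<Sum>v\<in>W. \<Sum>c\<in>Basis. Poly_Mapping.single (s u + s' v) (?c (pr u c) d * ?c (pr v a) c))"
    by (subst sum.swap) (simp add: sum.swap[of _ W Basis])
  also have "\<dots> = (\<Sum>u\<in>W. \<Sum>v\<in>W. Poly_Mapping.single (s u + s' v) (?c (pr u (pr v a)) d))"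
    by (simp add: single_sum[symmetric] coord_pr)
  also have "\<dots> = (\<Sum>u\<in>W. \<Sum>v\<in>W. if u = v then Poly_Mapping.single (s u + s' u) (?c (pr u a) d) else 0)"
    by (intro sum.cong refl) (auto simp: pr_pr representation_zero)
  also have "\<dots> = coaction (\<lambda>w. s w + s' w) a d"
    by (simp add: coaction_def finite_W)
  finally show ?thesis .
qed

lemma mat_apply_coaction:
  "mat_apply Basis (\<lambda>d b. coaction s b d) (coaction s' a) = coaction (\<lambda>w. s w + s' w) a"
  by (auto simp: fun_eq_iff mat_apply_def coaction_matrix_mult coaction_outside)

lemma mat_apply_coaction_embed:
  "mat_apply Basis (\<lambda>d b. coaction s b d) (tensor_embed smul Basis Const a) = coaction s a"
  using mat_apply_coaction[of s "\<lambda>_. 0" a] by (simp add: coaction_zero)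

text \<open>Once the structure constants are recombined into products of components, this is
  \<open>sum_weights_mult\<close>; additivity of \<open>s\<close> makes the exponents of products
  agree.\<close>

lemma coaction_mult:
  assumes "\<And>u v. s (u + v) = s u + s v"
  shows "coaction s (a * b) = tensor_mult smul Basis Const (coaction s a) (coaction s b)"
proof
  fix e
  let ?c = "coord smul Basis"
  have "coaction s a b' * coaction s b c' =
      (\<Sum>u\<in>W. \<Sum>v\<in>W. Poly_Mapping.single (s (u + v)) (?c (pr u a) b' * ?c (pr v b) c'))" for b' c'
    by (simp add: coaction_def sum_product mult_single assms)
  then have "tensor_mult smul Basis Const (coaction s a) (coaction s b) e =
     (\<Sum>b'\<in>Basis. \<Sum>c'\<in>Basis. \<Sum>u\<in>W. \<Sum>v\<in>W.
        Poly_Mapping.single (s (u + v)) (?c (b' * c') e * (?c (pr u a) b' * ?c (pr v b) c')))"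
    by (simp add: tensor_mult_def Const_def sum_distrib_left mult_single)
  also have "\<dots> = (\<Sum>b'\<in>Basis. \<Sum>u\<in>W. \<Sum>v\<in>W. \<Sum>c'\<in>Basis.
        Poly_Mapping.single (s (u + v)) (?c (b' * c') e * (?c (pr u a) b' * ?c (pr v b) c')))"
    by (rule sum.cong[OF refl], subst sum.swap, simp add: sum.swap[of _ W Basis])
  also have "\<dots> = (\<Sum>u\<in>W. \<Sum>v\<in>W. \<Sum>b'\<in>Basis. \<Sum>c'\<in>Basis.
        Poly_Mapping.single (s (u + v)) (?c (b' * c') e * (?c (pr u a) b' * ?c (pr v b) c')))"
    by (subst sum.swap) (simp add: sum.swap[of _ W Basis])
  also have "\<dots> = (\<Sum>u\<in>W. \<Sum>v\<in>W. Poly_Mapping.single (s (u + v)) (?c (pr u a * pr v b) e))"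
  proof (intro sum.cong refl)
    fix u v
    have "?c (pr u a * pr v b) e =
        ?c ((\<Sum>b'\<in>Basis. smul (?c (pr u a) b') b') * (\<Sum>c'\<in>Basis. smul (?c (pr v b) c') c')) e"
      by (simp add: sum_coord)
    also have "\<dots> = (\<Sum>b'\<in>Basis. \<Sum>c'\<in>Basis. ?c (b' * c') e * (?c (pr u a) b' * ?c (pr v b) c'))"
      by (simp add: sum_product coord_sum smul_mult_left[symmetric] smul_mult_right[symmetric]
          coord_scale algebra_simps)
    finally show "(\<Sum>b'\<in>Basis. \<Sum>c'\<in>Basis.
        Poly_Mapping.single (s (u + v)) (?c (b' * c') e * (?c (pr u a) b' * ?c (pr v b) c'))) =
        Poly_Mapping.single (s (u + v)) (?c (pr u a * pr v b) e)"
      by (simp add: single_sum)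
  qed
  also have "\<dots> = coaction s (a * b) e"
    unfolding coaction_def
    by (rule sum_weights_mult[symmetric]) (simp_all add: representation_zero coord_add single_add)
  finally show "coaction s (a * b) e = tensor_mult smul Basis Const (coaction s a) (coaction s b) e" ..
qed

lemma coaction_1:
  assumes "s 0 = 0"
  shows "coaction s 1 = coaction (\<lambda>_. 0) 1"
proof
  fix d show "coaction s 1 d = coaction (\<lambda>_. 0) 1 d"
    unfolding coaction_def by (intro sum.cong refl) (auto simp: pr_1 assms representation_zero)
qed

text \<open>Multiplicativity comes from the grading, unitality from \<open>1\<close> having weight
  \<open>0\<close>, and invertibility from \<open>w\<close> and \<open>- w\<close> cancelling to the
  exponent \<open>0\<close>.\<close>

lemma aut_eqs_coaction:
  "aut_eqs smul Basis Const (\<lambda>d b. coaction (\<lambda>w. w) b d) (\<lambda>d b. coaction uminus b d)"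
  unfolding aut_eqs_def[OF fd_comm_algebra_axioms Const_hom] mat_apply_coaction_embed mat_apply_coaction
  by (simp add: coaction_mult coaction_1 coaction_zero)

section \<open>Automorphisms given by characters\<close>

text \<open>For a character this is the generic torus element specialised at a
  \<open>k\<close>-point. Admitting arbitrary functions \<open>\<chi>\<close> makes composition
  plain pointwise multiplication.\<close>

definition act :: "('e \<Rightarrow> 'k) \<Rightarrow> 'a \<Rightarrow> 'a" where
  "act \<chi> a = (\<Sum>w\<in>W. smul (\<chi> w) (pr w a))"

lemma act_add: "act \<chi> (a + b) = act \<chi> a + act \<chi> b"
  by (simp add: act_def pr_add scale_right_distrib sum.distrib)

lemma act_smul: "act \<chi> (smul c a) = smul c (act \<chi> a)"
  by (simp add: act_def pr_smul scale_sum_right mult.commute)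

lemma act_act: "act \<chi> (act \<eta> a) = act (\<lambda>w. \<chi> w * \<eta> w) a"
proof -
  have "act \<chi> (act \<eta> a) = (\<Sum>u\<in>W. \<Sum>v\<in>W. smul (\<chi> u) (smul (\<eta> v) (pr u (pr v a))))"
    by (simp add: act_def pr_sum pr_smul scale_sum_right)
  also have "\<dots> = (\<Sum>u\<in>W. \<Sum>v\<in>W. if u = v then smul (\<chi> u * \<eta> u) (pr u a) else 0)"
    by (intro sum.cong refl) (auto simp: pr_pr)
  finally show ?thesis by (simp add: act_def finite_W)
qed

lemma act_trivial: "act (\<lambda>_. 1) a = a"
  by (simp add: act_def sum_pr)

context
  fixes \<chi> :: "'e \<Rightarrow> 'k"
  assumes char: "character \<chi>"
begin

interpretation character \<chi> by (rule char)

lemma char_uminus: "\<chi> w * \<chi> (- w) = 1"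
  using char_add[of w "- w"] by (simp add: char_0)

lemma act_mult: "act \<chi> (a * b) = act \<chi> a * act \<chi> b"
proof -
  have "act \<chi> (a * b) = (\<Sum>u\<in>W. \<Sum>v\<in>W. smul (\<chi> (u + v)) (pr u a * pr v b))"
    unfolding act_def by (rule sum_weights_mult) (simp_all add: scale_right_distrib)
  also have "\<dots> = act \<chi> a * act \<chi> b"
    by (simp add: act_def sum_product smul_mult_left[symmetric] smul_mult_right[symmetric]
        char_add mult.commute)
  finally show ?thesis .
qed

lemma act_1: "act \<chi> 1 = 1"
proof -
  have "act \<chi> 1 = act (\<lambda>_. 1) 1"
    unfolding act_def by (intro sum.cong refl) (auto simp: pr_1 char_0)
  then show ?thesis by (simp add: act_trivial)
qed

lemma act_inverse: "act \<chi> (act (\<lambda>w. \<chi> (- w)) a) = a" "act (\<lambda>w. \<chi> (- w)) (act \<chi> a) = a"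
  using char_uminus by (simp_all add: act_act act_trivial mult.commute)

lemma bij_act: "bij (act \<chi>)"
  by (rule bij_betw_byWitness[of _ "act (\<lambda>w. \<chi> (- w))"]) (simp_all add: act_inverse)

lemma inv_act: "inv_into UNIV (act \<chi>) = act (\<lambda>w. \<chi> (- w))"
  by (rule inv_equality) (simp_all add: act_inverse)

lemma act_alg_iso: "act \<chi> \<in> alg_iso (scalar smul) type_ring (scalar smul) type_ring"
  using bij_act
  by (auto simp: alg_iso_def ring_iso_def ring_hom_def type_ring_simps act_add act_mult act_1 act_smul)

lemma char_eval_coaction: "char_eval (coaction s a d) = (\<Sum>w\<in>W. \<chi> (s w) * coord smul Basis (pr w a) d)"
  for s :: "'e \<Rightarrow> 'e"
  by (simp add: coaction_def char_eval_sum char_eval_single mult.commute)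

text \<open>Links the generic matrices with the coordinates by which \<open>aut_point\<close>
  describes the automorphism \<open>act \<chi>\<close>.\<close>

lemma char_eval_matrices:
  "char_eval (case_gl_var (\<lambda>d b. coaction (\<lambda>w. w) b d) (\<lambda>d b. coaction uminus b d) i) =
   case_gl_var (\<lambda>d b. coord smul Basis (act \<chi> b) d) (\<lambda>d b. coord smul Basis (inv_into UNIV (act \<chi>) b) d) i"
  by (cases i) (simp_all add: char_eval_coaction inv_act act_def coord_sum coord_scale)

end

end


context fd_comm_algebra
begin

lemma cring_aut_coord_ring: "cring (aut_coord_ring smul Basis)"
  unfolding aut_coord_ring_def
  by (rule ideal.quotient_is_cring[OF aut_ideal_ideal[OF fd_comm_algebra_axioms] cring_mpoly_ring])

end

section \<open>The torus morphism and the identity component\<close>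

text \<open>Integer vectors supported in \<open>{1..r}\<close> are the characters of the torus of
  rank \<open>r\<close>; \<open>W_keys\<close> keeps all matrix entries inside its coordinate
  ring.\<close>

locale torus_graded_algebra = graded_fd_algebra smul Basis W pr
  for smul :: "'k::field \<Rightarrow> 'a::comm_ring_1 \<Rightarrow> 'a" and Basis :: "'a set"
    and W :: "(nat \<Rightarrow>\<^sub>0 int) set" and pr :: "(nat \<Rightarrow>\<^sub>0 int) \<Rightarrow> 'a \<Rightarrow> 'a" +
  fixes r :: nat
  assumes W_keys: "w \<in> W \<Longrightarrow> Poly_Mapping.keys w \<subseteq> {1..r}"
begin

abbreviation gl_matrices :: "'a gl_var \<Rightarrow> 'k laurent" where
  "gl_matrices \<equiv> case_gl_var (\<lambda>d b. coaction (\<lambda>w. w) b d) (\<lambda>d b. coaction uminus b d)"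

text \<open>It exists because the generic matrices satisfy the automorphism relations. The target is
  at first the ring of the whole type, as in \<open>hom_of_relations\<close>;
  \<open>comorphism_laurent\<close> cuts it down to \<open>r\<close> indeterminates.\<close>

definition comorphism :: "('a, 'k) gl_poly set \<Rightarrow> 'k laurent" where
  "comorphism = (SOME \<psi>.
     \<psi> \<in> alg_hom (\<lambda>c. aut_class smul Basis (Const c)) (aut_coord_ring smul Basis) Const type_ring \<and>
     (\<forall>p\<in>carrier (gl_poly_ring Basis). \<psi> (aut_class smul Basis p) = mpoly_eval Const gl_matrices p))"

lemma comorphism_alg_hom: "comorphism \<in> alg_hom (\<lambda>c. aut_class smul Basis (Const c)) (aut_coord_ring smul Basis) Const type_ring"
  and comorphism_class: "p \<in> carrier (gl_poly_ring Basis) \<Longrightarrow> comorphism (aut_class smul Basis p) = mpoly_eval Const gl_matrices p"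
proof -
  have "\<forall>q\<in>aut_relations smul Basis. mpoly_eval Const gl_matrices q = 0"
    using relations_iff[OF fd_comm_algebra_axioms Const_hom, of gl_matrices] aut_eqs_coaction by simp
  from hom_of_relations[OF fd_comm_algebra_axioms Const_hom this]
  have "\<exists>\<psi>. \<psi> \<in> alg_hom (\<lambda>c. aut_class smul Basis (Const c)) (aut_coord_ring smul Basis) Const type_ring \<and>
     (\<forall>p\<in>carrier (gl_poly_ring Basis). \<psi> (aut_class smul Basis p) = mpoly_eval Const gl_matrices p)"
    by metis
  from someI_ex[OF this, folded comorphism_def]
  show "comorphism \<in> alg_hom (\<lambda>c. aut_class smul Basis (Const c)) (aut_coord_ring smul Basis) Const type_ring"
    "p \<in> carrier (gl_poly_ring Basis) \<Longrightarrow> comorphism (aut_class smul Basis p) = mpoly_eval Const gl_matrices p"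
    by blast+
qed

lemma coaction_closed:
  assumes "\<And>w. Poly_Mapping.keys (s w) \<subseteq> Poly_Mapping.keys w"
  shows "coaction s a d \<in> carrier (laurent_ring r)"
proof -
  have "Poly_Mapping.keys (s w) \<subseteq> {1..r}" if "w \<in> W" for w
    using assms[of w] W_keys[OF that] by (rule subset_trans)
  then show ?thesis
    unfolding coaction_def by (intro mpoly_ring_sum) (simp add: mpoly_ring_simps)
qed

lemma gl_matrices_closed: "gl_matrices i \<in> carrier (laurent_ring r)"
  by (cases i) (simp_all add: coaction_closed del: One_nat_def)

lemma comorphism_closed: "x \<in> carrier (aut_coord_ring smul Basis) \<Longrightarrow> comorphism x \<in> carrier (laurent_ring r)"
  using mpoly_eval_Const_closed[OF gl_matrices_closed] comorphism_class
  by (auto simp: carrier_aut_coord_ring[OF fd_comm_algebra_axioms])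

lemma comorphism_laurent:
  "comorphism \<in> alg_hom (\<lambda>c. aut_class smul Basis (Const c)) (aut_coord_ring smul Basis) Const (laurent_ring r)"
  using comorphism_alg_hom comorphism_closed
  by (auto simp: alg_hom_def ring_hom_def type_ring_simps mpoly_ring_simps(1-4))

lemma comorphism_vimage_prime:
  assumes "primeideal Q (laurent_ring r)"
  shows "primeideal {x \<in> carrier (aut_coord_ring smul Basis). comorphism x \<in> Q} (aut_coord_ring smul Basis)"
proof -
  let ?R = "aut_coord_ring smul Basis" and ?L = "laurent_ring r :: 'k laurent ring"
  interpret L: cring ?L by (rule cring_mpoly_ring)
  interpret R: cring ?R by (rule cring_aut_coord_ring)
  have "ring_hom_ring ?R ?L comorphism"
    by (rule ring_hom_ringI2[OF R.ring_axioms L.ring_axioms])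
      (use comorphism_laurent in \<open>simp add: alg_hom_def\<close>)
  from ring_hom_ring.primeideal_vimage[OF this R.is_cring assms] show ?thesis .
qed

text \<open>\<open>char_eval\<close> after \<open>comorphism\<close> evaluates at the matrices of
  \<open>act \<chi>\<close> and its inverse. Hence the point of \<open>act \<chi>\<close> is the
  image of the torus point defined by \<open>\<chi>\<close>.\<close>

lemma aut_point_act:
  assumes "character \<chi>"
  shows "aut_point smul Basis (act \<chi>) = {x \<in> carrier (aut_coord_ring smul Basis).
    comorphism x \<in> {p \<in> carrier (laurent_ring r). character.char_eval \<chi> p = 0}}"
proof -
  interpret character \<chi> by fact
  let ?M = "case_gl_var (\<lambda>d b. coord smul Basis (act \<chi> b) d) (\<lambda>d b. coord smul Basis (inv_into UNIV (act \<chi>) b) d)"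
  have *: "mpoly_eval (\<lambda>c. c) ?M p = char_eval (comorphism (aut_class smul Basis p))"
    if "p \<in> carrier (gl_poly_ring Basis)" for p
    by (simp add: comorphism_class[OF that] char_eval_mpoly_eval char_eval_matrices[OF assms])
  have "x \<in> aut_point smul Basis (act \<chi>) \<longleftrightarrow>
      (\<exists>p\<in>carrier (gl_poly_ring Basis). x = aut_class smul Basis p \<and>
        char_eval (comorphism (aut_class smul Basis p)) = 0)" for x
    unfolding aut_point_def using * by (auto simp: image_iff)
  then show ?thesis
    using comorphism_closed by (auto simp: carrier_aut_coord_ring[OF fd_comm_algebra_axioms])
qed

text \<open>The pullbacks of all primes form one connected set: each contains the pullback of the
  zero ideal. The trivial character contributes the point of \<open>id\<close>.\<close>

lemma comorphism_vimage_identity_component: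
  assumes "primeideal Q (laurent_ring r)"
  shows "{x \<in> carrier (aut_coord_ring smul Basis). comorphism x \<in> Q} \<in> identity_component smul Basis"
proof -
  let ?R = "aut_coord_ring smul Basis"
  let ?pt = "\<lambda>Q. {x \<in> carrier ?R. comorphism x \<in> Q}"
  let ?S = "?pt ` {Q. primeideal Q (laurent_ring r)}"
  have one: "character (\<lambda>_ :: nat \<Rightarrow>\<^sub>0 int. 1 :: 'k)" by unfold_locales simp_all
  have "act (\<lambda>_. 1) = id" by (simp add: fun_eq_iff act_trivial)
  then have "aut_point smul Basis id = ?pt {p \<in> carrier (laurent_ring r). character.char_eval (\<lambda>_. 1) p = 0}"
    using aut_point_act[OF one] by simp
  then have id: "aut_point smul Basis id \<in> ?S"
    by (rule image_eqI) (simp add: kernel_char_eval_prime[OF one] del: One_nat_def)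
  have "connectedin (zariski ?R) ?S"
  proof (rule connectedin_zariski[of "?pt {0}"])
    show "?pt {0} \<in> ?S" by (rule imageI) (simp add: zero_prime_laurent del: One_nat_def)
    fix P assume "P \<in> ?S"
    then obtain Q where Q: "Q \<in> {Q. primeideal Q (laurent_ring r)}" "P = ?pt Q" by (rule imageE)
    then have prime: "primeideal Q (laurent_ring r)" by simp
    have "0 \<in> Q"
      using additive_subgroup.zero_closed[OF ideal.axioms(1)[OF primeideal.axioms(1)[OF prime]]]
      by (simp add: mpoly_ring_simps(1-4))
    then show "primeideal P ?R \<and> ?pt {0} \<subseteq> P"
      using comorphism_vimage_prime[OF prime] unfolding Q(2) by auto
  qed
  moreover have "?pt Q \<in> ?S" by (rule imageI) (use assms in simp)
  ultimately show ?thesis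
    using id unfolding identity_component_def connected_component_of_def
    by (intro CollectI exI[of _ ?S] conjI)
qed

lemma act_identity_component:
  assumes "character \<chi>"
  shows "act \<chi> \<in> identity_component_rational_points smul Basis"
  unfolding identity_component_rational_points_def
  using act_alg_iso[OF assms] aut_point_act[OF assms]
    comorphism_vimage_identity_component[OF kernel_char_eval_prime[OF assms]] by simp

text \<open>A vector of weight \<open>e_i\<close> is an eigenvector of the generic element, so a
  nonzero coordinate of its image is a nonzero scalar times \<open>T_i\<close>; the inverse matrix
  yields the inverse of \<open>T_i\<close>.\<close>

lemma comorphism_surj:
  assumes ex: "\<And>i. i \<in> {1..r} \<Longrightarrow> \<exists>a. a \<noteq> 0 \<and> pr (Poly_Mapping.single i 1) a = a"
  shows "comorphism ` carrier (aut_coord_ring smul Basis) = carrier (laurent_ring r)"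
proof
  let ?R = "aut_coord_ring smul Basis" and ?im = "comorphism ` carrier (aut_coord_ring smul Basis)"
  show "?im \<subseteq> carrier (laurent_ring r)" using comorphism_closed by blast
  interpret R: cring ?R by (rule cring_aut_coord_ring)
  have cl: "aut_class smul Basis p \<in> carrier ?R" if "p \<in> carrier (gl_poly_ring Basis)" for p
    using that by (simp add: carrier_aut_coord_ring[OF fd_comm_algebra_axioms])
  have mult: "p * q \<in> ?im" and add: "p + q \<in> ?im" if p: "p \<in> ?im" and q: "q \<in> ?im" for p q
  proof -
    obtain x where x: "p = comorphism x" "x \<in> carrier ?R" using p by (rule imageE)
    obtain y where y: "q = comorphism y" "y \<in> carrier ?R" using q by (rule imageE)
    from x y have "p * q = comorphism (x \<otimes>\<^bsub>?R\<^esub> y)" "p + q = comorphism (x \<oplus>\<^bsub>?R\<^esub> y)"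
      using comorphism_alg_hom by (simp_all add: alg_hom_def ring_hom_def type_ring_simps)
    then show "p * q \<in> ?im" "p + q \<in> ?im" using x(2) y(2) by simp_all
  qed
  have Const: "Const c \<in> ?im" for c
  proof (rule image_eqI)
    show "Const c = comorphism (aut_class smul Basis (Const c))"
      using comorphism_alg_hom by (simp add: alg_hom_def)
  qed (rule cl[OF mpoly_ring_Const])
  have sums: "sum f S \<in> ?im" if "\<And>i. i \<in> S \<Longrightarrow> f i \<in> ?im" for f and S :: "'a set"
    using that Const[of 0] by (induction S rule: infinite_finite_induct) (auto simp: Const_def intro: add)
  have entries: "coaction (\<lambda>w. w) b d \<in> ?im" "coaction uminus b d \<in> ?im"
    if "b \<in> Basis" "d \<in> Basis" for b d
  proof -
    interpret coeff_hom "Const :: 'k \<Rightarrow> 'k laurent" by (rule coeff_hom_Const)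
    have V: "Entry d b \<in> gl_vars Basis" "Inv_Entry d b \<in> gl_vars Basis"
      using that by (auto simp: gl_vars_def)
    note x = mpoly_ring_Var[OF V(1)] and y = mpoly_ring_Var[OF V(2)]
    show "coaction (\<lambda>w. w) b d \<in> ?im"
      by (rule image_eqI[OF _ cl[OF x]]) (simp add: comorphism_class[OF x] eval_Var)
    show "coaction uminus b d \<in> ?im"
      by (rule image_eqI[OF _ cl[OF y]]) (simp add: comorphism_class[OF y] eval_Var)
  qed
  \<comment> \<open>One argument for both signs: \<open>s\<close> will be the identity and
    \<open>uminus\<close>.\<close>
  have "Poly_Mapping.single (s (Poly_Mapping.single i 1)) 1 \<in> ?im"
    if i: "i \<in> {1..r}" and s: "\<And>b d. b \<in> Basis \<Longrightarrow> d \<in> Basis \<Longrightarrow> coaction s b d \<in> ?im" for i s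
  proof -
    obtain a where a: "a \<noteq> 0" "pr (Poly_Mapping.single i 1) a = a" using ex[OF i] by blast
    have "(\<Sum>b\<in>Basis. smul (coord smul Basis a b) b) \<noteq> 0" using a(1) by (simp add: sum_coord)
    then obtain d where d: "d \<in> Basis" "coord smul Basis a d \<noteq> 0"
      by (metis (no_types, lifting) scale_zero_left sum.neutral)
    have pr: "pr w a = (if w = Poly_Mapping.single i 1 then a else 0)" for w
      using pr_pr[of w "Poly_Mapping.single i 1" a] a(2) by simp
    \<comment> \<open>Composition with the zero exponent map exhibits this coordinate as a
      combination of matrix entries with constant coefficients.\<close>
    have "(\<Sum>b\<in>Basis. coaction s b d * Const (coord smul Basis a b)) = coaction s a d"
      using coaction_matrix_mult[of s d "\<lambda>_. 0" a] unfolding coaction_zero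
      by (simp add: tensor_embed_def)
    also have "\<dots> = (\<Sum>w\<in>W. if w = Poly_Mapping.single i 1 then Poly_Mapping.single (s w) (coord smul Basis a d) else 0)"
      unfolding coaction_def by (intro sum.cong refl) (auto simp: pr representation_zero)
    also have "\<dots> = Poly_Mapping.single (s (Poly_Mapping.single i 1)) (coord smul Basis a d)"
      using pr_outside[of "Poly_Mapping.single i 1" a] a finite_W by auto
    finally have "Poly_Mapping.single (s (Poly_Mapping.single i 1)) (coord smul Basis a d) \<in> ?im"
      using sums[of Basis "\<lambda>b. coaction s b d * Const (coord smul Basis a b)"] s d(1) mult Const by simp
    from mult[OF Const[of "inverse (coord smul Basis a d)"] this] d(2) show ?thesis
      by (simp add: Const_def mult_single)
  qed
  note gen = this
  show "carrier (laurent_ring r) \<subseteq> ?im"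
  proof (rule laurent_subring_eq_carrier[OF mult add Const])
    fix i assume i: "i \<in> {1..r}"
    show "Poly_Mapping.single (Poly_Mapping.single i 1) 1 \<in> ?im"
      "Poly_Mapping.single (Poly_Mapping.single i (- 1)) 1 \<in> ?im"
      using gen[OF i, of "\<lambda>w. w"] gen[OF i, of uminus] entries by (simp_all flip: single_uminus)
  qed
qed

theorem torus_embedding_comorphism:
  assumes "\<And>i. i \<in> {1..r} \<Longrightarrow> \<exists>a. a \<noteq> 0 \<and> pr (Poly_Mapping.single i 1) a = a"
  shows "torus_embedding smul Basis r comorphism"
proof -
  interpret coeff_hom "Const :: 'k \<Rightarrow> 'k laurent" by (rule coeff_hom_Const)
  \<comment> \<open>Substituting exponents in an entry merely changes \<open>s\<close>, so the group
    law becomes \<open>coaction_matrix_mult\<close> with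
    \<open>(m, 0) + (0, m) = (m, m)\<close>.\<close>
  have "map_exponents e (comorphism (aut_class smul Basis (Var (Entry d b)))) = coaction e b d"
    if "d \<in> Basis" "b \<in> Basis" for e :: "(nat \<Rightarrow>\<^sub>0 int) \<Rightarrow> (nat \<Rightarrow>\<^sub>0 int) \<times> (nat \<Rightarrow>\<^sub>0 int)" and b d
  proof -
    have "Entry d b \<in> gl_vars Basis" using that by (auto simp: gl_vars_def)
    from comorphism_class[OF mpoly_ring_Var[OF this]]
    have "comorphism (aut_class smul Basis (Var (Entry d b))) = coaction (\<lambda>w. w) b d"
      by (simp add: eval_Var)
    then show ?thesis by (simp add: coaction_def map_exponents_sum map_exponents_single)
  qed
  then have "(\<Sum>c\<in>Basis. map_exponents (\<lambda>m. (m, 0)) (comorphism (aut_class smul Basis (Var (Entry d c)))) *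
       map_exponents (\<lambda>m. (0, m)) (comorphism (aut_class smul Basis (Var (Entry c b))))) =
     map_exponents (\<lambda>m. (m, m)) (comorphism (aut_class smul Basis (Var (Entry d b))))"
    if "d \<in> Basis" "b \<in> Basis" for d b
    using that by (simp add: coaction_matrix_mult)
  then show ?thesis
    unfolding torus_embedding_def Let_def
    using comorphism_laurent comorphism_vimage_identity_component comorphism_surj[OF assms] by blast
qed

end


section \<open>Degrees, weights and homogeneous components\<close>

lemma mon_degree_superset:
  assumes "finite S" "Poly_Mapping.keys m \<subseteq> S"
  shows "mon_degree m = (\<Sum>i\<in>S. Poly_Mapping.lookup m i)"
  unfolding mon_degree_def
  by (rule sum.mono_neutral_left) (use assms in \<open>auto simp: in_keys_iff\<close>)

lemma mon_degree_add: "mon_degree (m + m') = mon_degree m + mon_degree m'"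
proof -
  let ?S = "Poly_Mapping.keys m \<union> Poly_Mapping.keys m'"
  have "finite ?S" "Poly_Mapping.keys (m + m') \<subseteq> ?S" using keys_add_subset[of m m'] by simp_all
  then show ?thesis
    by (simp add: mon_degree_superset[of ?S] lookup_add sum.distrib)
qed

lemma mon_degree_single: "mon_degree (Poly_Mapping.single i c) = c"
  by (simp add: mon_degree_superset[of "{i}"])

text \<open>Exponents are bounded by the degree, so these monomials inject into a finite function
  space. This bounds both the set of weights of \<open>A\<close> and the truncations of
  \<open>I\<close>.\<close>

lemma finite_mon_degree_less:
  assumes "finite V"
  shows "finite {m. Poly_Mapping.keys m \<subseteq> V \<and> mon_degree m < l}"
proof (rule inj_on_finite)
  let ?M = "{m. Poly_Mapping.keys m \<subseteq> V \<and> mon_degree m < l}"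
  let ?f = "\<lambda>m. restrict (Poly_Mapping.lookup m) V"
  show "inj_on ?f ?M"
  proof (rule inj_onI, rule poly_mapping_eqI)
    fix m m' i assume m: "m \<in> ?M" "m' \<in> ?M" and eq: "?f m = ?f m'"
    show "Poly_Mapping.lookup m i = Poly_Mapping.lookup m' i"
    proof (cases "i \<in> V")
      case True then show ?thesis using fun_cong[OF eq, of i] by simp
    next
      case False
      then have "i \<notin> Poly_Mapping.keys m" "i \<notin> Poly_Mapping.keys m'" using m by auto
      then show ?thesis by (simp add: in_keys_iff)
    qed
  qed
  have "Poly_Mapping.lookup m i \<le> mon_degree m" if "m \<in> ?M" "i \<in> V" for m i
    using that member_le_sum[of i V "Poly_Mapping.lookup m"] assms
    by (simp add: mon_degree_superset[of V])
  then have "Poly_Mapping.lookup m i \<le> l" if "m \<in> ?M" "i \<in> V" for m i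
    using that by fastforce
  then show "?f ` ?M \<subseteq> V \<rightarrow>\<^sub>E {..l}" by fastforce
  show "finite (V \<rightarrow>\<^sub>E {..l})" using assms by (simp add: finite_PiE)
qed

text \<open>Taking \<open>min i r\<close> gives \<open>X\<^sub>r, \<dots>, X\<^sub>n\<close>, which \<open>D(r,k)\<close> scales by
  the same \<open>\<beta>\<close>, a common weight.\<close>

definition weight :: "nat \<Rightarrow> (nat \<Rightarrow>\<^sub>0 nat) \<Rightarrow> (nat \<Rightarrow>\<^sub>0 int)" where
  "weight r m = (\<Sum>i\<in>Poly_Mapping.keys m. Poly_Mapping.single (min i r) (int (Poly_Mapping.lookup m i)))"

lemma weight_superset:
  assumes "finite S" "Poly_Mapping.keys m \<subseteq> S"
  shows "weight r m = (\<Sum>i\<in>S. Poly_Mapping.single (min i r) (int (Poly_Mapping.lookup m i)))"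
  unfolding weight_def
  by (rule sum.mono_neutral_left) (use assms in \<open>auto simp: in_keys_iff\<close>)

lemma weight_add: "weight r (m + m') = weight r m + weight r m'"
proof -
  let ?S = "Poly_Mapping.keys m \<union> Poly_Mapping.keys m'"
  have "finite ?S" "Poly_Mapping.keys (m + m') \<subseteq> ?S" using keys_add_subset[of m m'] by simp_all
  then show ?thesis
    by (simp add: weight_superset[of ?S] lookup_add single_add sum.distrib)
qed

lemma weight_0: "weight r 0 = 0"
  by (simp add: weight_def)

lemma weight_single: "weight r (Poly_Mapping.single i c) = Poly_Mapping.single (min i r) (int c)"
  by (simp add: weight_superset[of "{i}"])

lemma keys_weight:
  assumes "Poly_Mapping.keys m \<subseteq> {1..n}" "1 \<le> r"
  shows "Poly_Mapping.keys (weight r m) \<subseteq> {1..r}"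
proof
  fix j assume "j \<in> Poly_Mapping.keys (weight r m)"
  from subsetD[OF keys_sum this[unfolded weight_def]] obtain i where i: "i \<in> Poly_Mapping.keys m"
    "j \<in> Poly_Mapping.keys (Poly_Mapping.single (min i r) (int (Poly_Mapping.lookup m i)))"
    by (rule UN_E)
  have "j = min i r" using i(2) by (simp split: if_splits)
  moreover have "i \<in> {1..n}" using i(1) assms(1) by blast
  ultimately show "j \<in> {1..r}" using assms(2) by simp
qed

text \<open>On these monomials the weight remembers the degree alone. Together with
  \<open>lookup_weight_less\<close>, a weight amounts to the exponents of
  \<open>X_1, ..., X_(r-1)\<close> and the degree in the other indeterminates.\<close>

lemma weight_eq_single:
  assumes "Poly_Mapping.keys m \<subseteq> {s..n}" "r \<le> s"
  shows "weight r m = Poly_Mapping.single r (int (mon_degree m))"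
proof -
  have "weight r m = (\<Sum>i\<in>Poly_Mapping.keys m. Poly_Mapping.single r (int (Poly_Mapping.lookup m i)))"
    unfolding weight_def using assms by (intro sum.cong refl) (auto simp: min_absorb2)
  then show ?thesis by (simp add: mon_degree_def single_sum[symmetric])
qed

lemma lookup_weight_less:
  assumes "i < r"
  shows "Poly_Mapping.lookup (weight r m) i = int (Poly_Mapping.lookup m i)"
proof -
  have "Poly_Mapping.lookup (weight r m) i =
      (\<Sum>j\<in>Poly_Mapping.keys m. if j = i then int (Poly_Mapping.lookup m j) else 0)"
    unfolding weight_def lookup_sum
    using assms by (intro sum.cong refl) (auto simp: lookup_single when_def)
  then show ?thesis by (simp add: in_keys_iff)
qed

section \<open>Weight components of polynomials\<close>

definition wt_component :: "nat \<Rightarrow> (nat \<Rightarrow>\<^sub>0 int) \<Rightarrow> 'k::comm_ring_1 mpoly \<Rightarrow> 'k mpoly" where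
  "wt_component r w p = Poly_Mapping.mapp (\<lambda>m c. if weight r m = w then c else 0) p"

lemma lookup_wt_component:
  "Poly_Mapping.lookup (wt_component r w p) m = (if weight r m = w then Poly_Mapping.lookup p m else 0)"
  by (simp add: wt_component_def lookup_mapp when_def in_keys_iff)

lemma keys_wt_component:
  "Poly_Mapping.keys (wt_component r w p) = {m \<in> Poly_Mapping.keys p. weight r m = w}"
  by (auto simp: in_keys_iff lookup_wt_component split: if_splits)

lemma wt_component_add: "wt_component r w (p + q) = wt_component r w p + wt_component r w q"
  by (rule poly_mapping_eqI) (simp add: lookup_wt_component lookup_add)

lemma wt_component_0: "wt_component r w 0 = 0"
  by (rule poly_mapping_eqI) (simp add: lookup_wt_component)

lemma wt_component_sum: "wt_component r w (sum f S) = (\<Sum>i\<in>S. wt_component r w (f i))"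
  by (induction S rule: infinite_finite_induct) (simp_all add: wt_component_0 wt_component_add)

lemma wt_component_wt_component:
  "wt_component r u (wt_component r v p) = (if u = v then wt_component r v p else 0)"
  by (rule poly_mapping_eqI) (simp add: lookup_wt_component)

lemma wt_component_single:
  "wt_component r w (Poly_Mapping.single m c) = (if weight r m = w then Poly_Mapping.single m c else 0)"
  by (rule poly_mapping_eqI) (auto simp: lookup_wt_component lookup_single when_def)

text \<open>A monomial shifts weights by a constant. The difference makes sense because weights form
  a group; if no monomial of \<open>p\<close> has that weight, both sides vanish.\<close>

lemma wt_component_single_mult:
  "wt_component r w (Poly_Mapping.single m c * p) =
   Poly_Mapping.single m c * wt_component r (w - weight r m) p"
proof (induction p rule: poly_mapping_add_induct)
  case (3 m' c')
  then show ?case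
    by (auto simp: mult_single wt_component_single weight_add algebra_simps)
qed (simp_all add: wt_component_0 wt_component_add distrib_left)

lemma wt_component_smult: "wt_component r w (Const c * p) = Const c * wt_component r w p"
  using wt_component_single_mult[of r w 0 c p] by (simp add: Const_def weight_0)

lemma sum_wt_component:
  assumes "finite S" "weight r ` Poly_Mapping.keys p \<subseteq> S"
  shows "(\<Sum>w\<in>S. wt_component r w p) = p"
proof (rule poly_mapping_eqI)
  fix m
  show "Poly_Mapping.lookup (\<Sum>w\<in>S. wt_component r w p) m = Poly_Mapping.lookup p m"
  proof (cases "m \<in> Poly_Mapping.keys p")
    case True
    then have "weight r m \<in> S" using assms(2) by blast
    then show ?thesis using assms(1) by (simp add: lookup_sum lookup_wt_component)
  next
    case False
    then show ?thesis by (auto simp: lookup_sum lookup_wt_component in_keys_iff intro!: sum.neutral)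
  qed
qed

lemma wt_component_closed:
  "p \<in> carrier (mpoly_ring V) \<Longrightarrow> wt_component r w p \<in> carrier (mpoly_ring V)"
  by (auto simp: mpoly_ring_simps keys_wt_component)

lemma wt_component_homogeneous:
  assumes "\<And>m. m \<in> Poly_Mapping.keys p \<Longrightarrow> weight r m = u"
  shows "wt_component r w p = (if w = u then p else 0)"
  by (rule poly_mapping_eqI) (use assms in \<open>auto simp: lookup_wt_component in_keys_iff\<close>)

lemma wt_component_mult:
  "wt_component r w (wt_component r u p * wt_component r v q) =
   (if w = u + v then wt_component r u p * wt_component r v q else 0)"
proof (rule wt_component_homogeneous)
  fix m assume "m \<in> Poly_Mapping.keys (wt_component r u p * wt_component r v q)"
  then obtain a b where "m = a + b" "a \<in> Poly_Mapping.keys (wt_component r u p)"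
    "b \<in> Poly_Mapping.keys (wt_component r v q)"
    using Poly_Mapping.keys_mult by blast
  then show "weight r m = u + v" by (simp add: keys_wt_component weight_add)
qed


section \<open>Ideals of polynomial rings\<close>

lemma mpoly_idealI:
  fixes I :: "(('v \<Rightarrow>\<^sub>0 'e::comm_monoid_add) \<Rightarrow>\<^sub>0 'k::comm_ring_1) set"
  assumes carr: "I \<subseteq> carrier (mpoly_ring V)" and null: "0 \<in> I"
    and plus: "\<And>p q. p \<in> I \<Longrightarrow> q \<in> I \<Longrightarrow> p + q \<in> I"
    and times: "\<And>p q. p \<in> I \<Longrightarrow> q \<in> carrier (mpoly_ring V) \<Longrightarrow> q * p \<in> I"
  shows "ideal I (mpoly_ring V)"
proof -
  interpret cring "mpoly_ring V :: (('v \<Rightarrow>\<^sub>0 'e) \<Rightarrow>\<^sub>0 'k) ring" by (rule cring_mpoly_ring)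
  have "- p \<in> I" if "p \<in> I" for p
    using times[OF that, of "- 1"] one_closed
    by (simp add: mpoly_ring_closed mpoly_ring_simps(1-4))
  moreover have "inv\<^bsub>add_monoid (mpoly_ring V)\<^esub> p = - p" if "p \<in> I" for p
  proof -
    have "p \<in> carrier (mpoly_ring V)" using that carr by blast
    then have "\<ominus>\<^bsub>mpoly_ring V\<^esub> p = - p"
      by (intro minus_equality) (simp_all add: mpoly_ring_closed mpoly_ring_simps(1-4))
    then show ?thesis by (simp add: a_inv_def)
  qed
  ultimately have "subgroup I (add_monoid (mpoly_ring V))"
    by (intro subgroup.intro) (use carr null plus in \<open>auto simp: mpoly_ring_simps(1-4)\<close>)
  then show ?thesis
    by (rule idealI[OF ring_axioms])
      (use times in \<open>simp_all add: mpoly_ring_simps(1-4) mult.commute\<close>)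
qed

lemma mpoly_idealD:
  fixes I :: "(('v \<Rightarrow>\<^sub>0 'e::comm_monoid_add) \<Rightarrow>\<^sub>0 'k::comm_ring_1) set"
  assumes "ideal I (mpoly_ring V)"
  shows "I \<subseteq> carrier (mpoly_ring V)" "0 \<in> I"
    "p \<in> I \<Longrightarrow> q \<in> I \<Longrightarrow> p + q \<in> I"
    "p \<in> I \<Longrightarrow> q \<in> carrier (mpoly_ring V) \<Longrightarrow> q * p \<in> I"
    "p \<in> I \<Longrightarrow> q \<in> I \<Longrightarrow> p - q \<in> I"
proof -
  interpret ideal I "mpoly_ring V" by fact
  show "I \<subseteq> carrier (mpoly_ring V)" "0 \<in> I" "p \<in> I \<Longrightarrow> q \<in> I \<Longrightarrow> p + q \<in> I"
    using a_subset additive_subgroup.zero_closed[OF additive_subgroup_axioms]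
      additive_subgroup.a_closed[OF additive_subgroup_axioms] by (simp_all add: mpoly_ring_simps(1-4))
  show times: "p \<in> I \<Longrightarrow> q \<in> carrier (mpoly_ring V) \<Longrightarrow> q * p \<in> I" for p q
    using I_l_closed by (simp add: mpoly_ring_simps(1-4))
  have "- 1 * q \<in> I" if "q \<in> I" for q
    using times[OF that, of "- 1"] one_closed by (simp add: mpoly_ring_closed mpoly_ring_simps(1-4))
  then show "p \<in> I \<Longrightarrow> q \<in> I \<Longrightarrow> p - q \<in> I"
    using additive_subgroup.a_closed[OF additive_subgroup_axioms, of p "- q"] by (simp add: mpoly_ring_simps(1-4))
qed

lemma mpoly_ideal_sum:
  assumes "ideal I (mpoly_ring V)" "\<And>i. i \<in> S \<Longrightarrow> f i \<in> I"
  shows "sum f S \<in> I"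
  using assms(2)
  by (induction S rule: infinite_finite_induct)
    (simp_all add: mpoly_idealD(2)[OF assms(1)] mpoly_idealD(3)[OF assms(1)])

lemma mpoly_set_add:
  "I <+>\<^bsub>mpoly_ring V\<^esub> J = {p + q | p q. p \<in> I \<and> q \<in> J}"
  by (auto simp: set_add_def' mpoly_ring_simps(1-4))

section \<open>Powers of the ideal of the indeterminates\<close>

text \<open>Membership form of the power of the ideal of the indeterminates, by
  \<open>var_ideal_power_eq\<close>. Being a condition on monomials, it is visibly compatible with
  weight components.\<close>

definition deg_ideal :: "nat \<Rightarrow> nat \<Rightarrow> 'k::field mpoly set" where
  "deg_ideal n l = {p \<in> carrier (poly_ring_n n). \<forall>m\<in>Poly_Mapping.keys p. l \<le> mon_degree m}"

lemma ideal_deg_ideal: "ideal (deg_ideal n l :: 'k::field mpoly set) (poly_ring_n n)"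
proof (rule mpoly_idealI)
  fix p q :: "'k mpoly"
  assume p: "p \<in> deg_ideal n l"
  show "q * p \<in> deg_ideal n l" if "q \<in> carrier (poly_ring_n n)"
  proof -
    have "l \<le> mon_degree m" if m: "m \<in> Poly_Mapping.keys (q * p)" for m
    proof -
      obtain a b where "m = a + b" "b \<in> Poly_Mapping.keys p" using m Poly_Mapping.keys_mult[of q p] by blast
      then show ?thesis using p by (auto simp: deg_ideal_def mon_degree_add)
    qed
    then show ?thesis using p that by (simp add: deg_ideal_def mpoly_ring_closed)
  qed
  assume q: "q \<in> deg_ideal n l"
  have "l \<le> mon_degree m" if "m \<in> Poly_Mapping.keys (p + q)" for m
    using that p q Poly_Mapping.keys_add[of p q] by (auto simp: deg_ideal_def)
  then show "p + q \<in> deg_ideal n l" using p q by (simp add: deg_ideal_def mpoly_ring_closed)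
qed (auto simp: deg_ideal_def mpoly_ring_0)

lemma single_split_Var:
  assumes "i \<in> Poly_Mapping.keys m"
  shows "Poly_Mapping.single m c = Poly_Mapping.single (m - Poly_Mapping.single i 1) c * Var i"
    "mon_degree m = Suc (mon_degree (m - Poly_Mapping.single i 1))"
    "Poly_Mapping.keys (m - Poly_Mapping.single i 1) \<subseteq> Poly_Mapping.keys m"
proof -
  have m: "m = m - Poly_Mapping.single i 1 + Poly_Mapping.single i 1"
    by (rule poly_mapping_eqI) (use assms in \<open>auto simp: lookup_add lookup_minus lookup_single when_def in_keys_iff\<close>)
  show "Poly_Mapping.single m c = Poly_Mapping.single (m - Poly_Mapping.single i 1) c * Var i"
    by (subst (1) m) (simp add: Var_def mult_single)
  show "mon_degree m = Suc (mon_degree (m - Poly_Mapping.single i 1))"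
    by (subst (1) m) (simp add: mon_degree_add mon_degree_single)
  show "Poly_Mapping.keys (m - Poly_Mapping.single i 1) \<subseteq> Poly_Mapping.keys m"
    by (auto simp: in_keys_iff lookup_minus)
qed

lemma ex_key_of_mon_degree: "Suc l \<le> mon_degree m \<Longrightarrow> \<exists>i. i \<in> Poly_Mapping.keys m"
  by (metis all_not_in_conv le_zero_eq mon_degree_def nat.distinct(1) sum.empty)

text \<open>Every monomial of degree at least \<open>l + 1\<close> is some \<open>X_i\<close> times
  one of degree at least \<open>l\<close>, so additive closure of \<open>J\<close> suffices.
  \<open>J\<close> will be the ideal of the indeterminates and an ideal product.\<close>

lemma deg_ideal_Suc_subset:
  fixes J :: "'k::field mpoly set"
  assumes "0 \<in> J" and "\<And>p q. p \<in> J \<Longrightarrow> q \<in> J \<Longrightarrow> p + q \<in> J"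
    and "\<And>p i. p \<in> deg_ideal n l \<Longrightarrow> i \<in> {1..n} \<Longrightarrow> p * Var i \<in> J"
  shows "deg_ideal n (Suc l) \<subseteq> J"
proof
  fix p :: "'k mpoly" assume p: "p \<in> deg_ideal n (Suc l)"
  show "p \<in> J"
  proof (rule poly_mapping_add_induct[of "\<lambda>p. p \<in> J" p])
    fix m and c :: 'k assume m: "m \<in> Poly_Mapping.keys p"
    then have km: "Poly_Mapping.keys m \<subseteq> {1..n}" "Suc l \<le> mon_degree m"
      using p by (auto simp: deg_ideal_def mpoly_ring_simps)
    obtain i where i: "i \<in> Poly_Mapping.keys m" using ex_key_of_mon_degree[OF km(2)] by blast
    have "Poly_Mapping.single (m - Poly_Mapping.single i 1) c \<in> deg_ideal n l"
      using single_split_Var(2,3)[OF i] km by (auto simp: deg_ideal_def mpoly_ring_simps)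
    then show "Poly_Mapping.single m c \<in> J"
      using assms(3) i km(1) unfolding single_split_Var(1)[OF i] by blast
  qed (use assms in auto)
qed

lemma deg_ideal_0: "deg_ideal n 0 = carrier (poly_ring_n n)"
  by (auto simp: deg_ideal_def)

lemma Var_deg_ideal: "i \<in> {1..n} \<Longrightarrow> Var i \<in> deg_ideal n 1"
  by (auto simp: deg_ideal_def Var_def mpoly_ring_simps mon_degree_single)

lemma var_ideal_eq: "(var_ideal n :: 'k::field mpoly set) = deg_ideal n 1"
proof -
  interpret cring "poly_ring_n n :: ('k mpoly) ring" by (rule cring_mpoly_ring)
  have V: "Var ` {1..n} \<subseteq> carrier (poly_ring_n n :: ('k mpoly) ring)"
    by (auto intro: mpoly_ring_Var)
  have id: "ideal (var_ideal n :: 'k mpoly set) (poly_ring_n n)"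
    unfolding var_ideal_def by (rule genideal_ideal[OF V])
  show ?thesis
  proof
    show "(var_ideal n :: 'k mpoly set) \<subseteq> deg_ideal n 1"
      unfolding var_ideal_def
      by (rule genideal_minimal[OF ideal_deg_ideal]) (auto simp: Var_deg_ideal simp del: One_nat_def)
    have "p * Var i \<in> (var_ideal n :: 'k mpoly set)" if "p \<in> deg_ideal n 0" "i \<in> {1..n}" for p i
    proof -
      have "Var i \<in> (var_ideal n :: 'k mpoly set)"
        using genideal_self[OF V] that(2) unfolding var_ideal_def by blast
      then show ?thesis using mpoly_idealD(4)[OF id] that(1) by (simp add: deg_ideal_0)
    qed
    from deg_ideal_Suc_subset[OF mpoly_idealD(2,3)[OF id] this]
    show "deg_ideal n 1 \<subseteq> (var_ideal n :: 'k mpoly set)" by simp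
  qed
qed

lemma var_ideal_power_eq: "(var_ideal_power n l :: 'k::field mpoly set) = deg_ideal n l"
proof (induction l)
  case 0
  \<comment> \<open>The zeroth power is the unit of the monoid of ideals, that is, the whole
    ring.\<close>
  show ?case by (simp add: var_ideal_power_def nat_pow_def ideals_set_def deg_ideal_0)
next
  case (Suc l)
  let ?P = "poly_ring_n n :: ('k mpoly) ring"
  have "var_ideal_power n (Suc l) = ideal_prod ?P (var_ideal_power n l) (var_ideal n)"
    by (simp add: var_ideal_power_def nat_pow_def ideals_set_def)
  also have "\<dots> = ideal_prod ?P (deg_ideal n l) (deg_ideal n 1)"
    by (simp only: Suc var_ideal_eq)
  also have "\<dots> = deg_ideal n (Suc l)"
  proof
    show "ideal_prod ?P (deg_ideal n l) (deg_ideal n 1) \<subseteq> deg_ideal n (Suc l)"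
    proof
      fix p assume "p \<in> ideal_prod ?P (deg_ideal n l) (deg_ideal n 1)"
      then show "p \<in> deg_ideal n (Suc l)"
      proof induction
        case (prod i j)
        have "Suc l \<le> mon_degree m" if "m \<in> Poly_Mapping.keys (i * j)" for m
        proof -
          obtain a b where "m = a + b" "a \<in> Poly_Mapping.keys i" "b \<in> Poly_Mapping.keys j"
            using \<open>m \<in> Poly_Mapping.keys (i * j)\<close> Poly_Mapping.keys_mult by blast
          then show ?thesis using prod by (force simp: deg_ideal_def mon_degree_add)
        qed
        then show ?case using prod by (simp add: deg_ideal_def mpoly_ring_closed mpoly_ring_simps(1-4))
      next
        case (sum s1 s2)
        then show ?case
          using mpoly_idealD(3)[OF ideal_deg_ideal] by (simp add: mpoly_ring_simps(1-4))
      qed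
    qed
    have "p * q \<in> ideal_prod ?P (deg_ideal n l) (deg_ideal n 1)"
      if "p \<in> deg_ideal n l" "q \<in> deg_ideal n 1" for p q
      using ideal_prod.prod[OF that, of ?P] by (simp add: mpoly_ring_simps(1-4))
    note prod = this
    show "deg_ideal n (Suc l) \<subseteq> ideal_prod ?P (deg_ideal n l) (deg_ideal n 1)"
    proof (rule deg_ideal_Suc_subset)
      show "0 \<in> ideal_prod ?P (deg_ideal n l) (deg_ideal n 1)"
        using prod[OF mpoly_idealD(2)[OF ideal_deg_ideal] mpoly_idealD(2)[OF ideal_deg_ideal]] by simp
      show "p + q \<in> ideal_prod ?P (deg_ideal n l) (deg_ideal n 1)"
        if "p \<in> ideal_prod ?P (deg_ideal n l) (deg_ideal n 1)"
          "q \<in> ideal_prod ?P (deg_ideal n l) (deg_ideal n 1)" for p q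
        using ideal_prod.sum[OF that] by (simp add: mpoly_ring_simps(1-4))
    qed (use prod Var_deg_ideal in blast)
  qed
  finally show ?case .
qed


section \<open>Graded ideals\<close>

definition wt_graded :: "nat \<Rightarrow> 'k::field mpoly set \<Rightarrow> bool" where
  "wt_graded r I \<longleftrightarrow> (\<forall>p\<in>I. \<forall>w. wt_component r w p \<in> I)"

lemma wt_graded_deg_ideal: "wt_graded r (deg_ideal n l)"
  by (auto simp: wt_graded_def deg_ideal_def wt_component_closed keys_wt_component)

lemma wt_component_mult_mem:
  fixes I :: "'k::field mpoly set"
  assumes I: "ideal I (poly_ring_n n)" and p: "\<And>w. wt_component r w p \<in> I"
    and q: "q \<in> carrier (poly_ring_n n)"
  shows "wt_component r w (q * p) \<in> I"
proof -
  have "wt_component r w (q * p) =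
      (\<Sum>m\<in>Poly_Mapping.keys q.
         Poly_Mapping.single m (Poly_Mapping.lookup q m) * wt_component r (w - weight r m) p)"
    by (subst poly_mapping_sum_single[of q])
      (simp add: sum_distrib_right wt_component_sum wt_component_single_mult)
  also have "\<dots> \<in> I"
  proof (rule mpoly_ideal_sum[OF I])
    fix m assume "m \<in> Poly_Mapping.keys q"
    then have "Poly_Mapping.single m (Poly_Mapping.lookup q m) \<in> carrier (poly_ring_n n)"
      using q by (auto simp: mpoly_ring_simps)
    then show "Poly_Mapping.single m (Poly_Mapping.lookup q m) * wt_component r (w - weight r m) p \<in> I"
      by (rule mpoly_idealD(4)[OF I p])
  qed
  finally show ?thesis .
qed

text \<open>The polynomials with all components in the ideal generated by \<open>S\<close> form an
  ideal, by \<open>wt_component_mult_mem\<close>, and it contains \<open>S\<close>; minimality of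
  the generated ideal finishes the argument.\<close>

lemma wt_graded_generated:
  fixes I :: "'k::field mpoly set"
  assumes I: "ideal I (poly_ring_n n)"
    and gen: "I = deg_ideal n l <+>\<^bsub>poly_ring_n n\<^esub> (Idl\<^bsub>poly_ring_n n\<^esub> S)"
    and S: "S \<subseteq> carrier (poly_ring_n n)"
    and hom: "\<And>p. p \<in> S \<Longrightarrow> \<exists>u. \<forall>m\<in>Poly_Mapping.keys p. weight r m = u"
  shows "wt_graded r I"
proof -
  let ?P = "poly_ring_n n :: 'k mpoly ring"
  interpret cring ?P by (rule cring_mpoly_ring)
  have idl: "ideal (Idl\<^bsub>?P\<^esub> S) ?P" by (rule genideal_ideal[OF S])
  let ?J = "{p \<in> carrier ?P. \<forall>w. wt_component r w p \<in> Idl\<^bsub>?P\<^esub> S}"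
  have "ideal ?J ?P"
  proof (rule mpoly_idealI)
    show "0 \<in> ?J" using mpoly_idealD(2)[OF idl] by (simp add: mpoly_ring_0 wt_component_0)
    show "p + q \<in> ?J" if "p \<in> ?J" "q \<in> ?J" for p q
      using that mpoly_idealD(3)[OF idl] by (simp add: mpoly_ring_closed wt_component_add)
    show "q * p \<in> ?J" if "p \<in> ?J" "q \<in> carrier ?P" for p q
      using that wt_component_mult_mem[OF idl] by (simp add: mpoly_ring_closed)
  qed auto
  moreover have "S \<subseteq> ?J"
  proof
    fix p assume p: "p \<in> S"
    obtain u where "\<And>m. m \<in> Poly_Mapping.keys p \<Longrightarrow> weight r m = u" using hom[OF p] by blast
    then have "wt_component r w p = (if w = u then p else 0)" for w
      by (rule wt_component_homogeneous)
    then show "p \<in> ?J"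
      using p S genideal_self[OF S] mpoly_idealD(2)[OF idl] by auto
  qed
  ultimately have J: "Idl\<^bsub>?P\<^esub> S \<subseteq> ?J" by (rule genideal_minimal)
  show ?thesis
    unfolding wt_graded_def
  proof (intro ballI allI)
    fix p w assume "p \<in> I"
    then obtain a b where p: "p = a + b" "a \<in> deg_ideal n l" "b \<in> Idl\<^bsub>?P\<^esub> S"
      unfolding gen mpoly_set_add by blast
    have "wt_component r w a \<in> deg_ideal n l"
      using p(2) wt_graded_deg_ideal unfolding wt_graded_def by blast
    moreover have "wt_component r w b \<in> Idl\<^bsub>?P\<^esub> S" using p(3) J by blast
    ultimately show "wt_component r w p \<in> I"
      unfolding gen mpoly_set_add p(1) wt_component_add by blast
  qed
qed

text \<open>\<open>M\<close> contributes one fixed weight and, since \<open>r \<le> s\<close>, all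
  monomials of \<open>g\<close> have the weight determined by their common degree.\<close>

lemma weight_s_monomial_homogeneous:
  fixes f :: "'k::field mpoly"
  assumes "s_monomial_homogeneous n s f" "r \<le> s"
  shows "\<exists>u. \<forall>m\<in>Poly_Mapping.keys f. weight r m = u"
proof -
  obtain M g where M: "is_monomial M \<or> (\<exists>c. M = Const c)" and g: "s_homogeneous n s g" and f: "f = M * g"
    using assms(1) unfolding s_monomial_homogeneous_def by blast
  obtain m0 c where M0: "M = Poly_Mapping.single m0 c"
    using M by (auto simp: is_monomial_def Const_def)
  obtain d where d: "\<And>m. m \<in> Poly_Mapping.keys g \<Longrightarrow> mon_degree m = d \<and> Poly_Mapping.keys m \<subseteq> {s..n}"
    using g by (auto simp: s_homogeneous_def nonconst_homogeneous_def)
  have "weight r m = weight r m0 + Poly_Mapping.single r (int d)" if m: "m \<in> Poly_Mapping.keys f" for m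
  proof -
    obtain a b where ab: "m = a + b" "a \<in> Poly_Mapping.keys M" "b \<in> Poly_Mapping.keys g"
      using m Poly_Mapping.keys_mult[of M g] unfolding f by blast
    moreover have "a = m0" using ab(2) M0 by (simp split: if_splits)
    moreover have "weight r b = Poly_Mapping.single r (int d)"
      using d[OF ab(3)] weight_eq_single[of b s n r] assms(2) by simp
    ultimately show ?thesis by (simp add: weight_add)
  qed
  then show ?thesis by blast
qed

lemma wt_graded_star_or_monomial:
  fixes I :: "'k::field mpoly set"
  assumes I: "admissible n I" and "property_star n r I \<or> monomial_ideal n I"
  shows "wt_graded r I"
proof -
  obtain Ps where Ps: "admissible_generators n I Ps"
    and P: "\<And>P. P \<in> set Ps \<Longrightarrow> P = 0 \<or> is_monomial P \<or> (\<exists>s\<ge>r. s_monomial_homogeneous n s P)"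
    using assms(2) unfolding property_star_def monomial_ideal_def by (metis in_set_conv_nth)
  have "\<exists>u. \<forall>m\<in>Poly_Mapping.keys P. weight r m = u" if "P \<in> set Ps" for P
    using P[OF that] weight_s_monomial_homogeneous by (auto simp: is_monomial_def)
  then show ?thesis
    using Ps I unfolding admissible_generators_def var_ideal_power_eq admissible_def
    by (intro wt_graded_generated) auto
qed

text \<open>Artin's argument for the independence of characters, carried out modulo \<open>I\<close>.\<close>

lemma characters_independent_mod:
  fixes I :: "('e::comm_monoid_add \<Rightarrow>\<^sub>0 'k::field) set" and T :: "('w \<Rightarrow> 'k) set"
  assumes I: "\<And>p q. p \<in> I \<Longrightarrow> q \<in> I \<Longrightarrow> p - q \<in> I" "\<And>c p. p \<in> I \<Longrightarrow> Const c * p \<in> I" "0 \<in> I"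
    and T: "\<And>s t. s \<in> T \<Longrightarrow> t \<in> T \<Longrightarrow> (\<lambda>w. s w * t w) \<in> T" "T \<noteq> {}"
      "\<And>t w. t \<in> T \<Longrightarrow> t w \<noteq> 0"
    and "finite F" and sep: "\<And>u v. u \<in> F \<Longrightarrow> v \<in> F \<Longrightarrow> u \<noteq> v \<Longrightarrow> \<exists>t\<in>T. t u \<noteq> t v"
    and "\<And>t. t \<in> T \<Longrightarrow> (\<Sum>w\<in>F. Const (t w) * x w) \<in> I" and "w \<in> F"
  shows "x w \<in> I"
  using assms(7-10)
proof (induction F arbitrary: x w)
  case (insert u F)
  have Const: "Const (a * b) = Const a * (Const b :: 'e \<Rightarrow>\<^sub>0 'k)" "Const (a - b) = Const a - (Const b :: 'e \<Rightarrow>\<^sub>0 'k)"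
    for a b by (simp_all add: Const_def mult_single single_diff)
  have cancel: "p \<in> I" if "Const c * p \<in> I" "c \<noteq> 0" for c p
  proof -
    have "Const (inverse c) * (Const c * p) \<in> I" by (rule I(2)[OF that(1)])
    then show ?thesis using that(2) by (simp flip: mult.assoc Const(1)) (simp add: Const_def)
  qed
  have F: "x v \<in> I" if v: "v \<in> F" for v
  proof -
    obtain s where s: "s \<in> T" "s v \<noteq> s u" using insert.prems(1)[of v u] insert.hyps v by auto
    \<comment> \<open>The relation for the product of \<open>s\<close> and \<open>t\<close>, minus
      \<open>s u\<close> times the relation for \<open>t\<close>, has no term at \<open>u\<close>;
      the others acquire factors that do not vanish at the chosen index.\<close>
    have "(\<Sum>v\<in>F. Const (t v) * (Const (s v - s u) * x v)) \<in> I" if t: "t \<in> T" for t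
    proof -
      have "(\<Sum>v\<in>F. Const (t v) * (Const (s v - s u) * x v)) =
          (\<Sum>v\<in>insert u F. Const (t v) * (Const (s v - s u) * x v))"
        using insert.hyps by (simp add: Const_def)
      also have "\<dots> = (\<Sum>v\<in>insert u F. Const (s v * t v) * x v) -
          Const (s u) * (\<Sum>v\<in>insert u F. Const (t v) * x v)"
        by (simp only: sum_distrib_left sum_subtractf[symmetric] Const algebra_simps)
      also have "\<dots> \<in> I"
        using insert.prems(2)[OF T(1)[OF s(1) t]] insert.prems(2)[OF t] I by blast
      finally show ?thesis .
    qed
    then have "Const (s v - s u) * x v \<in> I"
      by (intro insert.IH[of "\<lambda>v. Const (s v - s u) * x v" v] v) (use insert.prems(1) in auto)
    then show ?thesis by (rule cancel) (use s(2) in simp)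
  qed
  \<comment> \<open>With the terms over \<open>F\<close> settled, any single relation isolates the
    term at \<open>u\<close>.\<close>
  obtain t where t: "t \<in> T" using T(2) by blast
  have sub: "sum f S \<in> I" if "finite S" "\<And>i. i \<in> S \<Longrightarrow> f i \<in> I" for f and S :: "'w set"
    using that
  proof (induction S)
    case (insert i S)
    have "- f i \<in> I" using I(1)[OF I(3), of "f i"] insert.prems by simp
    then have "sum f S - - f i \<in> I" using insert I(1) by blast
    then show ?case using insert.hyps by (simp add: add.commute)
  qed (simp add: I(3))
  have "(\<Sum>v\<in>F. Const (t v) * x v) \<in> I"
    by (rule sub) (use insert.hyps F I(2) in auto)
  then have "(\<Sum>v\<in>insert u F. Const (t v) * x v) - (\<Sum>v\<in>F. Const (t v) * x v) \<in> I"
    using insert.prems(2)[OF t] I(1) by blast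
  then have "Const (t u) * x u \<in> I" using insert.hyps by simp
  then have "x u \<in> I" by (rule cancel) (rule T(3)[OF t])
  then show ?case using F insert.prems(3) by blast
qed simp

section \<open>Torus characters and diagonal substitutions\<close>

definition torus_character :: "nat \<Rightarrow> (nat \<Rightarrow> 'k::field) \<Rightarrow> (nat \<Rightarrow>\<^sub>0 int) \<Rightarrow> 'k" where
  "torus_character r t w = (\<Prod>i\<in>{1..r}. t i powi Poly_Mapping.lookup w i)"

lemma character_torus:
  assumes "\<And>i. i \<in> {1..r} \<Longrightarrow> t i \<noteq> 0"
  shows "character (torus_character r t)"
proof
  show "torus_character r t (u + v) = torus_character r t u * torus_character r t v" for u v
    unfolding torus_character_def prod.distrib[symmetric]
    by (intro prod.cong refl) (use assms in \<open>auto simp: lookup_add power_int_add\<close>)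
qed (simp add: torus_character_def)

text \<open>The right-hand side is the factor by which \<open>m\<close> is scaled when each
  \<open>X_i\<close> is multiplied by \<open>t (min i r)\<close>; here weights and diagonal
  substitutions meet.\<close>

lemma torus_character_weight:
  assumes "Poly_Mapping.keys m \<subseteq> {1..n}" "1 \<le> r" "\<And>i. i \<in> {1..r} \<Longrightarrow> t i \<noteq> 0"
  shows "torus_character r t (weight r m) = (\<Prod>i\<in>Poly_Mapping.keys m. t (min i r) ^ Poly_Mapping.lookup m i)"
proof -
  interpret character "torus_character r t" by (rule character_torus[OF assms(3)])
  have sum: "torus_character r t (sum f S) = (\<Prod>i\<in>S. torus_character r t (f i))" for f and S :: "nat set"
    by (induction S rule: infinite_finite_induct) (simp_all add: char_0 char_add)
  have single: "torus_character r t (Poly_Mapping.single j (int c)) = t j ^ c" if "j \<in> {1..r}" for j c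
  proof -
    have "torus_character r t (Poly_Mapping.single j (int c)) = (\<Prod>i\<in>{1..r}. if i = j then t j ^ c else 1)"
      unfolding torus_character_def by (intro prod.cong refl) (auto simp: lookup_single when_def)
    then show ?thesis using that by (simp add: prod.delta')
  qed
  show ?thesis
    unfolding weight_def sum
  proof (intro prod.cong refl)
    fix i assume "i \<in> Poly_Mapping.keys m"
    then have "min i r \<in> {1..r}" using assms(1,2) by auto
    then show "torus_character r t (Poly_Mapping.single (min i r) (int (Poly_Mapping.lookup m i))) =
        t (min i r) ^ Poly_Mapping.lookup m i" by (rule single)
  qed
qed

text \<open>Both sides are additive and monomials are eigenvectors. The parameters are packed as
  \<open>a_i = t i\<close> for \<open>i < r\<close> and \<open>\<beta> = t r\<close>;
  \<open>S\<close> may be any finite set containing the weights of \<open>p\<close>.\<close>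

lemma diag_subst_eq:
  fixes p :: "'k::field mpoly"
  assumes p: "p \<in> carrier (poly_ring_n n)" and r: "1 \<le> r"
    and t: "\<And>i. i \<in> {1..r} \<Longrightarrow> t i \<noteq> 0"
    and S: "finite S" "weight r ` Poly_Mapping.keys p \<subseteq> S"
  shows "diag_subst r t (t r) p = (\<Sum>w\<in>S. Const (torus_character r t w) * wt_component r w p)"
proof -
  interpret coeff_hom "Const :: 'k \<Rightarrow> 'k mpoly" by (rule coeff_hom_Const)
  let ?Q = "\<lambda>q. diag_subst r t (t r) q = (\<Sum>w\<in>S. Const (torus_character r t w) * wt_component r w q)"
  have Const_prod: "Const (prod f A) = (\<Prod>i\<in>A. Const (f i) :: 'k mpoly)" for f and A :: "nat set"
    by (induction A rule: infinite_finite_induct) (simp_all add: hom_simps)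
  have Const_pow: "Const (a ^ j) = (Const a :: 'k mpoly) ^ j" for a j
    by (induction j) (simp_all add: hom_simps)
  have Var_pow: "Var i ^ j = (Poly_Mapping.single (Poly_Mapping.single i j) 1 :: 'k mpoly)" for i j
  proof (induction j)
    case (Suc j)
    have "Poly_Mapping.single i (Suc j) = Poly_Mapping.single i 1 + Poly_Mapping.single i j"
      by (simp flip: single_add)
    then show ?case using Suc by (simp add: Var_def mult_single)
  qed simp
  have prod_single: "(\<Prod>i\<in>A. Poly_Mapping.single (f i) (1::'k)) = Poly_Mapping.single (\<Sum>i\<in>A. f i) 1"
    for f :: "nat \<Rightarrow> (nat \<Rightarrow>\<^sub>0 nat)" and A
    by (induction A rule: infinite_finite_induct) (simp_all add: mult_single)
  show ?thesis
  proof (rule poly_mapping_add_induct[of ?Q p])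
    show "?Q (p + q)" if "?Q p" "?Q q" for p q
      using that by (simp add: diag_subst_def eval_add wt_component_add distrib_left sum.distrib)
    show "?Q 0" by (simp add: diag_subst_def eval_0 wt_component_0)
    fix m c assume m: "m \<in> Poly_Mapping.keys p"
    have km: "Poly_Mapping.keys m \<subseteq> {1..n}" using m p by (simp add: mpoly_ring_simps)
    have tw: "torus_character r t (weight r m) =
        (\<Prod>i\<in>Poly_Mapping.keys m. t (min i r) ^ Poly_Mapping.lookup m i)"
      by (rule torus_character_weight[OF km r]) (rule t)
    have "diag_subst r t (t r) (Poly_Mapping.single m c) =
        Const c * (\<Prod>i\<in>Poly_Mapping.keys m. (Const (t (min i r)) * Var i) ^ Poly_Mapping.lookup m i)"
      unfolding diag_subst_def eval_single mon_def
      by (intro arg_cong2[of _ _ _ _ "(*)"] prod.cong refl) (auto simp: min_def)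
    also have "\<dots> = Const c * (Const (torus_character r t (weight r m)) * Poly_Mapping.single m 1)"
      using poly_mapping_sum_single[of m]
      unfolding tw by (simp add: power_mult_distrib prod.distrib Var_pow prod_single Const_prod Const_pow)
    also have "\<dots> = Const (torus_character r t (weight r m)) * Poly_Mapping.single m c"
      by (simp add: Const_def mult_single mult.commute)
    also have "\<dots> = (\<Sum>w\<in>S. if w = weight r m then Const (torus_character r t w) * Poly_Mapping.single m c else 0)"
      using S m by (auto simp: sum.delta)
    also have "\<dots> = (\<Sum>w\<in>S. Const (torus_character r t w) * wt_component r w (Poly_Mapping.single m c))"
      by (intro sum.cong refl) (auto simp: wt_component_single)
    finally show "?Q (Poly_Mapping.single m c)" .
  qed
qed

text \<open>For nonzero \<open>x\<close>, equal powers make \<open>x\<close> a root of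
  \<open>X^d - 1\<close> with \<open>d\<close> the distance of the exponents, which excludes
  finitely many values.\<close>

lemma infinite_field_power_int_neq:
  fixes a b :: int
  assumes "infinite (UNIV :: 'k::field set)" "a \<noteq> b"
  obtains x :: "'k::field" where "x \<noteq> 0" "x powi a \<noteq> x powi b"
proof -
  have *: "\<exists>x :: 'k. x \<noteq> 0 \<and> x powi a \<noteq> x powi b" if "a < b" for a b :: int
  proof -
    define d where "d = nat (b - a)"
    have d: "d > 0" "b = a + int d" using that by (auto simp: d_def)
    let ?q = "monom 1 d - 1 :: 'k poly"
    have "poly ?q 0 \<noteq> 0" using d(1) by (simp add: poly_monom power_0_left)
    then have "?q \<noteq> 0" by force
    then have "finite ({x. poly ?q x = 0} \<union> {0})" using poly_roots_finite by blast
    from ex_new_if_finite[OF assms(1) this] obtain x where x: "x \<noteq> 0" "poly ?q x \<noteq> 0"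
      by auto
    have "x powi b = x powi a * x ^ d"
      unfolding d(2) using x(1) by (simp add: power_int_add)
    moreover have "x ^ d \<noteq> 1" using x(2) by (simp add: poly_monom)
    ultimately have "x powi a \<noteq> x powi b" using x(1) by simp
    then show ?thesis using x(1) by blast
  qed
  show thesis
    using *[of a b] *[of b a] assms(2) that by (cases "a < b") force+
qed

lemma wt_graded_of_diag_invariant:
  fixes I :: "'k::field mpoly set"
  assumes inf: "infinite (UNIV :: 'k set)" and I: "ideal I (poly_ring_n n)" and r: "1 \<le> r"
    and inv: "\<And>t p. (\<And>i. i \<in> {1..r} \<Longrightarrow> t i \<noteq> 0) \<Longrightarrow> p \<in> I \<Longrightarrow> diag_subst r t (t r) p \<in> I"
  shows "wt_graded r I"
  unfolding wt_graded_def
proof (intro ballI allI)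
  fix p w assume p: "p \<in> I"
  have pc: "p \<in> carrier (poly_ring_n n)" using mpoly_idealD(1)[OF I] p by blast
  \<comment> \<open>Torus characters see only the coordinates in \<open>{1..r}\<close>, so they
    separate weights supported there. The weights of \<open>p\<close> are of this kind; for any
    other \<open>w\<close> the component is zero.\<close>
  let ?F = "insert w (weight r ` Poly_Mapping.keys p) \<inter> {w. Poly_Mapping.keys w \<subseteq> {1..r}}"
  let ?T = "torus_character r ` {t :: nat \<Rightarrow> 'k. \<forall>i\<in>{1..r}. t i \<noteq> 0}"
  have sub: "weight r ` Poly_Mapping.keys p \<subseteq> ?F"
  proof
    fix v assume v: "v \<in> weight r ` Poly_Mapping.keys p"
    then obtain m where m: "v = weight r m" "m \<in> Poly_Mapping.keys p" by (rule imageE)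
    have "Poly_Mapping.keys m \<subseteq> {1..n}" using pc m(2) unfolding mpoly_ring_simps by blast
    from keys_weight[OF this r] have "Poly_Mapping.keys v \<subseteq> {1..r}" unfolding m(1) .
    then show "v \<in> ?F" using v by simp
  qed
  show "wt_component r w p \<in> I"
  proof (cases "w \<in> ?F")
    case True
    show ?thesis
    proof (rule characters_independent_mod[where I = I and T = ?T and F = ?F and x = "\<lambda>w. wt_component r w p"])
      show "p - q \<in> I" if "p \<in> I" "q \<in> I" for p q using mpoly_idealD(5)[OF I that] .
      show "Const c * p \<in> I" if "p \<in> I" for c p using mpoly_idealD(4)[OF I that mpoly_ring_Const] .
      show "0 \<in> I" by (rule mpoly_idealD(2)[OF I])
      show "(\<lambda>w. s w * t w) \<in> ?T" if st: "s \<in> ?T" "t \<in> ?T" for s t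
      proof -
        obtain s' t' where s': "s = torus_character r s'" "\<forall>i\<in>{1..r}. s' i \<noteq> 0"
          and t': "t = torus_character r t'" "\<forall>i\<in>{1..r}. t' i \<noteq> 0" using st by auto
        have "(\<lambda>w. s w * t w) = torus_character r (\<lambda>i. s' i * t' i)"
          by (simp add: fun_eq_iff s' t' torus_character_def power_int_mult_distrib prod.distrib)
        then show ?thesis using s' t' by auto
      qed
      have "(\<lambda>_. 1) \<in> {t :: nat \<Rightarrow> 'k. \<forall>i\<in>{1..r}. t i \<noteq> 0}" by simp
      then have "torus_character r (\<lambda>_. 1) \<in> ?T" by (rule imageI)
      then show "?T \<noteq> {}" by (metis empty_iff)
      show "t w \<noteq> 0" if "t \<in> ?T" for t w
        using that by (auto simp: torus_character_def)
      show "\<exists>t\<in>?T. t u \<noteq> t v" if uv: "u \<in> ?F" "v \<in> ?F" "u \<noteq> v" for u v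
      proof -
        obtain i where i: "Poly_Mapping.lookup u i \<noteq> Poly_Mapping.lookup v i"
          using poly_mapping_eqI[of u v] uv(3) by auto
        have ir: "i \<in> {1..r}"
        proof (rule ccontr)
          assume "i \<notin> {1..r}"
          moreover have "Poly_Mapping.keys u \<subseteq> {1..r}" "Poly_Mapping.keys v \<subseteq> {1..r}"
            using uv(1,2) by simp_all
          ultimately have "i \<notin> Poly_Mapping.keys u" "i \<notin> Poly_Mapping.keys v" by blast+
          then show False using i by (simp add: in_keys_iff)
        qed
        obtain x :: 'k where x: "x \<noteq> 0" "x powi Poly_Mapping.lookup u i \<noteq> x powi Poly_Mapping.lookup v i"
          using infinite_field_power_int_neq[OF inf i] by blast
        \<comment> \<open>Moving one coordinate reduces the separation of characters to that of two
          powers of \<open>x\<close>.\<close>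
        let ?t = "\<lambda>j. if j = i then x else 1"
        have "torus_character r ?t w = x powi Poly_Mapping.lookup w i" for w
        proof -
          have "torus_character r ?t w = (\<Prod>j\<in>{1..r}. if j = i then x powi Poly_Mapping.lookup w i else 1)"
            unfolding torus_character_def by (intro prod.cong refl) auto
          then show ?thesis using ir by (simp add: prod.delta')
        qed
        moreover have "torus_character r ?t \<in> ?T" using x(1) by auto
        ultimately show ?thesis using x(2) by (intro bexI[of _ "torus_character r ?t"]) simp_all
      qed
      show "(\<Sum>w\<in>?F. Const (t w) * wt_component r w p) \<in> I" if t: "t \<in> ?T" for t
      proof -
        obtain t' where t': "t = torus_character r t'" "t' \<in> {t. \<forall>i\<in>{1..r}. t i \<noteq> 0}"
          using t by (rule imageE)
        have nz: "t' i \<noteq> 0" if "i \<in> {1..r}" for i using t'(2) that by blast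
        have "diag_subst r t' (t' r) p = (\<Sum>w\<in>?F. Const (t w) * wt_component r w p)"
          unfolding t'(1) by (rule diag_subst_eq[OF pc r nz _ sub]) simp_all
        moreover have "diag_subst r t' (t' r) p \<in> I" by (rule inv[OF nz p])
        ultimately show ?thesis by simp
      qed
    qed (use True in auto)
  next
    case False
    then have "w \<notin> weight r ` Poly_Mapping.keys p" using sub by blast
    then have "wt_component r w p = 0"
      by (metis (mono_tags, lifting) image_eqI keys_wt_component[of r w p] keys_eq_empty Collect_empty_eq)
    then show ?thesis using mpoly_idealD(2)[OF I] by simp
  qed
qed


section \<open>Generators of graded admissible ideals\<close>

lemma mon_degree_eq_0_iff: "mon_degree m = 0 \<longleftrightarrow> m = 0"
proof
  assume "mon_degree m = 0"
  then have "Poly_Mapping.lookup m i = 0" for i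
    by (cases "i \<in> Poly_Mapping.keys m") (auto simp: mon_degree_def in_keys_iff)
  then show "m = 0" by (intro poly_mapping_eqI) simp
qed (simp add: mon_degree_def)

text \<open>The weight fixes the exponents below \<open>r\<close> and the degree in the other
  indeterminates. All monomials of \<open>p\<close> therefore share the factor \<open>u\<close>, and
  the cofactor \<open>g\<close> is homogeneous.\<close>

lemma s_monomial_homogeneous_of_weight:
  fixes p :: "'k::field mpoly"
  assumes p: "p \<in> carrier (poly_ring_n n)" "p \<noteq> 0" "\<not> is_monomial p" and r: "1 \<le> r"
    and w: "\<And>m. m \<in> Poly_Mapping.keys p \<Longrightarrow> weight r m = w"
  shows "s_monomial_homogeneous n r p"
proof -
  define low where "low m = Poly_Mapping.mapp (\<lambda>i c. if i < r then c else 0) m" for m :: "nat \<Rightarrow>\<^sub>0 nat"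
  define high where "high m = Poly_Mapping.mapp (\<lambda>i c. if i < r then 0 else c) m" for m :: "nat \<Rightarrow>\<^sub>0 nat"
  have lookup_low: "Poly_Mapping.lookup (low m) i = (if i < r then Poly_Mapping.lookup m i else 0)"
    and lookup_high: "Poly_Mapping.lookup (high m) i = (if i < r then 0 else Poly_Mapping.lookup m i)" for m i
    by (simp_all add: low_def high_def lookup_mapp when_def in_keys_iff)
  have split: "m = low m + high m" for m
    by (rule poly_mapping_eqI) (simp add: lookup_add lookup_low lookup_high)
  obtain m0 where m0: "m0 \<in> Poly_Mapping.keys p" using p(2) by (metis keys_eq_empty ex_in_conv)
  have keys_p: "Poly_Mapping.keys m \<subseteq> {1..n}" if "m \<in> Poly_Mapping.keys p" for m
    using p(1) that unfolding mpoly_ring_simps by blast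
  define u where "u = low m0"
  have low: "low m = u" if "m \<in> Poly_Mapping.keys p" for m
  proof (rule poly_mapping_eqI)
    fix i
    have "int (Poly_Mapping.lookup m i) = int (Poly_Mapping.lookup m0 i)" if "i < r"
      using lookup_weight_less[OF that] w[OF m0] w[OF \<open>m \<in> Poly_Mapping.keys p\<close>] by metis
    then show "Poly_Mapping.lookup (low m) i = Poly_Mapping.lookup u i"
      by (simp add: lookup_low u_def)
  qed
  have keys_high: "Poly_Mapping.keys (high m) \<subseteq> {r..n}" if "m \<in> Poly_Mapping.keys p" for m
    using keys_p[OF that] by (auto simp: in_keys_iff lookup_high subset_iff split: if_splits)
  define d where "d = mon_degree (high m0)"
  have degree_high: "mon_degree (high m) = d" if m: "m \<in> Poly_Mapping.keys p" for m
  proof -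
    have *: "w = weight r u + Poly_Mapping.single r (int (mon_degree (high m)))"
      if "m \<in> Poly_Mapping.keys p" for m
      using split[of m] weight_add[of r "low m" "high m"] low[OF that] w[OF that]
        weight_eq_single[OF keys_high[OF that] order_refl] by metis
    have "Poly_Mapping.single r (int (mon_degree (high m))) = Poly_Mapping.single r (int d)"
      using *[OF m] *[OF m0] unfolding d_def by (metis add_left_cancel)
    then show ?thesis by (metis lookup_single_eq of_nat_eq_iff)
  qed
  define g where "g = (\<Sum>m\<in>Poly_Mapping.keys p. Poly_Mapping.single (high m) (Poly_Mapping.lookup p m))"
  have pg: "p = Poly_Mapping.single u 1 * g"
  proof -
    have "Poly_Mapping.single u 1 * g =
        (\<Sum>m\<in>Poly_Mapping.keys p. Poly_Mapping.single (u + high m) (Poly_Mapping.lookup p m))"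
      by (simp add: g_def sum_distrib_left mult_single)
    also have "\<dots> = (\<Sum>m\<in>Poly_Mapping.keys p. Poly_Mapping.single m (Poly_Mapping.lookup p m))"
      by (intro sum.cong refl) (metis low split)
    finally show ?thesis using poly_mapping_sum_single[of p] by simp
  qed
  have keys_g: "mon_degree m = d \<and> Poly_Mapping.keys m \<subseteq> {r..n}" if m: "m \<in> Poly_Mapping.keys g" for m
  proof -
    from subsetD[OF keys_sum m[unfolded g_def]] obtain m' where "m' \<in> Poly_Mapping.keys p"
      "m \<in> Poly_Mapping.keys (Poly_Mapping.single (high m') (Poly_Mapping.lookup p m'))"
      by (rule UN_E)
    then show ?thesis using degree_high keys_high by (simp split: if_splits)
  qed
  have not_mon: "g \<noteq> Poly_Mapping.single m c" for m c
  proof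
    assume "g = Poly_Mapping.single m c"
    then have "p = Poly_Mapping.single (u + m) c" using pg by (simp add: mult_single)
    then show False using p(2,3) unfolding is_monomial_def by (metis single_zero)
  qed
  \<comment> \<open>In degree \<open>0\<close> the cofactor would be a scalar and \<open>p\<close> a
    monomial.\<close>
  have "d \<noteq> 0"
  proof
    assume "d = 0"
    then have "g = Poly_Mapping.single 0 (Poly_Mapping.lookup g 0)"
      using keys_g mon_degree_eq_0_iff
      by (intro poly_mapping_eqI) (auto simp: lookup_single when_def in_keys_iff)
    then show False using not_mon by metis
  qed
  have "s_homogeneous n r g"
    unfolding s_homogeneous_def nonconst_homogeneous_def is_monomial_def
  proof (intro conjI)
    show "g \<noteq> 0" using not_mon[of 0 0] by simp
    show "\<exists>d\<ge>1. \<forall>m\<in>Poly_Mapping.keys g. mon_degree m = d"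
      using keys_g \<open>d \<noteq> 0\<close> by (intro exI[of _ d]) simp
  qed (use r keys_g not_mon in blast)+
  moreover have "nonconst_homogeneous p"
    unfolding nonconst_homogeneous_def
  proof (intro conjI exI ballI)
    show "mon_degree m = mon_degree u + d" if "m \<in> Poly_Mapping.keys p" for m
      using split[of m] mon_degree_add[of "low m" "high m"] low[OF that] degree_high[OF that] by metis
    show "1 \<le> mon_degree u + d" using \<open>d \<noteq> 0\<close> by simp
  qed (rule p(2))
  moreover have "Poly_Mapping.single u 1 \<in> carrier (poly_ring_n n :: 'k mpoly ring)"
    using keys_p[OF m0] by (auto simp: mpoly_ring_simps u_def in_keys_iff lookup_low subset_iff split: if_splits)
  moreover have "is_monomial (Poly_Mapping.single u (1::'k))"
    unfolding is_monomial_def by (intro exI conjI) (rule one_neq_zero, rule refl)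
  ultimately show ?thesis
    unfolding s_monomial_homogeneous_def using pg by blast
qed

lemma vector_space_mpoly: "vector_space (\<lambda>c p :: 'k::field mpoly. Const c * p)"
  by unfold_locales (simp_all add: Const_def algebra_simps single_add mult_single flip: mult.assoc)

text \<open>A generating list has to be finite. \<open>V\<close> lies in the finite-dimensional
  space of polynomials of degree below \<open>l\<close>, so it has a finite basis; stating the
  conclusion through ideals keeps vector spaces local.\<close>

lemma finitely_spanned_mod_degree:
  fixes I :: "'k::field mpoly set" and l :: nat
  assumes I: "ideal I (poly_ring_n n)"
  defines "V \<equiv> {p \<in> I. \<forall>m\<in>Poly_Mapping.keys p. mon_degree m < l}"
  shows "\<exists>B. finite B \<and> B \<subseteq> V \<and> (\<forall>J. ideal J (poly_ring_n n) \<longrightarrow> B \<subseteq> J \<longrightarrow> V \<subseteq> J)"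
proof -
  interpret vector_space "\<lambda>c p :: 'k mpoly. Const c * p" by (rule vector_space_mpoly)
  let ?F = "(\<lambda>m. Poly_Mapping.single m (1::'k)) ` {m. Poly_Mapping.keys m \<subseteq> {1..n} \<and> mon_degree m < l}"
  obtain B where B: "B \<subseteq> V" "independent B" "V \<subseteq> span B" by (rule maximal_independent_subset)
  have "p \<in> span ?F" if p: "p \<in> V" for p
  proof -
    have "p = (\<Sum>m\<in>Poly_Mapping.keys p. Const (Poly_Mapping.lookup p m) * Poly_Mapping.single m 1)"
      using poly_mapping_sum_single[of p] by (simp add: Const_def mult_single)
    also have "\<dots> \<in> span ?F"
    proof (intro span_sum span_scale span_base imageI CollectI conjI)
      fix m assume m: "m \<in> Poly_Mapping.keys p"
      have "p \<in> carrier (poly_ring_n n)" using p mpoly_idealD(1)[OF I] by (auto simp: V_def)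
      then show "Poly_Mapping.keys m \<subseteq> {1..n}" using m unfolding mpoly_ring_simps by blast
      show "mon_degree m < l" using p m by (simp add: V_def)
    qed
    finally show ?thesis .
  qed
  then have "B \<subseteq> span ?F" using B(1) by blast
  then have "finite B"
    using independent_span_bound[OF _ B(2)] finite_mon_degree_less[of "{1..n}" l] by blast
  then show ?thesis
  proof (intro exI[of _ B] conjI allI impI B(1))
    fix J :: "'k mpoly set" assume J: "ideal J (poly_ring_n n)" "B \<subseteq> J"
    have "subspace J"
      by (rule subspaceI)
        (simp_all only: mpoly_idealD(2)[OF J(1)] mpoly_idealD(3)[OF J(1)]
          mpoly_idealD(4)[OF J(1) _ mpoly_ring_Const])
    then show "V \<subseteq> J" using span_minimal[OF J(2)] B(3) by blast
  qed
qed

text \<open>The generators are the nonzero weight components of a basis of the part of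
  \<open>I\<close> below the Loewy length. The cut-off gives the upper degree bound, containment in
  \<open>deg_ideal n 2\<close> the lower one.\<close>

lemma star_or_monomial_of_wt_graded:
  fixes I :: "'k::field mpoly set"
  assumes adm: "admissible n I" and graded: "wt_graded r I" and r: "1 \<le> r"
  shows "property_star n r I \<or> monomial_ideal n I"
proof -
  let ?P = "poly_ring_n n :: 'k mpoly ring"
  interpret cring ?P by (rule cring_mpoly_ring)
  have I: "ideal I ?P" using adm by (simp add: admissible_def)
  define l where "l = loewy_length n I"
  have "\<exists>l. l \<ge> 2 \<and> var_ideal_power n l \<subseteq> I \<and> I \<subseteq> var_ideal_power n 2"
    using adm by (auto simp: admissible_def)
  from LeastI_ex[OF this] have l: "l \<ge> 2" "deg_ideal n l \<subseteq> I" "I \<subseteq> deg_ideal n 2"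
    unfolding var_ideal_power_eq by (auto simp: l_def loewy_length_def var_ideal_power_eq)
  let ?V = "{p \<in> I. \<forall>m\<in>Poly_Mapping.keys p. mon_degree m < l}"
  obtain B where B: "finite B" "B \<subseteq> ?V" "\<forall>J. ideal J ?P \<longrightarrow> B \<subseteq> J \<longrightarrow> ?V \<subseteq> J"
    using finitely_spanned_mod_degree[OF I, of l] by (elim exE conjE) (rule that)
  define S where "S = (\<Union>b\<in>B. (\<lambda>w. wt_component r w b) ` weight r ` Poly_Mapping.keys b)"
  have "finite S" using B(1) by (simp add: S_def)
  then obtain Ps where Ps: "set Ps = S" using finite_list by blast
  have S: "p \<in> I \<and> p \<noteq> 0 \<and> (\<forall>m\<in>Poly_Mapping.keys p. 2 \<le> mon_degree m \<and> mon_degree m < l) \<and>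
      (\<exists>w. \<forall>m\<in>Poly_Mapping.keys p. weight r m = w)" if p: "p \<in> S" for p
  proof -
    obtain b m where b: "b \<in> B" "m \<in> Poly_Mapping.keys b" "p = wt_component r (weight r m) b"
      using p by (auto simp: S_def)
    have bI: "b \<in> I" using b(1) B(2) by blast
    have "m \<in> Poly_Mapping.keys p" using b by (simp add: keys_wt_component)
    then have "p \<noteq> 0" by auto
    moreover have "p \<in> I" using graded bI b(3) by (simp add: wt_graded_def)
    moreover have "2 \<le> mon_degree m" if "m \<in> Poly_Mapping.keys p" for m
      using \<open>p \<in> I\<close> l(3) that by (auto simp: deg_ideal_def)
    moreover have "mon_degree m < l" if "m \<in> Poly_Mapping.keys p" for m
      using that b(1,3) B(2) by (auto simp: keys_wt_component)
    moreover have "\<forall>m'\<in>Poly_Mapping.keys p. weight r m' = weight r m"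
      using b(3) by (simp add: keys_wt_component)
    ultimately show ?thesis by blast
  qed
  have S_carr: "S \<subseteq> carrier ?P" using S mpoly_idealD(1)[OF I] by blast
  have idl: "ideal (Idl\<^bsub>?P\<^esub> S) ?P" by (rule genideal_ideal[OF S_carr])
  have "B \<subseteq> Idl\<^bsub>?P\<^esub> S"
  proof
    fix b assume b: "b \<in> B"
    have "b = (\<Sum>w\<in>weight r ` Poly_Mapping.keys b. wt_component r w b)"
      by (simp add: sum_wt_component)
    also have "\<dots> \<in> Idl\<^bsub>?P\<^esub> S"
      by (rule mpoly_ideal_sum[OF idl]) (use b genideal_self[OF S_carr] in \<open>auto simp: S_def\<close>)
    finally show "b \<in> Idl\<^bsub>?P\<^esub> S" .
  qed
  from B(3)[rule_format, OF idl this] have V: "?V \<subseteq> Idl\<^bsub>?P\<^esub> S" .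
  have gen: "I = deg_ideal n l <+>\<^bsub>?P\<^esub> (Idl\<^bsub>?P\<^esub> S)"
  proof
    show "I \<subseteq> deg_ideal n l <+>\<^bsub>?P\<^esub> (Idl\<^bsub>?P\<^esub> S)"
    proof
      fix p assume p: "p \<in> I"
      \<comment> \<open>The terms of degree at least \<open>l\<close>, which lie in \<open>I\<close>
        in any case; hence the remainder belongs to \<open>?V\<close>.\<close>
      define q where "q = Poly_Mapping.mapp (\<lambda>m c. if mon_degree m < l then 0 else c) p"
      have lookup_q: "Poly_Mapping.lookup q m = (if mon_degree m < l then 0 else Poly_Mapping.lookup p m)" for m
        by (simp add: q_def lookup_mapp when_def in_keys_iff)
      have pc: "p \<in> carrier ?P" using p mpoly_idealD(1)[OF I] by blast
      have "q \<in> deg_ideal n l"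
        using pc by (auto simp: deg_ideal_def mpoly_ring_simps in_keys_iff lookup_q split: if_splits)
      moreover have "p - q \<in> ?V"
        using mpoly_idealD(5)[OF I p] calculation l(2)
        by (auto simp: in_keys_iff lookup_minus lookup_q split: if_splits)
      ultimately show "p \<in> deg_ideal n l <+>\<^bsub>?P\<^esub> (Idl\<^bsub>?P\<^esub> S)"
        using V unfolding mpoly_set_add by (intro CollectI exI[of _ q] exI[of _ "p - q"]) auto
    qed
    have "Idl\<^bsub>?P\<^esub> S \<subseteq> I" by (rule genideal_minimal[OF I]) (use S in blast)
    then show "deg_ideal n l <+>\<^bsub>?P\<^esub> (Idl\<^bsub>?P\<^esub> S) \<subseteq> I"
      using l(2) mpoly_idealD(3)[OF I] unfolding mpoly_set_add by blast
  qed
  have "2 \<le> total_degree p \<and> total_degree p \<le> l - 1 \<and> (\<forall>m\<in>Poly_Mapping.keys p. mon_degree m \<noteq> 1)"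
    if p: "p \<in> S" for p
  proof (intro conjI)
    have d: "2 \<le> mon_degree m \<and> mon_degree m < l" if "m \<in> Poly_Mapping.keys p" for m
      using S[OF p] that by blast
    obtain m where m: "m \<in> Poly_Mapping.keys p" using S[OF p] by (metis keys_eq_empty ex_in_conv)
    have "mon_degree m \<le> total_degree p" unfolding total_degree_def using m by (intro Max_ge) auto
    then show "2 \<le> total_degree p" using d[OF m] by simp
    show "total_degree p \<le> l - 1" unfolding total_degree_def using d by (intro Max.boundedI) force+
    show "\<forall>m\<in>Poly_Mapping.keys p. mon_degree m \<noteq> 1" using d by force
  qed
  then have adm_gen: "admissible_generators n I Ps"
    using gen S_carr unfolding admissible_generators_def Ps var_ideal_power_eq l_def by blast
  have hom: "is_monomial p \<or> s_monomial_homogeneous n r p" if "p \<in> S" for p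
    using s_monomial_homogeneous_of_weight[OF _ _ _ r] S[OF that] S_carr that by (metis subsetD)
  show ?thesis
  \<comment> \<open>Property \<open>*\<close> demands at least one \<open>s\<close>-monomial
    homogeneous generator. By \<open>hom\<close>, any element of \<open>S\<close> that is not a
    monomial is one; if there is none, the ideal is monomial.\<close>
  proof (cases "\<forall>p\<in>S. is_monomial p")
    case True
    then show ?thesis using adm_gen Ps unfolding monomial_ideal_def by blast
  next
    case False
    then obtain p where p: "p \<in> S" "\<not> is_monomial p" by blast
    obtain i where i: "i < length Ps" "Ps ! i = p" using p(1) Ps by (metis in_set_conv_nth)
    have "\<exists>s\<ge>r. s_monomial_homogeneous n s (Ps ! i)" using hom[OF p(1)] p(2) i(2) by blast
    moreover have "is_monomial (Ps ! j) \<or> (\<exists>u\<ge>r. s_monomial_homogeneous n u (Ps ! j))"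
      if "j < length Ps" for j
      using hom[of "Ps ! j"] that Ps by (metis nth_mem order_refl)
    ultimately have "property_star n r I"
      unfolding property_star_def using adm_gen i(1) by blast
    then show ?thesis ..
  qed
qed


section \<open>Presentations\<close>

locale presented_algebra = fd_comm_algebra smul Basis
  for smul :: "'k::field \<Rightarrow> 'a::comm_ring_1 \<Rightarrow> 'a" and Basis :: "'a set" +
  fixes n :: nat and I :: "'k mpoly set" and h :: "'k mpoly set \<Rightarrow> 'a"
  assumes ideal_I: "ideal I (poly_ring_n n)" and h: "h \<in> presentations smul n I"
begin

definition proj :: "'k mpoly \<Rightarrow> 'a" where
  "proj p = h (I +>\<^bsub>poly_ring_n n\<^esub> p)"

lemma proj_ring_hom: "proj \<in> ring_hom (poly_ring_n n) type_ring"
proof -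
  have "h \<in> ring_hom (poly_ring_n n Quot I) type_ring"
    using h by (simp add: presentations_def alg_iso_def ring_iso_def)
  from ring_hom_trans[OF ideal.rcos_ring_hom[OF ideal_I] this] show ?thesis
    by (simp add: proj_def[abs_def] comp_def)
qed

lemma proj_add: "p \<in> carrier (poly_ring_n n) \<Longrightarrow> q \<in> carrier (poly_ring_n n) \<Longrightarrow> proj (p + q) = proj p + proj q"
  and proj_mult: "p \<in> carrier (poly_ring_n n) \<Longrightarrow> q \<in> carrier (poly_ring_n n) \<Longrightarrow> proj (p * q) = proj p * proj q"
  and proj_1: "proj 1 = 1"
  using proj_ring_hom unfolding ring_hom_def type_ring_simps mpoly_ring_simps(1-4) by blast+

lemma proj_Const: "proj (Const c) = scalar smul c"
  using h by (simp add: presentations_def alg_iso_def proj_def)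

lemma proj_0: "proj 0 = 0"
  using proj_add[OF mpoly_ring_0 mpoly_ring_0] by simp

lemma proj_Const_mult: "p \<in> carrier (poly_ring_n n) \<Longrightarrow> proj (Const c * p) = smul c (proj p)"
  using proj_mult[OF mpoly_ring_Const] by (simp add: proj_Const smul_mult_left[symmetric])

lemma proj_sum:
  "(\<And>i. i \<in> S \<Longrightarrow> f i \<in> carrier (poly_ring_n n)) \<Longrightarrow> proj (sum f S) = (\<Sum>i\<in>S. proj (f i))"
proof (induction S rule: infinite_finite_induct)
  case (insert i S)
  have "proj (f i + sum f S) = proj (f i) + proj (sum f S)"
    by (rule proj_add) (use insert.prems in \<open>auto intro: mpoly_ring_sum\<close>)
  then show ?case using insert by simp
qed (simp_all add: proj_0)

lemma proj_eq_0_iff: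
  assumes "p \<in> carrier (poly_ring_n n)"
  shows "proj p = 0 \<longleftrightarrow> p \<in> I"
proof -
  interpret P: cring "poly_ring_n n :: 'k mpoly ring" by (rule cring_mpoly_ring)
  interpret ideal I "poly_ring_n n" by (rule ideal_I)
  have inj: "inj_on h (carrier (poly_ring_n n Quot I))"
    using h by (simp add: presentations_def alg_iso_def ring_iso_def bij_betw_def)
  have coset: "I +>\<^bsub>poly_ring_n n\<^esub> q \<in> carrier (poly_ring_n n Quot I)" if "q \<in> carrier (poly_ring_n n)" for q
    using rcos_ring_hom that by (auto simp: ring_hom_def)
  have I0: "I +>\<^bsub>poly_ring_n n\<^esub> 0 = I"
    using P.a_coset_add_zero[OF a_subset] by (simp add: mpoly_ring_simps(1-4))
  have "proj p = 0 \<longleftrightarrow> h (I +>\<^bsub>poly_ring_n n\<^esub> p) = h (I +>\<^bsub>poly_ring_n n\<^esub> 0)"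
    using proj_0 by (simp add: proj_def)
  also have "\<dots> \<longleftrightarrow> I +>\<^bsub>poly_ring_n n\<^esub> p = I"
    using inj_on_eq_iff[OF inj coset[OF assms] coset[OF mpoly_ring_0]] I0 by simp
  also have "\<dots> \<longleftrightarrow> p \<in> I"
    using a_rcos_const a_rcos_self[OF assms] by blast
  finally show ?thesis .
qed

lemma proj_eq_iff:
  assumes "p \<in> carrier (poly_ring_n n)" "q \<in> carrier (poly_ring_n n)"
  shows "proj p = proj q \<longleftrightarrow> p - q \<in> I"
proof -
  have "proj p = proj (p - q) + proj q"
    using proj_add[OF mpoly_ring_closed(3)[OF assms] assms(2)] by simp
  then show ?thesis using proj_eq_0_iff[OF mpoly_ring_closed(3)[OF assms]] by simp
qed

text \<open>A set-theoretic section of \<open>proj\<close>, through which projections on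
  \<open>A\<close> are defined by polynomials; \<open>pr_proj\<close> shows that the choice does not
  matter.\<close>

definition lift :: "'a \<Rightarrow> 'k mpoly" where
  "lift a = (SOME p. p \<in> carrier (poly_ring_n n) \<and> proj p = a)"

lemma lift: "lift a \<in> carrier (poly_ring_n n)" "proj (lift a) = a"
proof -
  have "h ` carrier (poly_ring_n n Quot I) = UNIV"
    using h by (simp add: presentations_def alg_iso_def ring_iso_def bij_betw_def type_ring_simps)
  then obtain x where x: "x \<in> carrier (poly_ring_n n Quot I)" "h x = a" by (metis UNIV_I imageE)
  obtain p where "p \<in> carrier (poly_ring_n n)" "x = I +>\<^bsub>poly_ring_n n\<^esub> p"
    using x(1) by (auto simp: FactRing_def A_RCOSETS_def')
  then have "\<exists>p. p \<in> carrier (poly_ring_n n) \<and> proj p = a" using x(2) by (auto simp: proj_def)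
  from someI_ex[OF this] show "lift a \<in> carrier (poly_ring_n n)" "proj (lift a) = a"
    unfolding lift_def by blast+
qed

end

section \<open>The grading of \<open>A\<close> defined by a graded ideal\<close>

locale graded_presentation = presented_algebra smul Basis n I h
  for smul :: "'k::field \<Rightarrow> 'a::comm_ring_1 \<Rightarrow> 'a" and Basis :: "'a set"
    and n I and h :: "'k mpoly set \<Rightarrow> 'a" +
  fixes r l :: nat
  assumes r: "1 \<le> r" "r \<le> n" and graded: "wt_graded r I"
    and I_deg: "deg_ideal n l \<subseteq> I" "I \<subseteq> deg_ideal n 2"
begin

definition pr :: "(nat \<Rightarrow>\<^sub>0 int) \<Rightarrow> 'a \<Rightarrow> 'a" where
  "pr w a = proj (wt_component r w (lift a))"

definition weights :: "(nat \<Rightarrow>\<^sub>0 int) set" where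
  "weights = weight r ` {m. Poly_Mapping.keys m \<subseteq> {1..n} \<and> mon_degree m < l}"

text \<open>Two representatives differ by an element of \<open>I\<close>, whose components lie in
  \<open>I\<close> by \<open>graded\<close>.\<close>

lemma pr_proj:
  assumes p: "p \<in> carrier (poly_ring_n n)"
  shows "pr w (proj p) = proj (wt_component r w p)"
proof -
  let ?q = "lift (proj p)"
  have "?q - p \<in> I"
    using proj_eq_iff[OF lift(1) p] lift(2) by blast
  then have "wt_component r w (?q - p) \<in> I" using graded unfolding wt_graded_def by blast
  moreover have "wt_component r w (?q - p) = wt_component r w ?q - wt_component r w p"
    by (rule poly_mapping_eqI) (simp add: lookup_wt_component lookup_minus)
  ultimately show ?thesis
    unfolding pr_def
    using proj_eq_iff[OF wt_component_closed[OF lift(1)] wt_component_closed[OF p]] by simp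
qed

text \<open>What the components indexed by \<open>weights\<close> miss has only monomials of degree
  at least \<open>l\<close> and therefore vanishes in \<open>A\<close>.\<close>

lemma sum_weights_proj:
  assumes p: "p \<in> carrier (poly_ring_n n)"
  shows "(\<Sum>w\<in>weights. pr w (proj p)) = proj p"
proof -
  let ?q = "\<Sum>w\<in>weights. wt_component r w p"
  have fin: "finite weights"
    unfolding weights_def by (intro finite_imageI finite_mon_degree_less) simp
  have qc: "?q \<in> carrier (poly_ring_n n)" by (intro mpoly_ring_sum wt_component_closed p)
  have lookup_q: "Poly_Mapping.lookup ?q m = (if weight r m \<in> weights then Poly_Mapping.lookup p m else 0)" for m
    using fin by (simp add: lookup_sum lookup_wt_component)
  have pq: "p - ?q \<in> carrier (poly_ring_n n)" by (rule mpoly_ring_closed(3)[OF p qc])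
  have "l \<le> mon_degree m" if m: "m \<in> Poly_Mapping.keys (p - ?q)" for m
  proof (rule ccontr)
    assume "\<not> l \<le> mon_degree m"
    moreover have "Poly_Mapping.keys m \<subseteq> {1..n}" using pq m unfolding mpoly_ring_simps by blast
    ultimately have "weight r m \<in> weights" unfolding weights_def by simp
    then show False using m by (simp add: in_keys_iff lookup_minus lookup_q)
  qed
  then have "p - ?q \<in> I" using pq I_deg(1) unfolding deg_ideal_def by blast
  then have eq: "proj p = proj ?q" using proj_eq_iff[OF p qc] by simp
  have "(\<Sum>w\<in>weights. pr w (proj p)) = proj ?q"
    using proj_sum[of weights "\<lambda>w. wt_component r w p"] wt_component_closed[OF p]
    by (simp add: pr_proj[OF p])
  then show ?thesis using eq by (rule trans[OF _ sym])
qed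

sublocale torus_graded_algebra smul Basis weights pr r
proof
  note comp = wt_component_closed[OF lift(1)]
  show "finite weights"
    unfolding weights_def by (intro finite_imageI finite_mon_degree_less) simp
  show "pr w (a + b) = pr w a + pr w b" for w a b
    using pr_proj[OF mpoly_ring_closed(1)[OF lift(1)[of a] lift(1)[of b]], of w]
    by (simp add: proj_add lift comp wt_component_add pr_def[symmetric] del: One_nat_def)
  show "pr w (smul c a) = smul c (pr w a)" for w c a
    using pr_proj[OF mpoly_ring_closed(2)[OF mpoly_ring_Const lift(1)[of a]], of w c]
    by (simp add: proj_Const_mult lift comp wt_component_smult pr_def[symmetric] del: One_nat_def)
  show "pr u (pr v a) = (if u = v then pr v a else 0)" for u v a
    using pr_proj[OF comp, of u r v a] by (simp add: wt_component_wt_component proj_0 pr_def[symmetric] del: One_nat_def)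
  show "(\<Sum>w\<in>weights. pr w a) = a" for a
    using sum_weights_proj[OF lift(1)[of a]] by (simp add: lift)
  show "pr w (pr u a * pr v b) = (if w = u + v then pr u a * pr v b else 0)" for w u v a b
    using pr_proj[OF mpoly_ring_closed(2)[OF comp comp], of w r u a r v b]
    by (simp add: proj_mult comp wt_component_mult proj_0 pr_def[symmetric] del: One_nat_def)
  have one: "1 \<in> carrier (poly_ring_n n :: 'k mpoly ring)" "(1 :: 'k mpoly) = Poly_Mapping.single 0 1"
    using mpoly_ring_Const[of "1::'k" "{1..n}"] by (simp_all add: Const_def)
  show "pr w 1 = (if w = 0 then 1 else 0)" for w
  proof -
    have "wt_component r w (1 :: 'k mpoly) = (if w = 0 then 1 else 0)"
      unfolding one(2) wt_component_single weight_0 by simp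
    then show ?thesis using pr_proj[OF one(1), of w] by (simp add: proj_1 proj_0)
  qed
  show "Poly_Mapping.keys w \<subseteq> {1..r}" if "w \<in> weights" for w
  proof -
    obtain m where m: "w = weight r m" "m \<in> {m. Poly_Mapping.keys m \<subseteq> {1..n} \<and> mon_degree m < l}"
      using \<open>w \<in> weights\<close> unfolding weights_def by (rule imageE)
    then show ?thesis using keys_weight[of m n r] r(1) by blast
  qed
qed

text \<open>The vectors needed for surjectivity are the classes of \<open>X_1, ..., X_r\<close>,
  available since \<open>r \<le> n\<close>: \<open>min i r = i\<close> gives \<open>X_i\<close> the
  weight \<open>e_i\<close>.\<close>

lemma ex_torus_embedding: "\<exists>\<psi>. torus_embedding smul Basis r \<psi>"
proof
  show "torus_embedding smul Basis r comorphism"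
  proof (rule torus_embedding_comorphism)
    fix i assume i: "i \<in> {1..r}"
    then have V: "Var i \<in> carrier (poly_ring_n n :: 'k mpoly ring)"
      using r(2) by (intro mpoly_ring_Var) simp
    have "Var i \<notin> deg_ideal n 2"
      by (simp add: deg_ideal_def Var_def mon_degree_single)
    then have "proj (Var i) \<noteq> 0" using proj_eq_0_iff[OF V] I_deg(2) by blast
    moreover have "wt_component r (Poly_Mapping.single i 1) (Var i :: 'k mpoly) = Var i"
      using i by (simp add: Var_def wt_component_single weight_single min_absorb1)
    then have "pr (Poly_Mapping.single i 1) (proj (Var i)) = proj (Var i)"
      by (simp only: pr_proj[OF V])
    ultimately show "\<exists>a. a \<noteq> 0 \<and> pr (Poly_Mapping.single i 1) a = a" by blast
  qed
qed

lemma act_proj: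
  assumes p: "p \<in> carrier (poly_ring_n n)" and t: "\<And>i. i \<in> {1..r} \<Longrightarrow> t i \<noteq> 0"
  shows "act (torus_character r t) (proj p) = proj (diag_subst r t (t r) p)"
proof -
  \<comment> \<open>\<open>p\<close> may have weights outside \<open>weights\<close>; they are added
    for \<open>diag_subst_eq\<close> and dropped again because their components vanish in
    \<open>A\<close>.\<close>
  let ?S = "weights \<union> weight r ` Poly_Mapping.keys p"
  have "diag_subst r t (t r) p = (\<Sum>w\<in>?S. Const (torus_character r t w) * wt_component r w p)"
    by (rule diag_subst_eq[OF p r(1) t]) (use finite_W in simp_all)
  also have "proj \<dots> = (\<Sum>w\<in>?S. smul (torus_character r t w) (pr w (proj p)))"
    using proj_Const_mult[OF wt_component_closed[OF p]]
    by (subst proj_sum)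
      (simp_all add: pr_proj[OF p] mpoly_ring_closed mpoly_ring_Const wt_component_closed p del: One_nat_def)
  also have "\<dots> = act (torus_character r t) (proj p)"
    unfolding act_def
    by (rule sum.mono_neutral_right) (use finite_W pr_outside in auto)
  finally show ?thesis by simp
qed

lemma ex_diagonal_automorphism:
  assumes a: "\<forall>i\<in>{1..<r}. a i \<noteq> 0" and \<beta>: "\<beta> \<noteq> 0"
  shows "\<exists>g \<in> identity_component_rational_points smul Basis.
    \<forall>p \<in> carrier (poly_ring_n n). g (proj p) = proj (diag_subst r a \<beta> p)"
proof -
  define t where "t i = (if i < r then a i else \<beta>)" for i
  have t: "t i \<noteq> 0" if "i \<in> {1..r}" for i using that a \<beta> by (simp add: t_def)
  have "(\<lambda>i. Const (if i < r then t i else t r) * Var i) = (\<lambda>i. Const (if i < r then a i else \<beta>) * Var i)"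
    by (auto simp: t_def)
  then have "diag_subst r t (t r) = diag_subst r a \<beta>" by (simp add: diag_subst_def)
  then have "\<forall>p \<in> carrier (poly_ring_n n). act (torus_character r t) (proj p) = proj (diag_subst r a \<beta> p)"
    using act_proj[OF _ t] by simp
  moreover have "act (torus_character r t) \<in> identity_component_rational_points smul Basis"
    by (intro act_identity_component character_torus t)
  ultimately show ?thesis by (rule bexI)
qed

end

section \<open>From diagonal automorphisms to graded ideals\<close>

context presented_algebra
begin

text \<open>A substitution that descends to \<open>A\<close> preserves \<open>I\<close>: the
  automorphism sends the zero class of an element of \<open>I\<close> to zero.\<close>

lemma wt_graded_of_diagonal_automorphisms:
  assumes inf: "infinite (UNIV :: 'k set)" and r: "1 \<le> r"
    and aut: "\<And>a \<beta>. (\<forall>i\<in>{1..<r}. a i \<noteq> 0) \<Longrightarrow> \<beta> \<noteq> 0 \<Longrightarrow>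
      \<exists>g \<in> identity_component_rational_points smul Basis.
        \<forall>p \<in> carrier (poly_ring_n n). g (proj p) = proj (diag_subst r a \<beta> p)"
  shows "wt_graded r I"
proof (rule wt_graded_of_diag_invariant[OF inf ideal_I r])
  fix t :: "nat \<Rightarrow> 'k" and p assume t: "\<And>i. i \<in> {1..r} \<Longrightarrow> t i \<noteq> 0" and p: "p \<in> I"
  have pc: "p \<in> carrier (poly_ring_n n)" using p mpoly_idealD(1)[OF ideal_I] by blast
  have "\<forall>i\<in>{1..<r}. t i \<noteq> 0" "t r \<noteq> 0" using t r by simp_all
  then obtain g where g: "g \<in> identity_component_rational_points smul Basis"
    "g (proj p) = proj (diag_subst r t (t r) p)" using aut pc by blast
  have "g \<in> ring_hom type_ring type_ring"
    using g(1) by (simp add: identity_component_rational_points_def alg_iso_def ring_iso_def)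
  then have "g (0 + 0) = g 0 + g 0" unfolding ring_hom_def type_ring_simps by blast
  then have "proj (diag_subst r t (t r) p) = 0"
    using g(2) proj_eq_0_iff[OF pc] p by simp
  moreover have "diag_subst r t (t r) p \<in> carrier (poly_ring_n n)"
  proof -
    have "diag_subst r t (t r) p =
        (\<Sum>w\<in>weight r ` Poly_Mapping.keys p. Const (torus_character r t w) * wt_component r w p)"
      by (rule diag_subst_eq[OF pc r t]) simp_all
    then show ?thesis
      using wt_component_closed[OF pc] by (simp add: mpoly_ring_sum mpoly_ring_closed mpoly_ring_Const)
  qed
  ultimately show "diag_subst r t (t r) p \<in> I" using proj_eq_0_iff by blast
qed

end

lemma graded_presentation_of_star_or_monomial:
  fixes smul :: "'k::field \<Rightarrow> 'a::comm_ring_1 \<Rightarrow> 'a"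
  assumes "fd_comm_algebra smul Basis" and "1 \<le> r" "r \<le> n"
    and "admissible n I" and "property_star n r I \<or> monomial_ideal n I"
    and "h \<in> presentations smul n I"
  shows "\<exists>l. graded_presentation smul Basis n I h r l"
proof -
  obtain l where "deg_ideal n l \<subseteq> I" "I \<subseteq> deg_ideal n 2"
    using assms(4) unfolding admissible_def var_ideal_power_eq by blast
  moreover have "ideal I (poly_ring_n n)" using assms(4) by (simp add: admissible_def)
  ultimately have "graded_presentation smul Basis n I h r l"
    using assms wt_graded_star_or_monomial[OF assms(4,5)]
    by (intro graded_presentation.intro graded_presentation_axioms.intro presented_algebra.intro
        presented_algebra_axioms.intro)
  then show ?thesis ..
qed

theorem theorem8:
  fixes smul :: "'k::field \<Rightarrow> 'a::comm_ring_1 \<Rightarrow> 'a" and Basis :: "'a set" and n r :: nat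
  assumes "infinite (UNIV :: 'k set)"
    and "fd_comm_algebra smul Basis"
    and "split_local smul"
    and "cotangent_dim smul n"
    and "1 \<le> r" and "r \<le> n"
  shows "(contains_diagonal smul Basis n r \<longleftrightarrow> star_or_monomial_presentation smul n r) \<and>
         (star_or_monomial_presentation smul n r \<longrightarrow> (\<exists>\<psi>. torus_embedding smul Basis r \<psi>))"
proof (intro conjI impI iffI)
  assume "contains_diagonal smul Basis n r"
  then obtain I h where adm: "admissible n I" and h: "h \<in> presentations smul n I"
    and aut: "\<forall>a \<beta>. (\<forall>i\<in>{1..<r}. a i \<noteq> 0) \<longrightarrow> \<beta> \<noteq> 0 \<longrightarrow>
      (\<exists>g \<in> identity_component_rational_points smul Basis. \<forall>p \<in> carrier (poly_ring_n n).
        g (h (I +>\<^bsub>poly_ring_n n\<^esub> p)) = h (I +>\<^bsub>poly_ring_n n\<^esub> diag_subst r a \<beta> p))"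
    unfolding contains_diagonal_def by blast
  interpret presented_algebra smul Basis n I h
    using assms(2) adm h unfolding presented_algebra_def presented_algebra_axioms_def admissible_def by blast
  \<comment> \<open>The presentation is kept; only the generators of \<open>I\<close> are chosen
    anew.\<close>
  have "wt_graded r I"
    by (rule wt_graded_of_diagonal_automorphisms[OF assms(1,5)]) (use aut in \<open>simp add: proj_def\<close>)
  from star_or_monomial_of_wt_graded[OF adm this assms(5)]
  show "star_or_monomial_presentation smul n r"
    unfolding star_or_monomial_presentation_def using adm h by blast
next
  assume "star_or_monomial_presentation smul n r"
  then obtain I h where adm: "admissible n I" and star: "property_star n r I \<or> monomial_ideal n I"
    and h: "h \<in> presentations smul n I"
    unfolding star_or_monomial_presentation_def by blast
  from graded_presentation_of_star_or_monomial[OF assms(2,5,6) this]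
  obtain l where "graded_presentation smul Basis n I h r l" ..
  then interpret graded_presentation smul Basis n I h r l .
  show "\<exists>\<psi>. torus_embedding smul Basis r \<psi>" by (rule ex_torus_embedding)
  show "contains_diagonal smul Basis n r"
    unfolding contains_diagonal_def
  proof (intro exI[of _ I] conjI bexI[of _ h] allI impI adm h)
    fix a :: "nat \<Rightarrow> 'k" and \<beta> :: 'k
    assume "\<forall>i\<in>{1..<r}. a i \<noteq> 0" "\<beta> \<noteq> (0::'k)"
    from ex_diagonal_automorphism[OF this]
    show "\<exists>g\<in>identity_component_rational_points smul Basis. \<forall>p\<in>carrier (poly_ring_n n).
        g (h (I +>\<^bsub>poly_ring_n n\<^esub> p)) = h (I +>\<^bsub>poly_ring_n n\<^esub> diag_subst r a \<beta> p)"
      unfolding proj_def .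
  qed
qed

end
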